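(* Every zero $s=\sigma+it$ of $\eta'$ with $\sigma\le 0$ is real, and for every positive integer $n$ the function $\eta'$ has exactly one real zero in the open interval $(-2n-2,-2n)$.
   Context: $\eta$ is the Euler (Dirichlet) eta function, $\eta(s)=\sum_{n\ge 1}(-1)^{n+1}n^{-s}$ for $\Re(s)>0$, extended to an entire function by $\eta(s)=(1-2^{1-s})\zeta(s)$, where $\zeta$ is the Riemann zeta function. $\eta'$ is its derivative. *)

theory Defs
  imports "HOL-Complex_Analysis.Complex_Analysis"
begin

text \<open>
  The series is indexed from 0, so its term with index \<open>n\<close> is the mathematical term
  \<open>(-1)^(m+1) m^(-s)\<close> with \<open>m = n + 1\<close>. The facts below show that this description determines
  exactly one function, and that this function is \<open>(1 - 2^(1-s)) \<zeta>(s)\<close>.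
\<close>
definition dirichlet_eta :: "complex \<Rightarrow> complex" where
  "dirichlet_eta = (THE f. f holomorphic_on UNIV \<and>
     (\<forall>s. Re s > 0 \<longrightarrow> (\<lambda>n. (-1) ^ n * of_nat (Suc n) powr (-s)) sums f s))"

text \<open>
  Existence is proved with the Euler transform: \<open>eta_diff k s\<close> is \<open>(-1)^k\<close> times the \<open>k\<close>-th forward
  difference of \<open>z^(-s)\<close> in \<open>z\<close>; each difference gains a factor \<open>1/z\<close> of decay, which moves
  the abscissa of convergence one unit to the left.
\<close>
primrec eta_diff :: "nat \<Rightarrow> complex \<Rightarrow> complex \<Rightarrow> complex" where
  "eta_diff 0 s z = z powr (-s)"
| "eta_diff (Suc k) s z = eta_diff k s z - eta_diff k s (z + 1)"

lemma eta_diff_deriv: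
  assumes "Re z > 0"
  shows "(eta_diff k s has_field_derivative (-s * eta_diff k (s + 1) z)) (at z within A)"
  using assms
proof (induction k arbitrary: z A)
  case 0
  have *: "z \<notin> \<real>\<^sub>\<le>\<^sub>0" using 0 by (auto simp: complex_nonpos_Reals_iff)
  have e: "eta_diff 0 s = (\<lambda>z. z powr (-s))" by (simp add: fun_eq_iff)
  have "((\<lambda>z. z powr (-s)) has_field_derivative (-s) * z powr (-s - 1)) (at z within A)"
    using has_field_derivative_powr[OF *, of "-s"] has_field_derivative_at_within by blast
  then show ?case unfolding e by simp
next
  case (Suc k)
  have e: "eta_diff (Suc k) s = (\<lambda>z. eta_diff k s z - eta_diff k s (z + 1))"
    by (simp add: fun_eq_iff)
  have 1: "(eta_diff k s has_field_derivative (-s * eta_diff k (s + 1) z)) (at z within A)"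
    by (rule Suc.IH) (use Suc.prems in simp)
  have 2: "(eta_diff k s has_field_derivative (-s * eta_diff k (s + 1) (z + 1))) (at (z + 1))"
    by (rule Suc.IH) (use Suc.prems in simp)
  have 3: "((\<lambda>z. z + 1) has_field_derivative 1) (at z within A)"
    by (auto intro!: derivative_eq_intros)
  have 4: "((\<lambda>z. eta_diff k s (z + 1)) has_field_derivative (-s * eta_diff k (s + 1) (z + 1)) * 1)
      (at z within A)"
    using DERIV_chain2[OF 2 3] .
  show ?case unfolding e
    using DERIV_diff[OF 1 4] by (simp add: algebra_simps)
qed

lemma eta_diff_bound:
  assumes "x > 0" "Re s + real k \<ge> 0"
  shows "norm (eta_diff k s (of_real x)) \<le> (norm s + real k) ^ k * x powr (- Re s - real k)"
  using assms
proof (induction k arbitrary: s x)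
  case 0
  then show ?case by (simp add: norm_powr_real_powr)
next
  case (Suc k)
  define B where "B = norm s * ((norm s + 1 + real k) ^ k * x powr (- Re s - 1 - real k))"
  have "norm (eta_diff k s (of_real (x + 1)) - eta_diff k s (of_real x))
      \<le> B * norm (of_real (x + 1) - of_real x :: complex)"
  proof (rule field_differentiable_bound)
    show "convex (closed_segment (of_real x) (of_real (x + 1) :: complex))" by simp
  next
    fix z :: complex assume z: "z \<in> closed_segment (of_real x) (of_real (x + 1))"
    then obtain y where y: "z = of_real y" "x \<le> y"
      unfolding closed_segment_of_real by (auto simp: closed_segment_eq_real_ivl split: if_splits)
    show "(eta_diff k s has_field_derivative (-s * eta_diff k (s + 1) z))
        (at z within closed_segment (of_real x) (of_real (x + 1)))"
      by (rule eta_diff_deriv) (use y Suc.prems in auto)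
    have "norm (eta_diff k (s + 1) z) \<le>
        (norm (s + 1) + real k) ^ k * y powr (- Re (s + 1) - real k)"
      unfolding y by (rule Suc.IH) (use y Suc.prems in auto)
    also have "\<dots> \<le> (norm s + 1 + real k) ^ k * x powr (- Re s - 1 - real k)"
    proof (rule mult_mono)
      have "norm (s + 1) \<le> norm s + 1" by (metis norm_triangle_ineq norm_one)
      then show "(norm (s + 1) + real k) ^ k \<le> (norm s + 1 + real k) ^ k"
        by (intro power_mono) auto
      show "y powr (- Re (s + 1) - real k) \<le> x powr (- Re s - 1 - real k)"
        using powr_mono2'[of "- Re s - 1 - real k" x y] y Suc.prems by simp
    qed auto
    finally show "norm (-s * eta_diff k (s + 1) z) \<le> B"
      unfolding B_def by (simp add: norm_mult mult_left_mono)
  qed auto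
  also have "norm (of_real (x + 1) - of_real x :: complex) = 1" by simp
  finally have "norm (eta_diff (Suc k) s (of_real x)) \<le> B"
    by (simp add: norm_minus_commute)
  also have "B = norm s * (norm s + real (Suc k)) ^ k * x powr (- Re s - real (Suc k))"
    by (simp add: B_def algebra_simps)
  also have "\<dots> \<le> (norm s + real (Suc k)) ^ Suc k * x powr (- Re s - real (Suc k))"
    by (simp add: mult_right_mono)
  finally show ?case .
qed

lemma eta_diff_holomorphic: "z \<noteq> 0 \<Longrightarrow> Re z \<ge> 0 \<Longrightarrow> (\<lambda>s. eta_diff k s z) holomorphic_on A"
proof (induction k arbitrary: z)
  case 0
  then show ?case by (auto intro!: holomorphic_intros)
next
  case (Suc k)
  have "z + 1 \<noteq> 0" "Re (z + 1) \<ge> 0" using Suc.prems by (auto simp: complex_eq_iff)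
  then show ?case using Suc by (auto intro!: holomorphic_intros)
qed

lemma alternating_sums_diff:
  fixes a :: "nat \<Rightarrow> complex"
  assumes "a \<longlonglongrightarrow> 0" and "(\<lambda>n. (-1) ^ n * (a n - a (Suc n))) sums L"
  shows "(\<lambda>n. (-1) ^ n * a n) sums ((a 0 + L) / 2)"
proof -
  have eq: "(\<Sum>n<N. (-1) ^ n * a n) =
      (a 0 + (\<Sum>n<N. (-1) ^ n * (a n - a (Suc n))) - (-1) ^ N * a N) / 2" for N
    by (induction N) (auto simp: field_simps)
  have "(\<lambda>N. (-1) ^ N * a N) \<longlonglongrightarrow> 0"
    using assms(1) by (subst tendsto_norm_zero_iff [symmetric])
      (simp add: norm_mult norm_power tendsto_norm_zero)
  then have "(\<lambda>N. (a 0 + (\<Sum>n<N. (-1) ^ n * (a n - a (Suc n))) - (-1) ^ N * a N) / 2)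
      \<longlonglongrightarrow> (a 0 + L - 0) / 2"
    by (intro tendsto_intros assms(2)[unfolded sums_def]) auto
  then show ?thesis unfolding sums_def eq by simp
qed

lemma eta_diff_tendsto:
  assumes "Re s + real k > 0"
  shows "(\<lambda>n. eta_diff k s (of_nat (Suc n))) \<longlonglongrightarrow> 0"
proof (rule Lim_null_comparison)
  show "\<forall>\<^sub>F n in sequentially. norm (eta_diff k s (of_nat (Suc n)))
      \<le> (norm s + real k) ^ k * real (Suc n) powr (- Re s - real k)"
    using eta_diff_bound[of "real (Suc _)" s k] assms
    by (intro always_eventually) (auto simp del: of_nat_Suc)
  have "(\<lambda>n. real (Suc n) powr (- (Re s + real k))) \<longlonglongrightarrow> 0"
    by (intro tendsto_neg_powr filterlim_compose[OF filterlim_real_sequentially filterlim_Suc])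
      (use assms in simp)
  then show "(\<lambda>n. (norm s + real k) ^ k * real (Suc n) powr (- Re s - real k)) \<longlonglongrightarrow> 0"
    by (intro tendsto_mult_right_zero) (simp add: algebra_simps)
qed

lemma summable_Suc_powr: "a > 1 \<Longrightarrow> summable (\<lambda>n. real (Suc n) powr (- a))"
  by (subst summable_Suc_iff) (simp add: summable_real_powr_iff)

lemma eta_diff_summable:
  assumes "Re s + real k > 1"
  shows "summable (\<lambda>n. (-1) ^ n * eta_diff k s (of_nat (Suc n)))"
proof (rule summable_comparison_test)
  show "\<exists>N. \<forall>n\<ge>N. norm ((-1) ^ n * eta_diff k s (of_nat (Suc n)))
      \<le> (norm s + real k) ^ k * real (Suc n) powr (- (Re s + real k))"
    using eta_diff_bound[of "real (Suc _)" s k] assms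
    by (intro exI[of _ 0]) (auto simp: norm_mult norm_power algebra_simps simp del: of_nat_Suc)
qed (intro summable_mult summable_Suc_powr assms)

definition eta_trans :: "nat \<Rightarrow> complex \<Rightarrow> complex" where
  "eta_trans k s = (\<Sum>j<k. eta_diff j s 1 / 2 ^ Suc j)
     + (\<Sum>n. (-1) ^ n * eta_diff k s (of_nat (Suc n))) / 2 ^ k"

lemma eta_trans_sums:
  assumes "Re s + real k > 0"
  shows "(\<lambda>n. (-1) ^ n * eta_diff k s (of_nat (Suc n))) sums
    ((eta_diff k s 1 + (\<Sum>n. (-1) ^ n * eta_diff (Suc k) s (of_nat (Suc n)))) / 2)"
proof -
  have "(\<lambda>n. (-1) ^ n * eta_diff (Suc k) s (of_nat (Suc n))) sums
      (\<Sum>n. (-1) ^ n * eta_diff (Suc k) s (of_nat (Suc n)))"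
    by (intro summable_sums eta_diff_summable) (use assms in auto)
  from alternating_sums_diff[OF eta_diff_tendsto[OF assms], of "(\<Sum>n. (-1) ^ n * eta_diff (Suc k) s (of_nat (Suc n)))"] this
  show ?thesis by (simp add: algebra_simps)
qed

lemma eta_trans_Suc:
  assumes "Re s + real k > 0"
  shows "eta_trans (Suc k) s = eta_trans k s"
proof -
  have "(\<Sum>n. (-1) ^ n * eta_diff k s (of_nat (Suc n))) =
      (eta_diff k s 1 + (\<Sum>n. (-1) ^ n * eta_diff (Suc k) s (of_nat (Suc n)))) / 2"
    using sums_unique[OF eta_trans_sums[OF assms]] by simp
  then show ?thesis
    unfolding eta_trans_def by (simp add: add_divide_distrib del: eta_diff.simps of_nat_Suc)
qed

lemma eta_trans_eq:
  assumes "k \<le> m" "Re s + real k > 0"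
  shows "eta_trans m s = eta_trans k s"
  using assms by (induction m rule: dec_induct) (auto simp: eta_trans_Suc)

lemma eta_trans_holomorphic: "eta_trans k holomorphic_on {s. Re s > 1 - real k}"
proof -
  let ?S = "{s. Re s > 1 - real k}"
  have op: "open ?S" by (rule open_halfspace_Re_gt)
  have "(\<lambda>s. \<Sum>n. (-1) ^ n * eta_diff k s (of_nat (Suc n))) holomorphic_on ?S"
  proof (rule holomorphic_uniform_sequence[OF op])
    show "(\<lambda>s. \<Sum>n<N. (-1) ^ n * eta_diff k s (of_nat (Suc n))) holomorphic_on ?S" for N
      by (intro holomorphic_intros eta_diff_holomorphic) (auto simp del: of_nat_Suc)
  next
    fix s assume s: "s \<in> ?S"
    define d where "d = (Re s + real k - 1) / 2"
    have d: "d > 0" "Re s + real k - d > 1" using s by (auto simp: d_def field_simps)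
    have Re: "Re x \<ge> Re s - d" "norm x \<le> norm s + d" if "x \<in> cball s d" for x
    proof -
      have "\<bar>Re (s - x)\<bar> \<le> d"
        using that abs_Re_le_cmod[of "s - x"] by (simp add: dist_norm)
      then show "Re x \<ge> Re s - d" by simp
      have "norm (x - s) \<le> d" using that by (simp add: dist_norm norm_minus_commute)
      then show "norm x \<le> norm s + d" using norm_triangle_ineq2[of x s] by simp
    qed
    have "uniform_limit (cball s d)
        (\<lambda>N x. \<Sum>n<N. (-1) ^ n * eta_diff k x (of_nat (Suc n)))
        (\<lambda>x. \<Sum>n. (-1) ^ n * eta_diff k x (of_nat (Suc n))) sequentially"
    proof (rule Weierstrass_m_test)
      fix n x assume x: "x \<in> cball s d"
      have "norm (eta_diff k x (of_real (real (Suc n))))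
          \<le> (norm x + real k) ^ k * real (Suc n) powr (- Re x - real k)"
        by (rule eta_diff_bound) (use d Re[OF x] in auto)
      also have "\<dots> \<le> (norm s + d + real k) ^ k * real (Suc n) powr (- (Re s + real k - d))"
        by (intro mult_mono power_mono powr_mono) (use d Re[OF x] in auto)
      finally show "norm ((-1) ^ n * eta_diff k x (of_nat (Suc n)))
          \<le> (norm s + d + real k) ^ k * real (Suc n) powr (- (Re s + real k - d))"
        by (simp add: norm_mult norm_power del: of_nat_Suc)
    qed (intro summable_mult summable_Suc_powr d)
    moreover have "cball s d \<subseteq> ?S" using Re d by fastforce
    ultimately show "\<exists>d. 0 < d \<and> cball s d \<subseteq> ?S \<and> uniform_limit (cball s d)
        (\<lambda>N x. \<Sum>n<N. (-1) ^ n * eta_diff k x (of_nat (Suc n)))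
        (\<lambda>x. \<Sum>n. (-1) ^ n * eta_diff k x (of_nat (Suc n))) sequentially"
      using d by blast
  qed
  then show ?thesis unfolding eta_trans_def
    by (intro holomorphic_intros eta_diff_holomorphic) auto
qed

lemma dirichlet_eta_exists:
  "\<exists>f. f holomorphic_on UNIV \<and>
     (\<forall>s. Re s > 0 \<longrightarrow> (\<lambda>n. (-1) ^ n * of_nat (Suc n) powr (-s)) sums f s)"
proof -
  define f where "f = (\<lambda>s. eta_trans (nat \<lceil>2 - Re s\<rceil>) s)"
  have f: "f s = eta_trans k s" if "Re s + real k > 0" for s k
  proof -
    have "Re s + real (nat \<lceil>2 - Re s\<rceil>) > 0" by linarith
    then show ?thesis unfolding f_def
      using that eta_trans_eq[of k _ s] eta_trans_eq[of _ k s] nle_le by metis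
  qed
  have "f field_differentiable at s" for s
  proof -
    define k where "k = nat \<lceil>2 - Re s\<rceil>"
    have k: "Re s > 1 - real k" unfolding k_def by linarith
    have op: "open {s. Re s > 1 - real k}" by (rule open_halfspace_Re_gt)
    have "f holomorphic_on {s. Re s > 1 - real k} \<longleftrightarrow>
        eta_trans k holomorphic_on {s. Re s > 1 - real k}"
      by (rule holomorphic_cong) (auto intro!: f)
    then show ?thesis
      using eta_trans_holomorphic[of k] op k by (auto simp: holomorphic_on_open field_differentiable_def)
  qed
  then have "f holomorphic_on UNIV"
    by (simp add: holomorphic_on_def)
  moreover have "(\<lambda>n. (-1) ^ n * of_nat (Suc n) powr (-s)) sums f s" if "Re s > 0" for s
    using eta_trans_sums[of s 0] f[of s 0] that
    by (simp add: eta_trans_def sums_iff del: of_nat_Suc)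
  ultimately show ?thesis by blast
qed

lemma dirichlet_eta_unique:
  assumes "f holomorphic_on UNIV" "g holomorphic_on UNIV"
    and "\<And>s. Re s > 0 \<Longrightarrow> (\<lambda>n. (-1) ^ n * of_nat (Suc n) powr (-s)) sums f s"
    and "\<And>s. Re s > 0 \<Longrightarrow> (\<lambda>n. (-1) ^ n * of_nat (Suc n) powr (-s)) sums g s"
  shows "f = g"
proof
  fix s
  show "f s = g s"
  proof (rule analytic_continuation_open[of "{s. Re s > 0}" UNIV f g])
    show "open {s. Re s > 0}" by (rule open_halfspace_Re_gt)
    show "{s. Re s > 0} \<noteq> {}" by (auto intro: exI[of _ 1])
    show "f z = g z" if "z \<in> {s. Re s > 0}" for z
      using sums_unique2[OF assms(3,4)[of z]] that by simp
  qed (use assms in auto)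
qed

lemma dirichlet_eta_spec:
  "dirichlet_eta holomorphic_on UNIV \<and>
     (\<forall>s. Re s > 0 \<longrightarrow> (\<lambda>n. (-1) ^ n * of_nat (Suc n) powr (-s)) sums dirichlet_eta s)"
proof -
  have "\<exists>!f. f holomorphic_on UNIV \<and>
     (\<forall>s. Re s > 0 \<longrightarrow> (\<lambda>n. (-1) ^ n * of_nat (Suc n) powr (-s)) sums f s)"
    using dirichlet_eta_exists dirichlet_eta_unique by (auto simp: Ex1_def)
  then show ?thesis unfolding dirichlet_eta_def by (rule theI')
qed

lemma dirichlet_eta_holomorphic: "dirichlet_eta holomorphic_on A"
  using dirichlet_eta_spec holomorphic_on_subset by blast

lemma dirichlet_eta_sums:
  "Re s > 0 \<Longrightarrow> (\<lambda>n. (-1) ^ n * of_nat (Suc n) powr (-s)) sums dirichlet_eta s"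
  using dirichlet_eta_spec by blast

text \<open>
  \<open>Z\<close> stands for the Riemann zeta function: the analytic continuation to \<open>- {1}\<close> of its
  Dirichlet series.
\<close>
lemma dirichlet_eta_eq_zeta:
  assumes Z: "Z holomorphic_on - {1}"
    and Zs: "\<And>s. Re s > 1 \<Longrightarrow> (\<lambda>n. of_nat (Suc n) powr (-s)) sums Z s"
    and s: "s \<noteq> 1"
  shows "dirichlet_eta s = (1 - 2 powr (1 - s)) * Z s"
proof (rule analytic_continuation_open[of "{s. Re s > 1}" "- {1}" dirichlet_eta
      "\<lambda>s. (1 - 2 powr (1 - s)) * Z s"])
  show "open {s. Re s > 1}" by (rule open_halfspace_Re_gt)
  show "{s. Re s > 1} \<noteq> {}" by (auto intro: exI[of _ 2])
  show "connected (- {1::complex})"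
    by (rule connected_punctured_universe) simp
  show "(\<lambda>s. (1 - 2 powr (1 - s)) * Z s) holomorphic_on - {1}"
    by (intro holomorphic_intros Z)
next
  fix s :: complex assume "s \<in> {s. Re s > 1}"
  then have s: "Re s > 1" by simp
  define a where "a = (\<lambda>n. of_nat (Suc n) powr (-s) :: complex)"
  have a: "a sums Z s" using Zs[OF s] by (simp add: a_def)
  have "(\<lambda>n. if even n then 0 else a (n div 2)) sums Z s"
    using a sums_mono_reindex[of "\<lambda>n. 2 * n + 1" "\<lambda>n. if even n then 0 else a (n div 2)" "Z s"]
    by (fastforce simp: strict_mono_def elim!: oddE)
  then have "(\<lambda>n. a n - 2 powr (1 - s) * (if even n then 0 else a (n div 2)))
      sums (Z s - 2 powr (1 - s) * Z s)"
    by (intro sums_diff a sums_mult)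
  also have "(\<lambda>n. a n - 2 powr (1 - s) * (if even n then 0 else a (n div 2)))
      = (\<lambda>n. (-1) ^ n * a n)"
  proof
    fix n show "a n - 2 powr (1 - s) * (if even n then 0 else a (n div 2)) = (-1) ^ n * a n"
    proof (cases "even n")
      case False
      then obtain m where m: "n = 2 * m + 1" by (elim oddE)
      have "a n = (2 * of_nat (Suc m)) powr (-s)" by (simp add: a_def m algebra_simps)
      also have "\<dots> = 2 powr (-s) * a m"
        unfolding a_def by (subst powr_times_real) (auto simp del: of_nat_Suc)
      finally have "2 powr (1 - s) * a m = 2 * a n"
        by (simp add: powr_diff powr_minus field_simps)
      then show ?thesis using m by simp
    qed auto
  qed
  finally have "(\<lambda>n. (-1) ^ n * a n) sums (Z s - 2 powr (1 - s) * Z s)" .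
  moreover have "(\<lambda>n. (-1) ^ n * a n) sums dirichlet_eta s"
    using dirichlet_eta_sums[of s] s by (simp add: a_def)
  ultimately show "dirichlet_eta s = (1 - 2 powr (1 - s)) * Z s"
    using sums_unique2 by (fastforce simp: algebra_simps)
qed (use s dirichlet_eta_holomorphic in auto)

end

theory Submission
  imports Defs "HOL-Real_Asymp.Real_Asymp"
begin

text \<open>
  Put \<open>w = 1 - s\<close>, \<open>u = Re w\<close>, \<open>v = Im w\<close>; by conjugation \<open>v > 0\<close> may be assumed for a non-real zero \<open>s\<close> of
  \<open>\<eta>'\<close>. Three arguments cover the half-plane \<open>u \<ge> 1\<close>.

  For \<open>v \<ge> 33/10\<close> write \<open>\<eta> (1 - w) = K w * \<xi> w\<close> with an explicit factor \<open>K\<close>. The functional equation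
  and the Phragmen-Lindelof principle show that \<open>\<bar>\<xi>\<bar>\<close> does not decrease along horizontal lines to the right of
  \<open>Re w = 1\<close>, so \<open>Re (\<xi>' / \<xi>) \<ge> 0\<close>, while \<open>Re (K' / K) > 0\<close>; the sum cannot vanish. On \<open>Re w = 1\<close> this
  works also at zeros of \<open>\<xi>\<close>, which could only be simple.

  For \<open>u \<ge> 5/2\<close> and \<open>v \<le> 33/10\<close> the logarithmic derivative of
  \<open>\<eta> (1 - w) = - 2 \<pi>^(-w) cos (\<pi> w / 2) \<Gamma> w \<lambda> w\<close>, where \<open>\<lambda>\<close> is the sum of \<open>n^(-w)\<close> over odd \<open>n\<close>, has
  negative imaginary part, since the tangent dominates \<open>\<psi> + \<lambda>' / \<lambda>\<close>.

  In the remaining box \<open>\<eta>'\<close> is computed by Boole summation with an explicit error.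

  On the real line the trivial zeros of \<open>\<eta>\<close> and Rolle's theorem give a zero in each interval, and the
  logarithmic derivative is strictly monotone between consecutive trivial zeros, so it is unique.
\<close>

section \<open>The zeta function to the right of \<open>Re s = -1\<close>\<close>

text \<open>The obstacle to monotonicity of \<open>\<bar>\<xi>\<bar>\<close> is growth: \<xi> obeys
  no polynomial bound in a half-plane. Therefore only quotients of \<xi> at horizontally shifted
  arguments enter. In them the Gamma factors nearly cancel, and what remains is polynomial growth of
  the zeta factor in the numerator and a positive lower bound for the one in the denominator. Such
  quotients have modulus at most 1 on a suitable vertical line because the symmetry under
  \<open>w -> 1 - w\<close>, combined with conjugation, pairs the two arguments.

  The height 33/10 lies just above the square root of \<open>1 + pi^2\<close>: from there on the
  lower bound used for the real part of \<psi> at \<open>(w - 1) / 2\<close> reaches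
  \<open>ln (pi / 2)\<close>, and all logarithms in \<open>K' / K\<close> balance up to
  \<open>ln 2 / 6\<close>. Closer to the real axis real parts give no sign, but the imaginary part
  of the tangent does. The abscissa 5/2 makes the derivatives of \<lambda> comparable to sums of
  inverse squares, so that \<open>\<lambda>' / \<lambda>\<close> is small. The box that remains is
  compact and close to the origin, where a short asymptotic expansion is already accurate
  enough.\<close>

lemma Re_pos_not_nonpos_Ints: "Re z > 0 \<Longrightarrow> z \<notin> \<int>\<^sub>\<le>\<^sub>0"
  by (metis nonpos_Ints_subset_nonpos_Reals complex_nonpos_Reals_iff not_le subsetD)

lemma Im_nonzero_not_nonpos_Ints: "Im z \<noteq> 0 \<Longrightarrow> z \<notin> \<int>\<^sub>\<le>\<^sub>0"
  by (metis nonpos_Ints_subset_nonpos_Reals complex_nonpos_Reals_iff subsetD)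

lemma has_vector_derivative_of_real_powr:
  fixes a :: complex and x :: real
  assumes "x > 0"
  shows "((\<lambda>x. of_real x powr a) has_vector_derivative a * of_real x powr (a - 1)) (at x within A)"
  by (rule has_vector_derivative_real_field, rule has_field_derivative_powr) (use assms in auto)

text \<open>\<open>G\<close> comes from integrating by parts twice against the Peano kernel
  \<open>(t^2 - t) / 2\<close> with \<open>t = x - a\<close>. The absolute value of this kernel has
  integral 1/12 over the cell, and \<open>\<phi>\<close> is a primitive of \<open>M\<close> times
  it.\<close>

lemma trapezoid_error:
  fixes A f f' f'' :: "real \<Rightarrow> complex" and a M :: real
  assumes A: "\<And>x. a \<le> x \<Longrightarrow> x \<le> a + 1 \<Longrightarrow> (A has_vector_derivative f x) (at x)"
    and f: "\<And>x. a \<le> x \<Longrightarrow> x \<le> a + 1 \<Longrightarrow> (f has_vector_derivative f' x) (at x)"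
    and f1: "\<And>x. a \<le> x \<Longrightarrow> x \<le> a + 1 \<Longrightarrow> (f' has_vector_derivative f'' x) (at x)"
    and M: "\<And>x. a \<le> x \<Longrightarrow> x \<le> a + 1 \<Longrightarrow> norm (f'' x) \<le> M"
  shows "norm (A (a + 1) - A a - (f a + f (a + 1)) / 2) \<le> M / 12"
proof -
  define G where "G = (\<lambda>x. (((x-a)^2 - (x-a)) / 2) *\<^sub>R f' x - (x - a - 1/2) *\<^sub>R f x + A x)"
  define \<phi> where "\<phi> = (\<lambda>x. M * ((x-a)^2/4 - (x-a)^3/6))"
  have G: "(G has_vector_derivative (((x-a)^2 - (x-a)) / 2) *\<^sub>R f'' x) (at x)"
    if x: "a \<le> x" "x \<le> a + 1" for x
  proof -
    have 1: "((\<lambda>x. (((x-a)^2 - (x-a)) / 2) *\<^sub>R f' x) has_vector_derivative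
        (((x-a)^2 - (x-a)) / 2) *\<^sub>R f'' x + (x - a - 1/2) *\<^sub>R f' x) (at x)"
      by (rule has_vector_derivative_scaleR[OF _ f1[OF x]])
        (auto intro!: derivative_eq_intros simp: field_simps)
    have 2: "((\<lambda>x. (x - a - 1/2) *\<^sub>R f x) has_vector_derivative
        (x - a - 1/2) *\<^sub>R f' x + 1 *\<^sub>R f x) (at x)"
      by (rule has_vector_derivative_scaleR[OF _ f[OF x]])
        (auto intro!: derivative_eq_intros)
    show ?thesis unfolding G_def
      using has_vector_derivative_add[OF has_vector_derivative_diff[OF 1 2] A[OF x]]
      by (simp add: algebra_simps)
  qed
  have \<phi>: "(\<phi> has_vector_derivative M * ((x-a) - (x-a)^2) / 2) (at x)" for x
    unfolding \<phi>_def has_real_derivative_iff_has_vector_derivative[symmetric]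
    by (auto intro!: derivative_eq_intros simp: field_simps power2_eq_square)
  have "norm (G (a + 1) - G a) \<le> \<phi> (a + 1) - \<phi> a"
  proof (rule differentiable_bound_general)
    show "continuous_on {a..a+1} G"
      by (rule continuous_on_vector_derivative) (use G has_vector_derivative_at_within in fastforce)
    show "continuous_on {a..a+1} \<phi>"
      unfolding \<phi>_def by (intro continuous_intros) auto
    fix x assume x: "a < x" "x < a + 1"
    have "\<bar>((x-a)^2 - (x-a)) / 2\<bar> = ((x-a) - (x-a)^2) / 2"
      using x by (simp add: power2_eq_square mult_left_le)
    then have "norm ((((x-a)^2 - (x-a)) / 2) *\<^sub>R f'' x) = ((x-a) - (x-a)^2) / 2 * norm (f'' x)"
      by simp
    also have "\<dots> \<le> ((x-a) - (x-a)^2) / 2 * M"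
      by (intro mult_left_mono M) (use x in \<open>auto simp: power2_eq_square mult_left_le\<close>)
    finally show "norm ((((x-a)^2 - (x-a)) / 2) *\<^sub>R f'' x) \<le> M * ((x-a) - (x-a)^2) / 2"
      by (simp add: algebra_simps)
  qed (use G \<phi> in auto)
  moreover have "G (a + 1) - G a = A (a + 1) - A a - (f a + f (a + 1)) / 2"
    by (simp add: G_def algebra_simps add_divide_distrib scaleR_conv_of_real)
  ultimately show ?thesis by (simp add: \<phi>_def)
qed

text \<open>\<open>pole_free_zeta s\<close> is \<open>(s - 1) \<zeta> s\<close>; the trapezoidal errors \<open>zeta_term n s\<close> continue it to
  \<open>Re s > -1\<close>, where the series converges.\<close>
definition zeta_term :: "nat \<Rightarrow> complex \<Rightarrow> complex" where
  "zeta_term n s = (s - 1) / 2 * (of_nat (Suc n) powr (-s) + of_nat (Suc (Suc n)) powr (-s))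
     + of_nat (Suc (Suc n)) powr (1 - s) - of_nat (Suc n) powr (1 - s)"

text \<open>Up to sign the term is the trapezoidal error for \<open>(s - 1) * x powr (-s)\<close>.
  Its primitive \<open>- (x powr (1 - s))\<close> is regular at \<open>s = 1\<close>, so the pole of
  zeta never arises, and the second derivative in \<open>x\<close> supplies two extra powers of
  decay.\<close>

lemma zeta_term_bound:
  assumes "Re s \<ge> -2"
  shows "norm (zeta_term n s) \<le> norm ((s - 1) * s * (s + 1)) / 12 * real (Suc n) powr (- Re s - 2)"
proof -
  define a where "a = real (Suc n)"
  have a: "a > 0" by (simp add: a_def)
  have "norm (- (of_real (a + 1) powr (1 - s)) - - (of_real a powr (1 - s)) -
      ((s - 1) * of_real a powr (-s) + (s - 1) * of_real (a + 1) powr (-s)) / 2)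
      \<le> (norm ((s - 1) * s * (s + 1)) * a powr (- Re s - 2)) / 12"
  proof (rule trapezoid_error[where f' = "\<lambda>x. (s - 1) * (-s * of_real x powr (-s-1))"
        and f'' = "\<lambda>x. (s - 1) * (-s * ((-s-1) * of_real x powr (-s-1-1)))"
        and A = "\<lambda>x. - (of_real x powr (1 - s))" and f = "\<lambda>x. (s - 1) * of_real x powr (-s)"])
    fix x assume x: "a \<le> x" "x \<le> a + 1"
    have x0: "x > 0" using x a by simp
    show "((\<lambda>x. - (of_real x powr (1 - s))) has_vector_derivative (s - 1) * of_real x powr (-s)) (at x)"
      using has_vector_derivative_minus[OF has_vector_derivative_of_real_powr[OF x0, of "1 - s"]]
      by (simp add: algebra_simps)
    show "((\<lambda>x. (s - 1) * of_real x powr (-s)) has_vector_derivative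
        (s - 1) * (-s * of_real x powr (-s-1))) (at x)"
      by (intro has_vector_derivative_mult_right has_vector_derivative_of_real_powr x0)
    show "((\<lambda>x. (s - 1) * (-s * of_real x powr (-s-1))) has_vector_derivative
        (s - 1) * (-s * ((-s-1) * of_real x powr (-s-1-1)))) (at x)"
      by (intro has_vector_derivative_mult_right has_vector_derivative_of_real_powr x0)
    have "norm ((s - 1) * (-s * ((-s-1) * of_real x powr (-s-1-1))))
        = norm ((s - 1) * s * (s + 1)) * x powr (- Re s - 2)"
    proof -
      have "norm (-s-1) = norm (s + 1)" by (metis minus_add_distrib norm_minus_cancel uminus_add_conv_diff diff_conv_add_uminus)
      moreover have "norm (of_real x powr (-s-1-1) :: complex) = x powr (- Re s - 2)"
        using x0 norm_powr_real_powr[of "of_real x" "-s-1-1"] by (simp add: algebra_simps)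
      ultimately show ?thesis by (simp add: norm_mult)
    qed
    also have "\<dots> \<le> norm ((s - 1) * s * (s + 1)) * a powr (- Re s - 2)"
      by (intro mult_left_mono powr_mono2') (use x a assms in auto)
    finally show "norm ((s - 1) * (-s * ((-s-1) * of_real x powr (-s-1-1))))
      \<le> norm ((s - 1) * s * (s + 1)) * a powr (- Re s - 2)" .
  qed
  moreover have "- (of_real (a + 1) powr (1 - s)) - - (of_real a powr (1 - s)) -
      ((s - 1) * of_real a powr (-s) + (s - 1) * of_real (a + 1) powr (-s)) / 2 = - zeta_term n s"
    by (simp add: zeta_term_def a_def field_simps)
  ultimately show ?thesis by (simp add: a_def)
qed

definition pole_free_zeta :: "complex \<Rightarrow> complex" where
  "pole_free_zeta s = 1 + (s - 1) / 2 + (\<Sum>n. zeta_term n s)"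

lemma summable_zeta_term:
  assumes "Re s > -1"
  shows "summable (\<lambda>n. zeta_term n s)"
proof (rule summable_comparison_test)
  show "\<exists>N. \<forall>n\<ge>N. norm (zeta_term n s)
      \<le> norm ((s - 1) * s * (s + 1)) / 12 * real (Suc n) powr (- (Re s + 2))"
    using zeta_term_bound[of s] assms by (intro exI[of _ 0]) (auto simp del: of_nat_Suc)
qed (intro summable_mult summable_Suc_powr, use assms in simp)

lemma pole_free_zeta_holomorphic: "pole_free_zeta holomorphic_on {s. Re s > -1}"
proof -
  let ?S = "{s. Re s > -1}"
  have "(\<lambda>s. \<Sum>n. zeta_term n s) holomorphic_on ?S"
  proof (rule holomorphic_uniform_sequence)
    show "open ?S" by (rule open_halfspace_Re_gt)
    show "(\<lambda>s. \<Sum>n<N. zeta_term n s) holomorphic_on ?S" for N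
      unfolding zeta_term_def by (auto intro!: holomorphic_intros simp del: of_nat_Suc)
  next
    fix s assume s: "s \<in> ?S"
    define d where "d = (Re s + 1) / 2"
    have d: "d > 0" "Re s - d > -1" using s by (auto simp: d_def field_simps)
    have Re: "Re x \<ge> Re s - d" "norm x \<le> norm s + d" if "x \<in> cball s d" for x
    proof -
      have "\<bar>Re (s - x)\<bar> \<le> d"
        using that abs_Re_le_cmod[of "s - x"] by (simp add: dist_norm)
      then show "Re x \<ge> Re s - d" by simp
      have "norm (x - s) \<le> d" using that by (simp add: dist_norm norm_minus_commute)
      then show "norm x \<le> norm s + d" using norm_triangle_ineq2[of x s] by simp
    qed
    define B where "B = norm s + d + 1"
    have "uniform_limit (cball s d) (\<lambda>N x. \<Sum>n<N. zeta_term n x)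
        (\<lambda>x. \<Sum>n. zeta_term n x) sequentially"
    proof (rule Weierstrass_m_test)
      fix n x assume x: "x \<in> cball s d"
      have "norm ((x - 1) * x * (x + 1)) \<le> B * B * B"
        unfolding norm_mult
        by (intro mult_mono) (use Re[OF x] norm_triangle_ineq[of x 1] norm_triangle_ineq4[of x 1] d in
            \<open>auto simp: B_def\<close>)
      then have "norm ((x - 1) * x * (x + 1)) / 12 * real (Suc n) powr (- Re x - 2)
          \<le> B * B * B / 12 * real (Suc n) powr (- (Re s - d + 2))"
        by (intro mult_mono powr_mono divide_right_mono) (use d Re[OF x] in \<open>auto simp: B_def\<close>)
      then show "norm (zeta_term n x) \<le> B * B * B / 12 * real (Suc n) powr (- (Re s - d + 2))"
        using zeta_term_bound[of x n] Re[OF x] d by simp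
    qed (intro summable_mult summable_Suc_powr, use d in simp)
    moreover have "cball s d \<subseteq> ?S" using Re d by fastforce
    ultimately show "\<exists>d. 0 < d \<and> cball s d \<subseteq> ?S \<and> uniform_limit (cball s d)
        (\<lambda>N x. \<Sum>n<N. zeta_term n x) (\<lambda>x. \<Sum>n. zeta_term n x) sequentially"
      using d by blast
  qed
  then show ?thesis unfolding pole_free_zeta_def by (auto intro!: holomorphic_intros)
qed

text \<open>Distance 1/2 from the line \<open>Re s = -1\<close> lets one convergent series with
  exponent 3/2 dominate all error series at once. The cubic growth is that of
  \<open>(s - 1) * s * (s + 1)\<close>.\<close>

lemma pole_free_zeta_growth:
  obtains C where "C > 0" "\<And>s. Re s \<ge> -1/2 \<Longrightarrow> norm (pole_free_zeta s) \<le> C * (1 + norm s) ^ 3"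
proof -
  define K where "K = (\<Sum>n. real (Suc n) powr (- (3/2)))"
  have sK: "summable (\<lambda>n. real (Suc n) powr (- (3/2)))" by (rule summable_Suc_powr) simp
  have K: "K \<ge> 0" unfolding K_def by (intro suminf_nonneg sK) simp
  have "norm (pole_free_zeta s) \<le> (2 + K) * (1 + norm s) ^ 3" if s: "Re s \<ge> -1/2" for s
  proof -
    define B where "B = 1 + norm s"
    have B1: "B \<ge> 1" by (simp add: B_def)
    have BB: "B \<le> B ^ 3" using B1 by (simp add: self_le_power)
    have n1: "norm (s - 1) \<le> B" "norm (s + 1) \<le> B"
      using norm_triangle_ineq[of s 1] norm_triangle_ineq4[of s 1] by (auto simp: B_def)
    have "norm ((s - 1) * s * (s + 1)) \<le> B * B * B"
      unfolding norm_mult by (intro mult_mono) (use n1 in \<open>auto simp: B_def\<close>)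
    then have le: "norm (zeta_term n s) \<le> B ^ 3 * real (Suc n) powr (- (3/2))" for n
    proof -
      have "norm (zeta_term n s) \<le> norm ((s - 1) * s * (s + 1)) / 12 * real (Suc n) powr (- Re s - 2)"
        using s by (intro zeta_term_bound) simp
      also have "\<dots> \<le> B ^ 3 * real (Suc n) powr (- (3/2))"
      proof (intro mult_mono powr_mono)
        show "norm ((s - 1) * s * (s + 1)) / 12 \<le> B ^ 3"
          using \<open>norm ((s - 1) * s * (s + 1)) \<le> B * B * B\<close> norm_ge_zero[of "(s - 1) * s * (s + 1)"]
          unfolding power3_eq_cube by linarith
      next
        show "- Re s - 2 \<le> - (3 / 2)" using s by (simp add: field_simps)
      qed (use s B1 in auto)
      finally show ?thesis .
    qed
    have "norm (\<Sum>n. zeta_term n s) \<le> (\<Sum>n. B ^ 3 * real (Suc n) powr (- (3/2)))"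
      by (intro norm_suminf_le le summable_mult sK)
    also have "\<dots> = B ^ 3 * K" unfolding K_def by (rule suminf_mult[OF sK])
    finally have 1: "norm (\<Sum>n. zeta_term n s) \<le> B ^ 3 * K" .
    have "norm (pole_free_zeta s) \<le> norm (1 + (s - 1) / 2) + norm (\<Sum>n. zeta_term n s)"
      unfolding pole_free_zeta_def by (rule norm_triangle_ineq)
    also have "norm (1 + (s - 1) / 2) \<le> 1 + B / 2"
      using norm_triangle_ineq[of 1 "(s - 1)/2"] n1 by (simp add: norm_divide)
    finally have "norm (pole_free_zeta s) \<le> 1 + B / 2 + B ^ 3 * K" using 1 by simp
    also have "\<dots> \<le> (2 + K) * B ^ 3" using B1 BB by (simp add: algebra_simps)
    finally show ?thesis by (simp add: B_def)
  qed
  then show ?thesis using K that[of "2 + K"] by simp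
qed

lemma norm_of_nat_Suc_powr: "norm (of_nat (Suc n) powr z :: complex) = real (Suc n) powr Re z"
  using norm_powr_real_powr[of "of_nat (Suc n)" z] by (simp del: of_nat_Suc)

lemma summable_norm_Suc_powr:
  assumes "Re s > 1"
  shows "summable (\<lambda>n. norm (of_nat (Suc n) powr (-s) :: complex))"
  using summable_Suc_powr[OF assms] by (simp add: norm_of_nat_Suc_powr del: of_nat_Suc)

lemma pole_free_zeta_eq:
  assumes s: "Re s > 1"
  shows "pole_free_zeta s = (s - 1) * (\<Sum>n. of_nat (Suc n) powr (-s))"
proof -
  define a where "a = (\<lambda>n. of_nat (Suc n) powr (-s) :: complex)"
  define Z where "Z = (\<Sum>n. a n)"
  have "summable a" using summable_norm_cancel[OF summable_norm_Suc_powr[OF s]] by (simp add: a_def)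
  then have Z: "a sums Z" by (simp add: Z_def summable_sums)
  then have Z': "(\<lambda>n. a (Suc n)) sums (Z - a 0)" by (simp add: sums_Suc_iff)
  have a0: "a 0 = 1" by (simp add: a_def)
  have lim: "(\<lambda>n. of_nat (Suc n) powr (1 - s) :: complex) \<longlonglongrightarrow> 0"
  proof (rule tendsto_norm_zero_cancel)
    have "(\<lambda>n. real (Suc n) powr (- (Re s - 1))) \<longlonglongrightarrow> 0"
      by (intro tendsto_neg_powr filterlim_compose[OF filterlim_real_sequentially filterlim_Suc])
        (use s in simp)
    then show "(\<lambda>n. norm (of_nat (Suc n) powr (1 - s) :: complex)) \<longlonglongrightarrow> 0"
      by (simp add: norm_of_nat_Suc_powr del: of_nat_Suc)
  qed
  have tel: "(\<lambda>n. of_nat (Suc (Suc n)) powr (1 - s) - of_nat (Suc n) powr (1 - s)) sums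
      (0 - of_nat (Suc 0) powr (1 - s) :: complex)"
    by (rule telescope_sums[OF lim])
  have "(\<lambda>n. (s - 1) / 2 * (a n + a (Suc n)) + (of_nat (Suc (Suc n)) powr (1 - s) - of_nat (Suc n) powr (1 - s)))
      sums ((s - 1) / 2 * (Z + (Z - a 0)) + (0 - of_nat (Suc 0) powr (1 - s)))"
    by (intro sums_add sums_mult Z Z' tel)
  \<comment> \<open>The telescoping part contributes -1, and the trapezoidal weights count the first
    Dirichlet term only half. The summand \<open>1 + (s - 1) / 2\<close> in
    \<open>pole_free_zeta\<close> restores both.\<close>
  then have "(\<lambda>n. zeta_term n s) sums ((s - 1) / 2 * (2 * Z - 1) - 1)"
    by (simp add: zeta_term_def a_def a0 algebra_simps)
  then have "pole_free_zeta s = 1 + (s - 1) / 2 + ((s - 1) / 2 * (2 * Z - 1) - 1)"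
    unfolding pole_free_zeta_def by (simp add: sums_iff)
  also have "\<dots> = (s - 1) * Z" by (simp add: field_simps)
  finally show ?thesis by (simp add: Z_def a_def)
qed

section \<open>A lower bound for zeta by sieving\<close>

definition sieve_set :: "nat \<Rightarrow> nat set" where
  "sieve_set m = {n. n \<ge> 1 \<and> (\<forall>p. prime p \<and> p \<le> m \<longrightarrow> \<not> p dvd n)}"

text \<open>For \<open>Re w > 1\<close> this is zeta of \<open>w\<close> times the Euler factors
  \<open>1 - p^(-w)\<close> with \<open>p \<le> m\<close>. Unordered summation lets index sets be
  split and reindexed without regard to order.\<close>

definition sieve_sum :: "complex \<Rightarrow> nat \<Rightarrow> complex" where
  "sieve_sum w m = infsum (\<lambda>n. of_nat n powr (-w)) (sieve_set m)"

lemma abs_summable_of_nat_powr: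
  fixes w :: complex
  assumes "Re w > 1"
  shows "(\<lambda>n. norm (of_nat n powr (-w) :: complex)) summable_on A"
proof -
  have "summable (\<lambda>n. norm (of_nat n powr (-w) :: complex))"
    using summable_norm_Suc_powr[OF assms] by (subst summable_Suc_iff [symmetric])
  then have "(\<lambda>n. norm (of_nat n powr (-w) :: complex)) summable_on UNIV"
    by (simp add: summable_on_UNIV_nonneg_real_iff)
  then show ?thesis by (rule summable_on_subset_banach) simp
qed

lemma summable_on_of_nat_powr:
  fixes w :: complex
  assumes "Re w > 1"
  shows "(\<lambda>n. of_nat n powr (-w) :: complex) summable_on A"
  using abs_summable_summable[OF abs_summable_of_nat_powr[OF assms]] .

text \<open>Multiplication by the new prime preserves divisibility by the smaller primes, so it maps
  the sieved set bijectively onto its own multiples of that prime. Those are exactly the elements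
  removed by the step.\<close>

lemma sieve_sum_Suc_prime:
  assumes w: "Re w > 1" and p: "prime (Suc m)"
  shows "sieve_sum w (Suc m) = (1 - of_nat (Suc m) powr (-w)) * sieve_sum w m"
proof -
  let ?a = "\<lambda>n. of_nat n powr (-w) :: complex"
  let ?B = "(\<lambda>n. Suc m * n) ` sieve_set m"
  have dvd_iff: "q dvd Suc m * n \<longleftrightarrow> q dvd n" if "prime q" "q \<le> m" for q n
  proof -
    have "\<not> q dvd Suc m"
    proof
      assume "q dvd Suc m"
      then have "q = Suc m" by (rule primes_dvd_imp_eq[OF that(1) p])
      with that show False by simp
    qed
    then show ?thesis using that prime_dvd_mult_iff by blast
  qed
  have un: "sieve_set m = sieve_set (Suc m) \<union> ?B"
  proof (intro equalityI subsetI)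
    fix n assume n: "n \<in> sieve_set m"
    show "n \<in> sieve_set (Suc m) \<union> ?B"
    proof (cases "Suc m dvd n")
      case True
      then obtain k where k: "n = Suc m * k" by (elim dvdE)
      have "k \<in> sieve_set m"
        using n dvd_iff unfolding k sieve_set_def by (auto simp: Suc_le_eq)
      then show ?thesis using k by blast
    next
      case False
      then show ?thesis using n by (auto simp: sieve_set_def le_Suc_eq)
    qed
  next
    fix n assume "n \<in> sieve_set (Suc m) \<union> ?B"
    then show "n \<in> sieve_set m"
      using dvd_iff by (auto simp: sieve_set_def Suc_le_eq simp del: mult_Suc)
  qed
  have disj: "sieve_set (Suc m) \<inter> ?B = {}"
    using p by (auto simp: sieve_set_def simp del: mult_Suc)
  have inj: "inj_on (\<lambda>n. Suc m * n) (sieve_set m)" by (auto simp: inj_on_def simp del: mult_Suc)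
  have "infsum ?a ?B = infsum (\<lambda>n. of_nat (Suc m) powr (-w) * of_nat n powr (-w)) (sieve_set m)"
    by (subst infsum_reindex[OF inj], rule infsum_cong)
      (simp add: powr_times_real del: of_nat_Suc mult_Suc)
  also have "\<dots> = of_nat (Suc m) powr (-w) * sieve_sum w m"
    unfolding sieve_sum_def by (rule infsum_cmult_right')
  finally have "infsum ?a ?B = of_nat (Suc m) powr (-w) * sieve_sum w m" .
  moreover have "sieve_sum w m = sieve_sum w (Suc m) + infsum ?a ?B"
    unfolding sieve_sum_def
    by (subst un, rule infsum_Un_disjoint) (use disj summable_on_of_nat_powr[OF w] in auto)
  ultimately show ?thesis by (simp add: algebra_simps)
qed

lemma sieve_sum_Suc_not_prime:
  assumes "\<not> prime (Suc m)"
  shows "sieve_sum w (Suc m) = sieve_sum w m"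
proof -
  have "sieve_set (Suc m) = sieve_set m"
    using assms by (auto simp: sieve_set_def le_Suc_eq)
  then show ?thesis by (simp add: sieve_sum_def)
qed

text \<open>Every surviving number other than 1 exceeds \<open>m\<close>, since a prime factor of it
  is at most the number itself. Hence the difference from 1 is bounded by a tail of the absolutely
  convergent series.\<close>

lemma sieve_sum_tendsto:
  assumes w: "Re w > 1"
  shows "sieve_sum w \<longlonglongrightarrow> 1"
proof -
  let ?a = "\<lambda>n. of_nat n powr (-w) :: complex"
  let ?b = "\<lambda>n. norm (?a n)"
  define T where "T = infsum ?b UNIV"
  have b: "?b summable_on A" for A by (rule abs_summable_of_nat_powr[OF w])
  have "norm (sieve_sum w m - 1) \<le> T - sum ?b {..<Suc m}" for m
  proof -
    have n: "n > m" if nm: "n \<in> sieve_set m - {1}" for n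
    proof (rule ccontr)
      assume nm': "\<not> n > m"
      have n: "n \<noteq> 1" "n \<ge> 1" "\<And>p. prime p \<Longrightarrow> p \<le> m \<Longrightarrow> \<not> p dvd n"
        using nm by (auto simp: sieve_set_def)
      obtain p where p: "prime p" "p dvd n" using prime_factor_nat[OF n(1)] by blast
      have "p \<le> n" using n(2) by (intro dvd_imp_le p) simp
      with n(3)[OF p(1)] p(2) nm' show False by simp
    qed
    have "1 \<in> sieve_set m" by (auto simp: sieve_set_def)
    then have "sieve_sum w m = infsum ?a ({1} \<union> (sieve_set m - {1}))"
      unfolding sieve_sum_def by (simp add: insert_absorb)
    also have "\<dots> = infsum ?a {1} + infsum ?a (sieve_set m - {1})"
      by (rule infsum_Un_disjoint) (use summable_on_of_nat_powr[OF w] in auto)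
    finally have "sieve_sum w m - 1 = infsum ?a (sieve_set m - {1})" by simp
    also have "norm \<dots> \<le> infsum ?b (sieve_set m - {1})" by (rule norm_infsum_bound[OF b])
    also have "\<dots> \<le> infsum ?b (UNIV - {..<Suc m})"
      by (rule infsum_mono_neutral[OF b b]) (use n in fastforce)+
    also have "\<dots> = T - sum ?b {..<Suc m}"
      unfolding T_def by (subst infsum_Diff) (use b in auto)
    finally show ?thesis .
  qed
  moreover have "(\<lambda>m. T - sum ?b {..<Suc m}) \<longlonglongrightarrow> T - T"
  proof (intro tendsto_intros)
    have "?b sums T" unfolding T_def using has_sum_imp_sums[OF has_sum_infsum[OF b]] .
    then show "(\<lambda>m. sum ?b {..<Suc m}) \<longlonglongrightarrow> T" unfolding sums_def by (rule LIMSEQ_Suc)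
  qed
  ultimately have "(\<lambda>m. sieve_sum w m - 1) \<longlonglongrightarrow> 0"
    unfolding diff_self by (rule Lim_null_comparison[OF always_eventually[OF allI]])
  then show ?thesis by (simp add: LIM_zero_iff)
qed

lemma sieve_sum_0:
  assumes w: "Re w > 1"
  shows "sieve_sum w 0 = (\<Sum>n. of_nat (Suc n) powr (-w))"
proof -
  let ?a = "\<lambda>n. of_nat n powr (-w) :: complex"
  have "sieve_set 0 = UNIV - {0}" by (auto simp: sieve_set_def)
  then have "sieve_sum w 0 = infsum ?a UNIV"
    unfolding sieve_sum_def by (intro infsum_cong_neutral) auto
  also have "(?a has_sum infsum ?a UNIV) UNIV" by (rule has_sum_infsum[OF summable_on_of_nat_powr[OF w]])
  then have "?a sums infsum ?a UNIV" by (rule has_sum_imp_sums)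
  then have "(\<lambda>n. ?a (Suc n)) sums infsum ?a UNIV" by (subst sums_Suc_iff) simp
  then have "infsum ?a UNIV = (\<Sum>n. ?a (Suc n))" by (rule sums_unique)
  finally show ?thesis .
qed

text \<open>
  Each sieve step multiplies the left-hand side of the invariant by
  \<open>\<bar>1 - p^(-w)\<bar> (1 - p^(-u)) \<le> 1 - p^(-2u)\<close> with \<open>u = Re w\<close>, and both sieved sums tend to 1.
\<close>
lemma zeta_lower_bound:
  assumes w: "Re w > 1"
  shows "1 \<le> norm (\<Sum>n. of_nat (Suc n) powr (-w) :: complex)
      * norm (\<Sum>n. of_nat (Suc n) powr (-of_real (Re w)) :: complex)"
proof -
  define u where "u = complex_of_real (Re w)"
  have u: "Re u > 1" using w by (simp add: u_def)
  have "norm (sieve_sum w m) * norm (sieve_sum u m) \<le> norm (sieve_sum w 0) * norm (sieve_sum u 0)" for m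
  proof (induction m)
    case (Suc m)
    show ?case
    proof (cases "prime (Suc m)")
      case True
      define q where "q = real (Suc m) powr (- Re w)"
      have q: "q > 0" "q \<le> 1"
        using w powr_mono[of "- Re w" 0 "real (Suc m)"] by (auto simp: q_def)
      have "norm (1 - of_nat (Suc m) powr (-w) :: complex) \<le> 1 + q"
        using norm_triangle_ineq4[of 1 "of_nat (Suc m) powr (-w) :: complex"]
        by (simp add: q_def norm_of_nat_Suc_powr del: of_nat_Suc)
      moreover have "norm (1 - of_nat (Suc m) powr (-u) :: complex) = 1 - q"
      proof -
        have "of_nat (Suc m) powr (-u) = complex_of_real q"
          using powr_of_real[of "real (Suc m)" "- Re w"] by (simp add: u_def q_def del: of_nat_Suc)
        then show ?thesis using q by (metis abs_of_nonneg diff_ge_0_iff_ge norm_of_real of_real_1 of_real_diff)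
      qed
      ultimately have "norm (1 - of_nat (Suc m) powr (-w) :: complex) *
          norm (1 - of_nat (Suc m) powr (-u) :: complex) \<le> (1 + q) * (1 - q)"
        using q by (intro mult_mono) auto
      also have "\<dots> \<le> 1" by (simp add: algebra_simps)
      finally have "norm (1 - of_nat (Suc m) powr (-w) :: complex) *
          norm (1 - of_nat (Suc m) powr (-u) :: complex) * (norm (sieve_sum w m) * norm (sieve_sum u m))
          \<le> 1 * (norm (sieve_sum w m) * norm (sieve_sum u m))"
        by (intro mult_right_mono) auto
      then show ?thesis
        using Suc by (simp add: sieve_sum_Suc_prime[OF w True] sieve_sum_Suc_prime[OF u True] norm_mult mult_ac
          del: of_nat_Suc)
    next
      case False
      then show ?thesis using Suc by (simp add: sieve_sum_Suc_not_prime)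
    qed
  qed auto
  moreover have "(\<lambda>m. norm (sieve_sum w m) * norm (sieve_sum u m)) \<longlonglongrightarrow> norm (1::complex) * norm (1::complex)"
    by (intro tendsto_intros sieve_sum_tendsto w u)
  ultimately have "norm (1::complex) * norm (1::complex) \<le> norm (sieve_sum w 0) * norm (sieve_sum u 0)"
    by (intro LIMSEQ_le_const2) auto
  then show ?thesis by (simp add: sieve_sum_0 w u u_def)
qed

section \<open>Growth and Gamma estimates\<close>

text \<open>Dividing by \<open>(1 + \<delta> (w - a))^(k+1)\<close>, of modulus at least 1 on the half-plane, makes the
  function tend to 0, so that the maximum principle applies on large half-discs; then \<open>\<delta> \<rightarrow> 0\<close>.\<close>
lemma phragmen_lindelof_half_plane:
  fixes f :: "complex \<Rightarrow> complex"
  assumes hol: "f holomorphic_on S" and S: "{w. Re w \<ge> a} \<subseteq> S"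
    and bd: "\<And>w. Re w = a \<Longrightarrow> norm (f w) \<le> 1"
    and C: "C > 0" and gr: "\<And>w. Re w \<ge> a \<Longrightarrow> norm (f w) \<le> C * (1 + norm w) ^ k"
    and w: "Re w \<ge> a"
  shows "norm (f w) \<le> 1"
proof -
  have key: "norm (f w) \<le> norm (1 + of_real \<delta> * (w - of_real a)) ^ Suc k" if d: "\<delta> > 0" for \<delta>
  proof -
    define h where "h = (\<lambda>w. (1 + of_real \<delta> * (w - of_real a)) :: complex)"
    have h1: "norm (h z) \<ge> 1" if "Re z \<ge> a" for z
    proof -
      have "1 \<le> Re (h z)" using that d by (simp add: h_def)
      also have "\<dots> \<le> norm (h z)" by (rule complex_Re_le_cmod)
      finally show ?thesis .
    qed
    define K where "K = 2 / \<delta> + \<bar>a\<bar> + 1"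
    have K: "K > 0" using d by (simp add: K_def add_pos_nonneg)
    have hK: "1 + norm z \<le> K * norm (h z)" if "Re z \<ge> a" for z
    proof -
      have "\<delta> * norm (z - of_real a) = norm (h z - 1)"
        using d by (simp add: h_def norm_mult)
      then have "\<delta> * norm (z - of_real a) \<le> norm (h z) + 1"
        using norm_triangle_ineq4[of "h z" 1] by simp
      then have "norm (z - of_real a) \<le> (norm (h z) + 1) / \<delta>" using d by (simp add: field_simps)
      also have "\<dots> \<le> (2 * norm (h z)) / \<delta>"
        using h1[OF that] d by (intro divide_right_mono) auto
      finally have "norm (z - of_real a) \<le> (2 / \<delta>) * norm (h z)" by simp
      moreover have "norm z \<le> norm (z - of_real a) + \<bar>a\<bar>"
        using norm_triangle_ineq[of "z - of_real a" "of_real a"] by simp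
      moreover have "\<bar>a\<bar> * 1 \<le> \<bar>a\<bar> * norm (h z)" using h1[OF that] by (intro mult_left_mono) auto
      ultimately show ?thesis using h1[OF that] by (simp add: K_def algebra_simps)
    qed
    have h0: "h z \<noteq> 0" if "Re z \<ge> a" for z using h1[OF that] by auto
    define g where "g = (\<lambda>z. f z / h z ^ Suc k)"
    \<comment> \<open>The exponent \<open>Suc k\<close> is one more than the growth of
      \<open>f\<close>. Comparing the spare factor with \<open>1 + norm z\<close> yields an explicit
      radius beyond which the quotient is at most 1.\<close>
    have g_far: "norm (g z) \<le> 1" if z: "Re z \<ge> a" "norm z \<ge> C * K ^ Suc k" for z
    proof -
      have "norm (f z) * (1 + norm z) \<le> C * (1 + norm z) ^ Suc k"
        using mult_right_mono[OF gr[OF z(1)], of "1 + norm z"] by (simp add: mult_ac)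
      also have "\<dots> \<le> C * (K * norm (h z)) ^ Suc k"
        using C hK[OF z(1)] by (intro mult_left_mono power_mono) auto
      also have "\<dots> = (C * K ^ Suc k) * norm (h z) ^ Suc k" by (simp add: power_mult_distrib)
      also have "\<dots> \<le> (1 + norm z) * norm (h z) ^ Suc k"
        using z by (intro mult_right_mono) auto
      finally have "norm (f z) * (1 + norm z) \<le> norm (h z) ^ Suc k * (1 + norm z)" by (simp add: mult_ac)
      then have "norm (f z) \<le> norm (h z) ^ Suc k"
        using mult_right_le_imp_le[of "norm (f z)" "1 + norm z"] by (simp add: add_pos_nonneg)
      then show ?thesis using h0[OF z(1)] by (simp add: g_def norm_divide norm_mult norm_power divide_le_eq_1)
    qed
    have g_bd: "norm (g z) \<le> 1" if z: "Re z = a" for z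
    proof -
      have "norm (f z) \<le> norm (h z) ^ Suc k"
        using bd[OF z] one_le_power[OF h1[of z], of "Suc k"] z by linarith
      then show ?thesis using h0[of z] z by (simp add: g_def norm_divide norm_mult norm_power divide_le_eq_1)
    qed
    have "norm (g w) \<le> 1"
    proof (cases "Re w = a")
      case False
      define R where "R = max (C * K ^ Suc k) (norm w + 1)"
      define T where "T = {z. Re z > a} \<inter> ball 0 R"
      have opT: "open T" unfolding T_def by (intro open_Int open_halfspace_Re_gt open_ball)
      have clT: "closure T \<subseteq> {z. Re z \<ge> a} \<inter> cball 0 R"
        by (rule closure_minimal) (auto simp: T_def closed_halfspace_Re_ge intro!: closed_Int)
      have hol_g: "g holomorphic_on {z. Re z \<ge> a}"
        unfolding g_def using h0
        by (intro holomorphic_intros holomorphic_on_subset[OF hol S]) (auto simp: h_def intro!: holomorphic_intros)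
      show ?thesis
      proof (rule maximum_modulus_frontier[where S = T and f = g and \<xi> = w and B = 1])
        show "g holomorphic_on interior T"
          using hol_g by (rule holomorphic_on_subset) (use interior_subset in \<open>fastforce simp: T_def\<close>)
        show "continuous_on (closure T) g"
          using holomorphic_on_imp_continuous_on[OF hol_g] clT continuous_on_subset by blast
        show "bounded T" unfolding T_def using bounded_ball bounded_Int by blast
        show "w \<in> T" using False w by (auto simp: T_def R_def)
        fix z assume "z \<in> frontier T"
        then have z: "z \<in> closure T" "z \<notin> T" using opT by (auto simp: frontier_def interior_open)
        then have "Re z = a \<or> norm z \<ge> R" "Re z \<ge> a" using clT by (auto simp: T_def)
        then show "norm (g z) \<le> 1" using g_bd g_far by (auto simp: R_def)
      qed
    qed (use g_bd in auto)
    then have "norm (f w) / norm (h w) ^ Suc k \<le> 1"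
      by (simp only: g_def norm_divide norm_power)
    moreover have "0 < norm (h w) ^ Suc k" using h0[OF w] by simp
    ultimately have "norm (f w) \<le> norm (h w) ^ Suc k" by (simp only: divide_le_eq_1_pos)
    then show ?thesis by (simp only: h_def)
  qed
  have "((\<lambda>\<delta>. norm (1 + of_real \<delta> * (w - of_real a)) ^ Suc k) \<longlongrightarrow> norm (1 + of_real 0 * (w - of_real a)) ^ Suc k) (at_right 0)"
    by (intro tendsto_intros)
  then have "((\<lambda>\<delta>. norm (1 + of_real \<delta> * (w - of_real a)) ^ Suc k) \<longlongrightarrow> 1) (at_right 0)" by simp
  then show ?thesis
    by (rule tendsto_lowerbound)
      (use key in \<open>auto simp: eventually_at_right_field intro!: exI[of _ 1]\<close>)
qed

text \<open>Compare the Gamma products factor by factor: \<open>\<bar>Z + c + k\<bar> / \<bar>Z + k\<bar> \<le> 1 + c / (x + k)\<close>.\<close>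
lemma norm_Gamma_ratio_le:
  fixes Z :: complex and x c :: real
  assumes x: "x > 0" and c: "c > 0" and Z: "Re Z \<ge> x"
  shows "norm (Gamma Z / Gamma (Z + of_real c)) \<le> Gamma x / Gamma (x + c)"
proof -
  have pos: "norm (pochhammer Z n) > 0" "pochhammer x n > 0" for n
  proof -
    have "Z \<notin> \<int>\<^sub>\<le>\<^sub>0" using x Z by (auto elim!: nonpos_Ints_cases)
    then have "pochhammer Z n \<noteq> 0" using pochhammer_eq_0_imp_nonpos_Int by blast
    then show "norm (pochhammer Z n) > 0" by simp
    show "pochhammer x n > 0" using x by (simp add: pochhammer_pos)
  qed
  have poch: "norm (pochhammer (Z + of_real c) n) * pochhammer x n
      \<le> norm (pochhammer Z n) * pochhammer (x + c) n" for n
  proof (induction n)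
    case (Suc n)
    have "x + n \<le> Re (Z + of_nat n)" using Z by simp
    also have "\<dots> \<le> norm (Z + of_nat n)" by (rule complex_Re_le_cmod)
    finally have 1: "x + n \<le> norm (Z + of_nat n)" .
    have "norm (Z + of_real c + of_nat n) \<le> norm (Z + of_nat n) + c"
      using norm_triangle_ineq[of "Z + of_nat n" "of_real c"] c by (simp add: add_ac)
    then have "norm (Z + of_real c + of_nat n) * (x + n) \<le> (norm (Z + of_nat n) + c) * (x + n)"
      using x by (intro mult_right_mono) auto
    also have "\<dots> \<le> norm (Z + of_nat n) * (x + c + n)"
      using 1 c mult_left_mono[OF 1, of c] by (simp add: algebra_simps)
    finally have 2: "norm (Z + of_real c + of_nat n) * (x + n) \<le> norm (Z + of_nat n) * (x + c + n)" .
    have "(norm (pochhammer (Z + of_real c) n) * pochhammer x n) * (norm (Z + of_real c + of_nat n) * (x + n))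
        \<le> (norm (pochhammer Z n) * pochhammer (x + c) n) * (norm (Z + of_nat n) * (x + c + n))"
      using x c pos[of n] by (intro mult_mono Suc 2) (auto intro!: mult_nonneg_nonneg pochhammer_nonneg)
    then show ?case by (simp add: pochhammer_rec' norm_mult mult_ac)
  qed simp
  have le: "norm (Gamma_series Z n / Gamma_series (Z + of_real c) n) \<le> Gamma_series x n / Gamma_series (x + c) n"
    if n: "n > 0" for n
  proof -
    have E: "norm (exp (Z * of_real (ln (real n))) / exp ((Z + of_real c) * of_real (ln (real n))))
       = exp (x * ln (real n)) / exp ((x + c) * ln (real n))"
      by (simp add: exp_diff[symmetric] ring_distribs del: exp_of_real flip: norm_divide)
    have "norm (Gamma_series Z n / Gamma_series (Z + of_real c) n) =
       (exp (x * ln (real n)) / exp ((x + c) * ln (real n))) *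
       (norm (pochhammer (Z + of_real c) (n+1)) / norm (pochhammer Z (n+1)))"
      unfolding Gamma_series_def E[symmetric] by (simp add: norm_divide norm_mult field_simps)
    also have "\<dots> \<le> (exp (x * ln (real n)) / exp ((x + c) * ln (real n))) *
       (pochhammer (x + c) (n+1) / pochhammer x (n+1))"
      using poch[of "n+1"] pos[of "n+1"] by (intro mult_left_mono) (auto simp: field_simps)
    also have "\<dots> = Gamma_series x n / Gamma_series (x + c) n"
      unfolding Gamma_series_def by (simp add: field_simps)
    finally show ?thesis .
  qed
  have "Re (Z + of_real c) > 0" using x Z c by simp
  then have "Z + of_real c \<notin> \<int>\<^sub>\<le>\<^sub>0" by (rule Re_pos_not_nonpos_Ints)
  then have nz: "Gamma (Z + of_real c) \<noteq> 0" "Gamma (x + c) \<noteq> 0"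
    using x c Gamma_real_pos[of "x + c"] by (auto simp: Gamma_eq_zero_iff)
  show ?thesis
  proof (rule tendsto_le[OF trivial_limit_sequentially])
    show "(\<lambda>n. norm (Gamma_series Z n / Gamma_series (Z + of_real c) n)) \<longlonglongrightarrow> norm (Gamma Z / Gamma (Z + of_real c))"
      by (intro tendsto_intros nz)
    show "(\<lambda>n. Gamma_series x n / Gamma_series (x + c) n) \<longlonglongrightarrow> Gamma x / Gamma (x + c)"
      by (intro tendsto_intros nz)
    show "\<forall>\<^sub>F n in sequentially. norm (Gamma_series Z n / Gamma_series (Z + of_real c) n)
        \<le> Gamma_series x n / Gamma_series (x + c) n"
      using eventually_gt_at_top[of 0] le by (rule eventually_mono)
  qed
qed

text \<open>Since \<open>artanh q \<ge> q\<close>, each term of the series for \<open>-Re (\<psi> z)\<close> is at most the corresponding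
  term of a telescoping sum of logarithms.\<close>
lemma Re_Digamma_ge:
  assumes x: "x \<ge> 0" and y: "y > 1 / 2"
  shows "Re (Digamma (Complex x y)) \<ge> ln ((x - 1/2)\<^sup>2 + y\<^sup>2 - 1/4) / 2"
proof -
  \<comment> \<open>The shift by 1/2 makes the logarithms telescope: the argument of
    \<open>ln\<close> is \<open>t^2 + y^2 - t\<close> in \<open>l t\<close> and
    \<open>t^2 + y^2 + t\<close> in \<open>l (t + 1)\<close>, and their ratio is
    \<open>(1 + q) / (1 - q)\<close> for \<open>q = t / (t^2 + y^2)\<close>.\<close>
  define l where "l = (\<lambda>t::real. ln ((t - 1/2)\<^sup>2 + y\<^sup>2 - 1/4) / 2)"
  have y2: "y\<^sup>2 > 1/4" using y power_strict_mono[of "1/2" y 2] by (simp add: power2_eq_square)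
  have step: "t / (t\<^sup>2 + y\<^sup>2) \<le> l (t + 1) - l t" if t: "t \<ge> 0" for t
  proof -
    define q where "q = t / (t\<^sup>2 + y\<^sup>2)"
    have pos: "t\<^sup>2 + y\<^sup>2 - t > 0"
    proof -
      have "t\<^sup>2 + y\<^sup>2 - t = (t - 1/2)\<^sup>2 + (y\<^sup>2 - 1/4)" by (simp add: power2_eq_square algebra_simps)
      then show ?thesis using y2 zero_le_power2[of "t - 1/2"] by linarith
    qed
    have pos2: "t\<^sup>2 + y\<^sup>2 > 0" using pos t by simp
    have q: "q \<ge> 0" "q < 1" using pos pos2 t by (auto simp: q_def field_simps)
    have "q \<le> artanh q"
    proof -
      have "artanh 0 - 0 \<le> artanh q - q"
      proof (rule DERIV_nonneg_imp_nondecreasing[where f = "\<lambda>x. artanh x - x", OF q(1)])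
        fix z assume z: "0 \<le> z" "z \<le> q"
        then have z1: "\<bar>z\<bar> < 1" using q by simp
        then have "z\<^sup>2 < 1" using abs_square_less_1 by blast
        then show "\<exists>D. ((\<lambda>x. artanh x - x) has_real_derivative D) (at z) \<and> 0 \<le> D"
          using z1 by (intro exI[of _ "1 / (1 - z\<^sup>2) - 1"] conjI) (auto intro!: derivative_eq_intros simp: field_simps)
      qed
      then show ?thesis by simp
    qed
    also have "artanh q = ln ((1 + q) / (1 - q)) / 2" by (simp add: artanh_def)
    also have "(1 + q) / (1 - q) = (t\<^sup>2 + y\<^sup>2 + t) / (t\<^sup>2 + y\<^sup>2 - t)"
    proof -
      have "1 + q = (t\<^sup>2 + y\<^sup>2 + t) / (t\<^sup>2 + y\<^sup>2)" "1 - q = (t\<^sup>2 + y\<^sup>2 - t) / (t\<^sup>2 + y\<^sup>2)"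
        using less_imp_neq[OF pos2] by (simp_all add: q_def add_divide_distrib diff_divide_distrib del: sum_power2_eq_zero_iff)
      then show ?thesis using pos2 by simp
    qed
    also have "ln \<dots> / 2 = l (t + 1) - l t"
      using pos t by (subst ln_div) (auto simp: l_def power2_eq_square algebra_simps diff_divide_distrib)
    finally show ?thesis by (simp add: q_def)
  qed
  define z where "z = Complex x y"
  have z0: "z \<noteq> 0" using y by (auto simp: z_def complex_eq_iff)
  have sum_le: "(\<Sum>n<m. (x + real n) / ((x + real n)\<^sup>2 + y\<^sup>2)) \<le> l (x + m) - l x" for m
  proof (induction m)
    case (Suc m)
    then show ?case using step[of "x + m"] x by (simp add: add_ac)
  qed simp
  have "(\<lambda>m. of_real (ln (real m)) - (\<Sum>n<m. inverse (z + of_nat n))) \<longlonglongrightarrow> Digamma z"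
    by (rule Digamma_LIMSEQ[OF z0])
  from tendsto_Re[OF this]
  have lim1: "(\<lambda>m. ln (real m) - (\<Sum>n<m. (x + real n) / ((x + real n)\<^sup>2 + y\<^sup>2))) \<longlonglongrightarrow> Re (Digamma z)"
    by (simp add: z_def)
  have lim2: "(\<lambda>m. ln (real m) - (l (x + m) - l x)) \<longlonglongrightarrow> l x"
  proof -
    have "((\<lambda>m::real. ln m - ln ((x + m - 1/2)\<^sup>2 + y\<^sup>2 - 1/4) / 2) \<longlongrightarrow> 0) at_top"
      by real_asymp
    from filterlim_compose[OF this filterlim_real_sequentially]
    have "(\<lambda>m. ln (real m) - l (x + m)) \<longlonglongrightarrow> 0" by (simp add: l_def)
    from tendsto_add[OF this tendsto_const[of "l x"]] show ?thesis by (simp add: algebra_simps)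
  qed
  have "l x \<le> Re (Digamma z)"
    by (rule LIMSEQ_le[OF lim2 lim1]) (intro exI allI impI diff_left_mono sum_le)
  then show ?thesis by (simp add: l_def z_def)
qed

section \<open>The functional equation\<close>

lemma nn_integral_powr_exp:
  fixes t a :: real
  assumes t: "t > 0" and a: "a > -1"
  shows "(\<integral>\<^sup>+x. ennreal (x powr a * exp (-t * x)) * indicator {0<..} x \<partial>lborel)
    = ennreal (Gamma (a + 1) * t powr (- a - 1))"
proof -
  define f where "f = (\<lambda>x. ennreal (x powr a * exp (-t * x)) * indicator {0<..} x)"
  have [measurable]: "f \<in> borel_measurable borel" unfolding f_def by measurable
  have "nn_integral lborel f = ennreal \<bar>1 / t\<bar> * (\<integral>\<^sup>+x. f (0 + 1 / t * x) \<partial>lborel)"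
    by (rule nn_integral_real_affine) (use t in auto)
  also have "(\<integral>\<^sup>+x. f (0 + 1 / t * x) \<partial>lborel)
    = (\<integral>\<^sup>+x. ennreal (t powr (-a)) * ennreal (indicator {0..} x * x powr (a + 1 - 1) / exp x) \<partial>lborel)"
  proof (rule nn_integral_cong_AE, rule AE_mp[OF AE_lborel_singleton[of 0]], rule AE_I2, intro impI)
    fix x :: real assume "x \<noteq> 0"
    show "f (0 + 1 / t * x) = ennreal (t powr (-a)) * ennreal (indicator {0..} x * x powr (a + 1 - 1) / exp x)"
    proof (cases "x > 0")
      case True
      have "(x / t) powr a * exp (-x) = t powr (-a) * (x powr a / exp x)"
        using t True by (simp add: powr_divide exp_minus powr_minus field_simps)
      then show ?thesis using t True by (simp add: f_def ennreal_mult'[symmetric])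
    next
      case False
      then show ?thesis using t \<open>x \<noteq> 0\<close> by (simp add: f_def zero_less_divide_iff)
    qed
  qed
  also have "\<dots> = ennreal (t powr (-a)) * ennreal (Gamma (a + 1))"
    using a Gamma_conv_nn_integral_real[of "a + 1"] by (subst nn_integral_cmult) auto
  also have "ennreal \<bar>1 / t\<bar> * (ennreal (t powr (-a)) * ennreal (Gamma (a + 1)))
      = ennreal (1 / t * (t powr (-a) * Gamma (a + 1)))"
    using t by ((subst ennreal_mult', simp)+, simp)
  also have "1 / t * (t powr (-a) * Gamma (a + 1)) = Gamma (a + 1) * t powr (- a - 1)"
    using t by (simp add: powr_diff field_simps)
  finally show ?thesis by (simp add: f_def)
qed

text \<open>Tonelli, with \<open>exp (-n x) - exp (-(n+1) x)\<close> written as the integral of \<open>x exp (-t x)\<close> over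
  \<open>n \<le> t \<le> n + 1\<close>.\<close>
lemma nn_integral_exp_diff:
  fixes s :: real and n :: nat
  assumes s: "-1 < s" "s < 0"
  shows "(\<integral>\<^sup>+x. ennreal (x powr (s - 1) * (exp (- real n * x) - exp (- (real n + 1) * x))) * indicator {0<..} x \<partial>lborel)
    = ennreal (Gamma (s + 1) / (-s) * ((real n + 1) powr (-s) - real n powr (-s)))"
proof -
  let ?k = "\<lambda>x t::real. ennreal (x powr s * exp (-t * x)) * indicator {0<..} x * indicator {real n..real n + 1} t"
  have "(\<integral>\<^sup>+x. ennreal (x powr (s - 1) * (exp (- real n * x) - exp (- (real n + 1) * x))) * indicator {0<..} x \<partial>lborel)
    = (\<integral>\<^sup>+x. \<integral>\<^sup>+t. ?k x t \<partial>lborel \<partial>lborel)"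
  proof (rule nn_integral_cong)
    fix x :: real
    show "ennreal (x powr (s - 1) * (exp (- real n * x) - exp (- (real n + 1) * x))) * indicator {0<..} x
      = (\<integral>\<^sup>+t. ?k x t \<partial>lborel)"
    proof (cases "x > 0")
      case True
      have "(\<integral>\<^sup>+t. ennreal (x powr s * exp (-t * x)) * indicator {real n..real n + 1} t \<partial>lborel)
          = ennreal (- (x powr (s - 1) * exp (- (real n + 1) * x)) - - (x powr (s - 1) * exp (- real n * x)))"
      proof (rule nn_integral_FTC_Icc)
        fix t :: real
        show "((\<lambda>t. - (x powr (s - 1) * exp (- t * x))) has_real_derivative x powr s * exp (- t * x)) (at t)"
          using True by (auto intro!: derivative_eq_intros simp: powr_diff field_simps)
      qed auto
      then show ?thesis using True by (simp add: mult_ac right_diff_distrib add_ac)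
    qed simp
  qed
  also have "\<dots> = (\<integral>\<^sup>+t. \<integral>\<^sup>+x. ?k x t \<partial>lborel \<partial>lborel)"
    by (rule lborel_pair.Fubini') simp
  also have "\<dots> = (\<integral>\<^sup>+t. ennreal (Gamma (s + 1) * t powr (- s - 1)) * indicator {real n..real n + 1} t \<partial>lborel)"
  \<comment> \<open>For \<open>n = 0\<close> the point \<open>t = 0\<close> belongs to the range.
    The inner integral is infinite there, but a single point is a null set.\<close>
  proof (rule nn_integral_cong_AE, rule AE_mp[OF AE_lborel_singleton[of 0]], rule AE_I2, intro impI)
    fix t :: real assume "t \<noteq> 0"
    show "(\<integral>\<^sup>+x. ?k x t \<partial>lborel) = ennreal (Gamma (s + 1) * t powr (- s - 1)) * indicator {real n..real n + 1} t"
    proof (cases "t \<in> {real n..real n + 1}")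
      case True
      then have "t > 0" using \<open>t \<noteq> 0\<close> by auto
      then show ?thesis using nn_integral_powr_exp[of t s] s True by simp
    qed simp
  qed
  also have "\<dots> = ennreal (Gamma (s + 1) / (-s) * (real n + 1) powr (-s) - Gamma (s + 1) / (-s) * real n powr (-s))"
  proof (rule nn_integral_has_integral_lebesgue')
    let ?F = "\<lambda>t. Gamma (s + 1) / (-s) * t powr (-s)"
    \<comment> \<open>For \<open>n = 0\<close> the integrand blows up at the left endpoint, while
      its primitive is continuous there because \<open>-s > 0\<close>. So differentiability is asked
      for in the interior only.\<close>
    show "((\<lambda>t. Gamma (s + 1) * t powr (- s - 1)) has_integral ?F (real n + 1) - ?F (real n)) {real n..real n + 1}"
    proof (rule fundamental_theorem_of_calculus_interior)
      show "continuous_on {real n..real n + 1} ?F"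
        using s by (intro continuous_intros continuous_on_powr') auto
      fix t assume "t \<in> {real n<..<real n + 1}"
      then have "t > 0" by auto
      then show "(?F has_vector_derivative Gamma (s + 1) * t powr (- s - 1)) (at t)"
        unfolding has_real_derivative_iff_has_vector_derivative[symmetric]
        using s by (auto intro!: derivative_eq_intros)
    qed auto
  qed (use s in \<open>auto intro!: mult_nonneg_nonneg\<close>)
  finally show ?thesis by (simp add: right_diff_distrib add_ac)
qed

lemma tanh_half_eq:
  fixes x :: real
  shows "tanh (x / 2) = (1 - exp (-x)) / (1 + exp (-x))"
proof -
  have "exp (-x) = exp (-(x/2)) * exp (-(x/2))" by (simp flip: exp_add)
  then show ?thesis unfolding tanh_def sinh_def cosh_def
    by (simp add: exp_minus divide_simps power2_eq_square)
qed

text \<open>The logarithmic derivative of the reflection formula at \<open>1/2 + i y\<close>.\<close>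
lemma tanh_sums:
  fixes x :: real
  shows "(\<lambda>k. 4 * x / (x\<^sup>2 + (of_nat (2 * k + 1) * pi)\<^sup>2)) sums tanh (x / 2)"
proof -
  \<comment> \<open>With this scaling \<open>pi * z = \<i> * x / 2\<close> for
    \<open>z = \<i> * y\<close>, so sine and cosine become \<open>sinh\<close> and
    \<open>cosh\<close> of \<open>x / 2\<close>. The two Digamma series at \<open>1/2 + z\<close>
    and \<open>1/2 - z\<close> then differ by purely imaginary terms, which are the partial
    fractions.\<close>
  define y where "y = x / (2 * pi)"
  have not_np: "1/2 + \<i> * of_real y \<notin> \<int>\<^sub>\<le>\<^sub>0" "1/2 - \<i> * of_real y \<notin> \<int>\<^sub>\<le>\<^sub>0" for y
    by (auto intro!: Re_pos_not_nonpos_Ints)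
  have refl: "rGamma (1/2 + z) * rGamma (1/2 - z) = cos (of_real pi * z) / of_real pi" for z :: complex
    using rGamma_reflection_complex[of "1/2 + z"]
    by (simp add: sin_add ring_distribs sin_of_real[symmetric] cos_of_real[symmetric] del: sin_of_real cos_of_real)
  define z where "z = \<i> * complex_of_real y"
  have d1: "((\<lambda>z. rGamma (1/2 + z) * rGamma (1/2 - z)) has_field_derivative
      (- rGamma (1/2 + z) * Digamma (1/2 + z) * rGamma (1/2 - z) + rGamma (1/2 + z) * (rGamma (1/2 - z) * Digamma (1/2 - z)))) (at z)"
    using not_np[of y] by (auto intro!: derivative_eq_intros simp: z_def)
  have d2: "((\<lambda>z. cos (of_real pi * z) / of_real pi) has_field_derivative - sin (of_real pi * z)) (at z)"
    by (auto intro!: derivative_eq_intros)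
  have "- rGamma (1/2 + z) * Digamma (1/2 + z) * rGamma (1/2 - z) + rGamma (1/2 + z) * (rGamma (1/2 - z) * Digamma (1/2 - z))
      = - sin (of_real pi * z)"
    using DERIV_unique[OF d1] d2 unfolding refl by blast
  then have "(Digamma (1/2 + z) - Digamma (1/2 - z)) * (rGamma (1/2 + z) * rGamma (1/2 - z)) = sin (of_real pi * z)"
    by (simp add: algebra_simps)
  then have "(Digamma (1/2 + z) - Digamma (1/2 - z)) * cos (of_real pi * z) = of_real pi * sin (of_real pi * z)"
    unfolding refl by (simp add: field_simps)
  moreover have "sin (of_real pi * z) = \<i> * of_real (sinh (x / 2))" "cos (of_real pi * z) = of_real (cosh (x / 2))"
  proof -
    have e: "of_real pi * z = \<i> * of_real (x / 2)" by (simp add: z_def y_def)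
    show "sin (of_real pi * z) = \<i> * of_real (sinh (x / 2))" "cos (of_real pi * z) = of_real (cosh (x / 2))"
      unfolding e sin_i_times cos_i_times by (simp_all add: sinh_def cosh_def exp_minus flip: exp_of_real)
  qed
  ultimately have D: "Digamma (1/2 + z) - Digamma (1/2 - z) = \<i> * of_real (pi * tanh (x / 2))"
    by (simp add: tanh_def field_simps cosh_real_nonzero)
  have nz: "1/2 + z \<noteq> 0" "1/2 - z \<noteq> 0" by (auto simp: z_def complex_eq_iff)
  have "(\<lambda>n. (inverse (of_nat (Suc n)) - inverse (1/2 + z + of_nat n)) - (inverse (of_nat (Suc n)) - inverse (1/2 - z + of_nat n)))
     sums (Digamma (1/2 + z) + euler_mascheroni - (Digamma (1/2 - z) + euler_mascheroni))"
    by (intro sums_diff) (use summable_Digamma[OF nz(1)] summable_Digamma[OF nz(2)] in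
        \<open>simp_all add: Digamma_def summable_sums\<close>)
  then have S: "(\<lambda>n. inverse (1/2 - z + of_nat n) - inverse (1/2 + z + of_nat n)) sums (\<i> * of_real (pi * tanh (x / 2)))"
    by (simp add: D)
  from sums_Im[OF this]
  have "(\<lambda>n. Im (inverse (1/2 - z + of_nat n) - inverse (1/2 + z + of_nat n))) sums (pi * tanh (x / 2))"
    by simp
  also have "(\<lambda>n. Im (inverse (1/2 - z + of_nat n) - inverse (1/2 + z + of_nat n)))
      = (\<lambda>n. pi * (4 * x / (x\<^sup>2 + (of_nat (2 * n + 1) * pi)\<^sup>2)))"
  proof
    fix n
    define m where "m = real (2 * n + 1)"
    have m: "m > 0" by (simp add: m_def)
    have e: "1/2 - z + of_nat n = Complex (m/2) (-y)" "1/2 + z + of_nat n = Complex (m/2) y"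
      by (auto simp: complex_eq_iff z_def m_def)
    have "Im (inverse (Complex (m/2) (-y)) - inverse (Complex (m/2) y)) = 2 * y / ((m/2)\<^sup>2 + y\<^sup>2)"
      by (simp add: add_divide_distrib[symmetric])
    also have "\<dots> = pi * (4 * x / (x\<^sup>2 + (m * pi)\<^sup>2))"
    proof -
      have p: "x\<^sup>2 + (m * pi)\<^sup>2 > 0" using m by (intro add_nonneg_pos) auto
      have "(m/2)\<^sup>2 + y\<^sup>2 = (x\<^sup>2 + (m * pi)\<^sup>2) / (4 * pi\<^sup>2)"
        by (simp add: y_def field_simps power2_eq_square)
      then show ?thesis using p by (simp add: y_def power2_eq_square)
    qed
    finally show "Im (inverse (1/2 - z + of_nat n) - inverse (1/2 + z + of_nat n))
      = pi * (4 * x / (x\<^sup>2 + (of_nat (2 * n + 1) * pi)\<^sup>2))"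
      unfolding e m_def by simp
  qed
  finally show ?thesis by (subst (asm) sums_mult_iff) auto
qed

text \<open>The substitution \<open>t = x^2 / (x^2 + a^2)\<close> maps the half-line to the unit
  interval and produces a Beta integral whose parameters add up to 1, so that its denominator is
  \<open>Gamma 1\<close>.\<close>

lemma nn_integral_powr_div_square_add:
  fixes s a :: real
  assumes s: "-1 < s" "s < 1" and a: "a > 0"
  shows "(\<integral>\<^sup>+x. ennreal (x powr s / (x\<^sup>2 + a\<^sup>2)) * indicator {0<..} x \<partial>lborel)
    = ennreal (a powr (s - 1) * (Gamma ((1 + s) / 2) * Gamma ((1 - s) / 2) / 2))"
proof -
  define p q where "p = (1 + s) / 2" and "q = (1 - s) / 2"
  have pq: "p > 0" "q > 0" "p + q = 1" using s by (auto simp: p_def q_def field_simps)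
  define g where "g = (\<lambda>x. x\<^sup>2 / (x\<^sup>2 + a\<^sup>2))"
  define g' where "g' = (\<lambda>x. 2 * a\<^sup>2 * x / (x\<^sup>2 + a\<^sup>2)\<^sup>2)"
  let ?f = "\<lambda>t::real. t powr (p - 1) * (1 - t) powr (q - 1)"
  have P: "x\<^sup>2 + a\<^sup>2 > 0" for x using a by (simp add: add_nonneg_pos)
  have img: "g ` {0<..} = {0<..<1}"
  proof (intro equalityI subsetI)
    fix t assume t: "t \<in> {0<..<1::real}"
    define x where "x = a * sqrt (t / (1 - t))"
    have "x\<^sup>2 = a\<^sup>2 * (t / (1 - t))" using t by (simp add: x_def power_mult_distrib)
    then have "g x = t" using t a by (simp add: g_def field_simps)
    moreover have "x > 0" using t a by (simp add: x_def)
    ultimately show "t \<in> g ` {0<..}" by force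
  qed (use P in \<open>auto simp: g_def field_simps a\<close>)
  have "(?f has_integral Beta p q) {0..1}" by (rule has_integral_Beta_real) (use pq in auto)
  then have fB: "(?f has_integral Beta p q) {0<..<1}"
    by (subst (asm) has_integral_Icc_iff_Ioo)
  have "?f absolutely_integrable_on {0<..<1}"
    by (rule nonnegative_absolutely_integrable_1) (use fB in auto)
  moreover have "integral {0<..<1} ?f = Beta p q" using fB by (rule integral_unique)
  moreover have "(\<lambda>x. \<bar>g' x\<bar> * ?f (g x)) absolutely_integrable_on {0<..} \<and>
      integral {0<..} (\<lambda>x. \<bar>g' x\<bar> * ?f (g x)) = Beta p q \<longleftrightarrow>
      ?f absolutely_integrable_on (g ` {0<..}) \<and> integral (g ` {0<..}) ?f = Beta p q"
  proof (rule has_absolute_integral_change_of_variables_1')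
    show "(g has_real_derivative g' x) (at x within {0<..})" if "x \<in> {0<..}" for x
      unfolding g_def g'_def using P[of x]
      by (auto intro!: derivative_eq_intros simp: field_simps power2_eq_square)
    show "inj_on g {0<..}"
      using P a by (auto simp: inj_on_def g_def field_simps)
  qed auto
  ultimately have "(\<lambda>x. \<bar>g' x\<bar> * ?f (g x)) absolutely_integrable_on {0<..} \<and>
      integral {0<..} (\<lambda>x. \<bar>g' x\<bar> * ?f (g x)) = Beta p q"
    unfolding img by blast
  then have "((\<lambda>x. \<bar>g' x\<bar> * ?f (g x)) has_integral Beta p q) {0<..}"
    using set_lebesgue_integral_eq_integral(1) integrable_integral by metis
  then have "(\<integral>\<^sup>+x. ennreal (\<bar>g' x\<bar> * ?f (g x)) * indicator {0<..} x \<partial>lborel) = ennreal (Beta p q)"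
    by (intro nn_integral_has_integral_lebesgue') auto
  moreover have "ennreal (\<bar>g' x\<bar> * ?f (g x)) * indicator {0<..} x =
      ennreal (2 * a powr (1 - s)) * (ennreal (x powr s / (x\<^sup>2 + a\<^sup>2)) * indicator {0<..} x)" for x
  proof (cases "x > 0")
    case True
    define A where "A = x\<^sup>2 + a\<^sup>2"
    have A: "A > 0" using P by (simp add: A_def)
    have "1 - g x = (A - x\<^sup>2) / A" using A by (simp add: g_def diff_divide_distrib flip: A_def)
    then have "1 - g x = a\<^sup>2 / A" by (simp add: A_def)
    then have "?f (g x) = (x\<^sup>2) powr (p - 1) / A powr (p - 1) * ((a\<^sup>2) powr (q - 1) / A powr (q - 1))"
      using A by (simp add: g_def A_def powr_divide)
    also have "(x\<^sup>2) powr (p - 1) = x powr (s - 1)"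
    proof -
      have "x\<^sup>2 = x powr 2" using True by simp
      then have "(x\<^sup>2) powr (p - 1) = x powr (2 * (p - 1))" by (simp only: powr_powr)
      also have "2 * (p - 1) = s - 1" by (simp add: p_def field_simps)
      finally show ?thesis .
    qed
    also have "(a\<^sup>2) powr (q - 1) = a powr (- s - 1)"
    proof -
      have "a\<^sup>2 = a powr 2" using a by simp
      then have "(a\<^sup>2) powr (q - 1) = a powr (2 * (q - 1))" by (simp only: powr_powr)
      also have "2 * (q - 1) = - s - 1" by (simp add: q_def field_simps)
      finally show ?thesis .
    qed
    also have "x powr (s - 1) / A powr (p - 1) * (a powr (- s - 1) / A powr (q - 1))
        = x powr (s - 1) * a powr (- s - 1) * A"
    proof -
      have "A powr (p - 1) * A powr (q - 1) = A powr (p + q - 2)" by (simp flip: powr_add)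
      also have "\<dots> = 1 / A" using A pq by (simp add: powr_minus_divide)
      finally show ?thesis using A by (simp add: field_simps)
    qed
    finally have "\<bar>g' x\<bar> * ?f (g x) = 2 * (a\<^sup>2 * a powr (-s - 1)) * (x * x powr (s - 1)) / A"
    proof -
      assume f: "?f (g x) = x powr (s - 1) * a powr (- s - 1) * A"
      have "\<bar>g' x\<bar> = 2 * a\<^sup>2 * x / A\<^sup>2"
        using True by (simp add: g'_def A_def)
      then show ?thesis using A unfolding f by (simp add: power2_eq_square field_simps)
    qed
    also have "a\<^sup>2 * a powr (-s - 1) = a powr (1 - s)"
      using a by (simp flip: powr_numeral powr_add)
    also have "x * x powr (s - 1) = x powr s"
      using True by (simp add: powr_diff)
    finally show ?thesis using True A by (simp add: A_def ennreal_mult'[symmetric])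
  qed simp
  ultimately have "ennreal (2 * a powr (1 - s)) *
      (\<integral>\<^sup>+x. ennreal (x powr s / (x\<^sup>2 + a\<^sup>2)) * indicator {0<..} x \<partial>lborel) = ennreal (Beta p q)"
    by (simp add: nn_integral_cmult)
  then have "ennreal (a powr (s - 1) / 2) * (ennreal (2 * a powr (1 - s)) *
      (\<integral>\<^sup>+x. ennreal (x powr s / (x\<^sup>2 + a\<^sup>2)) * indicator {0<..} x \<partial>lborel))
      = ennreal (a powr (s - 1) / 2) * ennreal (Beta p q)" by simp
  moreover have "ennreal (a powr (s - 1) / 2) * ennreal (2 * a powr (1 - s)) = 1"
    using a by (simp add: ennreal_mult'[symmetric] flip: powr_add)
  ultimately have "(\<integral>\<^sup>+x. ennreal (x powr s / (x\<^sup>2 + a\<^sup>2)) * indicator {0<..} x \<partial>lborel)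
      = ennreal (a powr (s - 1) / 2 * Beta p q)"
    by (simp add: ennreal_mult'[symmetric] mult.assoc[symmetric])
  also have "Beta p q = Gamma p * Gamma q" using pq by (simp add: Beta_def)
  finally show ?thesis by (simp add: p_def q_def mult_ac)
qed

text \<open>The bound is uniform in \<open>N\<close> and in \<open>r\<close> up to 1. It provides
  the dominating function for the expansion of \<open>tanh\<close>, whose ratio
  \<open>exp (-x)\<close> tends to 1 at the origin.\<close>

lemma norm_alternating_geometric_le:
  fixes r :: real
  assumes "0 \<le> r" "r \<le> 1"
  shows "\<bar>\<Sum>n<N. (-1) ^ n * r ^ n\<bar> \<le> 1"
proof -
  have e: "(\<Sum>n<N. (-1) ^ n * r ^ n) = (1 - (-r) ^ N) / (1 + r)"
    using assms geometric_sum[of "-r" N] by (simp flip: power_mult_distrib) (simp add: field_simps)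
  have "\<bar>(-r) ^ N\<bar> \<le> 1" using assms by (simp add: power_abs power_le_one)
  then have b: "(-r) ^ N \<le> 1" "(-r) ^ N \<ge> -1" by linarith+
  have "(-r) ^ N \<ge> - r" if N: "N > 0"
  proof -
    obtain M where M: "N = Suc M" using N by (cases N) auto
    have "\<bar>(-r) ^ M\<bar> \<le> 1" using assms by (simp add: power_abs power_le_one)
    then have "(-r) ^ M \<le> 1" by linarith
    then have "r * (-r) ^ M \<le> r * 1" using assms by (intro mult_left_mono) auto
    then show ?thesis by (simp add: M)
  qed
  then have "0 \<le> 1 - (-r) ^ N" "1 - (-r) ^ N \<le> 1 + r"
    using b assms by (cases "N = 0"; simp)+
  then show ?thesis unfolding e using assms by simp
qed

lemma has_bochner_integral_exp_diff:
  fixes s :: real and n :: nat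
  assumes s: "-1 < s" "s < 0"
  shows "has_bochner_integral lborel
    (\<lambda>x. indicator {0<..} x * (x powr (s - 1) * (exp (- real n * x) - exp (- (real n + 1) * x))))
    (Gamma (s + 1) / (-s) * ((real n + 1) powr (-s) - real n powr (-s)))"
proof (rule has_bochner_integral_nn_integral)
  have "(\<integral>\<^sup>+x. ennreal (indicator {0<..} x * (x powr (s - 1) * (exp (- real n * x) - exp (- (real n + 1) * x)))) \<partial>lborel)
    = (\<integral>\<^sup>+x. ennreal (x powr (s - 1) * (exp (- real n * x) - exp (- (real n + 1) * x))) * indicator {0<..} x \<partial>lborel)"
    by (rule nn_integral_cong) (simp add: indicator_def)
  also have "\<dots> = ennreal (Gamma (s + 1) / (-s) * ((real n + 1) powr (-s) - real n powr (-s)))"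
    by (rule nn_integral_exp_diff[OF s])
  finally show "(\<integral>\<^sup>+x. ennreal (indicator {0<..} x * (x powr (s - 1) * (exp (- real n * x) - exp (- (real n + 1) * x)))) \<partial>lborel)
    = ennreal (Gamma (s + 1) / (-s) * ((real n + 1) powr (-s) - real n powr (-s)))" .
  show "0 \<le> Gamma (s + 1) / (-s) * ((real n + 1) powr (-s) - real n powr (-s))"
    using s by (intro mult_nonneg_nonneg divide_nonneg_nonneg) (auto intro!: powr_mono2)
  show "AE x in lborel. 0 \<le> indicator {0<..} x * (x powr (s - 1) * (exp (- real n * x) - exp (- (real n + 1) * x)))"
    by (intro AE_I2) (auto simp: indicator_def algebra_simps intro!: mult_nonneg_nonneg)
qed measurable

text \<open>This ties the function given only by a uniqueness property to the explicit Euler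
  transform, by continuation from the half-plane where the Dirichlet series converges. With
  \<open>k = 2\<close> it reaches \<open>Re s > -1\<close>, which covers the range of the tanh
  integral.\<close>

lemma dirichlet_eta_eq_eta_trans:
  assumes "Re s > 1 - real k"
  shows "dirichlet_eta s = eta_trans k s"
proof (rule analytic_continuation_open[of "{s. Re s > max 0 (1 - real k)}" "{s. Re s > 1 - real k}"
      dirichlet_eta "eta_trans k"])
  show "open {s. Re s > max 0 (1 - real k)}" "open {s. Re s > 1 - real k}"
    by (rule open_halfspace_Re_gt)+
  show "{s. Re s > max 0 (1 - real k)} \<noteq> {}"
    by (auto intro!: exI[of _ "of_real (max 0 (1 - real k) + 1)"])
  show "connected {s. Re s > 1 - real k}"
    by (intro convex_connected convex_halfspace_Re_gt)
  show "dirichlet_eta z = eta_trans k z" if "z \<in> {s. Re s > max 0 (1 - real k)}" for z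
  proof -
    have z: "Re z > 0" using that by simp
    have "eta_trans k z = eta_trans 0 z" by (rule eta_trans_eq) (use z in auto)
    also have "\<dots> = dirichlet_eta z"
      using sums_unique[OF dirichlet_eta_sums[OF z]] by (simp add: eta_trans_def del: of_nat_Suc)
    finally show ?thesis by simp
  qed
qed (use assms eta_trans_holomorphic dirichlet_eta_holomorphic in auto)

text \<open>Expand \<open>tanh (x / 2)\<close> as \<open>(1 - exp (-x))\<close> times a geometric
  series in \<open>- exp (-x)\<close>. Pairing the exponentials is essential: for
  \<open>s < 0\<close> a single one is not integrable against \<open>x powr (s - 1)\<close> at 0.
  The pairs integrate to the first differences occurring in the Euler transform, and the partial
  sums are dominated by the pair with \<open>n = 0\<close>.\<close>

lemma integral_tanh_eq_eta:
  fixes s :: real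
  assumes s: "-1 < s" "s < 0"
  shows "integrable lborel (\<lambda>x. indicator {0<..} x * (x powr (s - 1) * tanh (x / 2)))"
    and "complex_of_real (LINT x|lborel. indicator {0<..} x * (x powr (s - 1) * tanh (x / 2)))
      = 2 * of_real (Gamma (s + 1) / (-s)) * dirichlet_eta (of_real s)"
proof -
  define c where "c = Gamma (s + 1) / (-s)"
  define h where "h = (\<lambda>n x. (-1) ^ n * (indicator {0<..} x *
      (x powr (s - 1) * (exp (- real n * x) - exp (- (real n + 1) * x)))))"
  let ?T = "\<lambda>x. indicator {0<..} x * (x powr (s - 1) * tanh (x / 2))"
  let ?D = "\<lambda>x. indicator {0<..} x * (x powr (s - 1) * (exp (- real 0 * x) - exp (- (real 0 + 1) * x)))"
  have hb: "has_bochner_integral lborel (h n) ((-1) ^ n * (c * ((real n + 1) powr (-s) - real n powr (-s))))" for n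
    unfolding h_def c_def by (intro has_bochner_integral_mult_right has_bochner_integral_exp_diff s)
  have hb_sum: "has_bochner_integral lborel (\<lambda>x. \<Sum>n<N. h n x)
      (\<Sum>n<N. (-1) ^ n * (c * ((real n + 1) powr (-s) - real n powr (-s))))" for N
    by (intro has_bochner_integral_sum hb)
  have h_eq: "(\<Sum>n<N. h n x) = ?D x * (\<Sum>n<N. (-1) ^ n * exp (-x) ^ n)" for N x
  proof -
    have "h n x = ?D x * ((-1) ^ n * exp (-x) ^ n)" for n
    proof -
      have "exp (- real n * x) = exp (-x) ^ n" using exp_of_nat_mult[of n "-x"] by simp
      moreover have "exp (- (real n + 1) * x) = exp (-x) ^ n * exp (-x)"
        using calculation by (simp add: ring_distribs exp_add exp_diff exp_minus field_simps)
      ultimately show ?thesis by (simp add: h_def algebra_simps)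
    qed
    then show ?thesis by (simp add: sum_distrib_left)
  qed
  have D: "integrable lborel ?D"
    using has_bochner_integral_exp_diff[OF s, of 0] by (simp add: has_bochner_integral_iff)
  have lim: "(\<lambda>N. \<Sum>n<N. h n x) \<longlonglongrightarrow> ?T x" for x
  proof (cases "x > 0")
    case True
    define r where "r = exp (-x)"
    have r: "0 < r" "r < 1" using True by (auto simp: r_def)
    have "(\<lambda>n. (-r) ^ n) sums (1 / (1 - (-r)))" using r by (intro geometric_sums) auto
    then have "(\<lambda>N. \<Sum>n<N. (-1) ^ n * r ^ n) \<longlonglongrightarrow> 1 / (1 + r)"
      by (simp add: sums_def flip: power_mult_distrib)
    then have "(\<lambda>N. ?D x * (\<Sum>n<N. (-1) ^ n * r ^ n)) \<longlonglongrightarrow> ?D x * (1 / (1 + r))"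
      by (intro tendsto_intros)
    moreover have "?D x * (1 / (1 + r)) = ?T x"
      using True by (simp add: tanh_half_eq r_def)
    ultimately show ?thesis unfolding h_eq r_def by simp
  qed (simp add: h_eq)
  have bd: "norm (\<Sum>n<N. h n x) \<le> ?D x" for N x
  proof (cases "x > 0")
    case True
    have D0: "?D x \<ge> 0" using True by simp
    have "\<bar>\<Sum>n<N. (-1) ^ n * exp (-x) ^ n\<bar> \<le> 1"
      by (rule norm_alternating_geometric_le) (use True in auto)
    then have "?D x * \<bar>\<Sum>n<N. (-1) ^ n * exp (-x) ^ n\<bar> \<le> ?D x * 1" by (intro mult_left_mono D0)
    moreover have "norm (\<Sum>n<N. h n x) = ?D x * \<bar>\<Sum>n<N. (-1) ^ n * exp (-x) ^ n\<bar>"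
      unfolding h_eq real_norm_def by (subst abs_mult, subst abs_of_nonneg[OF D0], rule refl)
    ultimately show ?thesis by simp
  qed (simp add: h_eq)
  have meas: "?T \<in> borel_measurable lborel" "(\<lambda>x. \<Sum>n<N. h n x) \<in> borel_measurable lborel" for N
  proof -
    show "(\<lambda>x. \<Sum>n<N. h n x) \<in> borel_measurable lborel" for N
      using hb_sum[of N] by (intro borel_measurable_integrable) (simp add: has_bochner_integral_iff)
    then show "?T \<in> borel_measurable lborel"
      by (rule borel_measurable_LIMSEQ_real[rotated]) (rule lim)
  qed
  have AEs: "AE x in lborel. (\<lambda>N. \<Sum>n<N. h n x) \<longlonglongrightarrow> ?T x"
    "\<And>N. AE x in lborel. norm (\<Sum>n<N. h n x) \<le> ?D x"
    using lim bd by auto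
  show "integrable lborel ?T"
    by (rule integrable_dominated_convergence[OF meas D AEs])
  have "(\<lambda>N. LINT x|lborel. (\<Sum>n<N. h n x)) \<longlonglongrightarrow> (LINT x|lborel. ?T x)"
    by (rule integral_dominated_convergence[OF meas D AEs])
  also have "(\<lambda>N. LINT x|lborel. (\<Sum>n<N. h n x)) =
      (\<lambda>N. \<Sum>n<N. (-1) ^ n * (c * ((real n + 1) powr (-s) - real n powr (-s))))"
    using hb_sum by (auto simp: has_bochner_integral_iff)
  finally have "(\<lambda>n. (-1) ^ n * (c * ((real n + 1) powr (-s) - real n powr (-s)))) sums (LINT x|lborel. ?T x)"
    by (simp add: sums_def)
  then have S: "(\<lambda>n. complex_of_real ((-1) ^ n * (c * ((real n + 1) powr (-s) - real n powr (-s)))))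
      sums complex_of_real (LINT x|lborel. ?T x)"
    by (simp only: sums_of_real_iff)
  define E where "E = (\<Sum>n. (-1) ^ n * eta_diff 1 (of_real s) (of_nat (Suc n)))"
  have E: "(\<lambda>n. (-1) ^ n * eta_diff 1 (of_real s) (of_nat (Suc n))) sums E"
    using eta_trans_sums[of "of_real s" 1] s unfolding E_def by (simp add: sums_iff)
  have eta: "dirichlet_eta (of_real s) = 1 / 2 + E / 2"
    using dirichlet_eta_eq_eta_trans[of 2 "of_real s"] eta_trans_Suc[of "of_real s" 1] s
    by (simp add: eta_trans_def E_def numeral_2_eq_2)
  have "(\<lambda>n. complex_of_real c * ((-1) ^ n * eta_diff 1 (of_real s) (of_nat (Suc n)))) sums (of_real c * E)"
    by (intro sums_mult E)
  also have "(\<lambda>n. complex_of_real c * ((-1) ^ n * eta_diff 1 (of_real s) (of_nat (Suc n))))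
    = (\<lambda>n. complex_of_real ((-1) ^ Suc n * (c * ((real (Suc n) + 1) powr (-s) - real (Suc n) powr (-s)))))"
  proof
    fix n
    have "of_nat (Suc n) powr (- complex_of_real s) = of_real (real (Suc n) powr (-s))"
      "(of_nat (Suc n) + 1) powr (- complex_of_real s) = of_real ((real (Suc n) + 1) powr (-s))"
      using powr_of_real[of "real (Suc n)" "-s"] powr_of_real[of "real (Suc n) + 1" "-s"] by simp_all
    then show "complex_of_real c * ((-1) ^ n * eta_diff 1 (of_real s) (of_nat (Suc n)))
      = complex_of_real ((-1) ^ Suc n * (c * ((real (Suc n) + 1) powr (-s) - real (Suc n) powr (-s))))"
      by (simp add: algebra_simps del: of_nat_Suc)
  qed
  \<comment> \<open>The integrated series starts at \<open>n = 0\<close>, where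
    \<open>0 powr (-s)\<close> is 0 and the term is \<open>c\<close>; the series for
    \<open>E\<close> begins one index later, hence the shift and the sign.\<close>
  finally have "(\<lambda>n. complex_of_real ((-1) ^ n * (c * ((real n + 1) powr (-s) - real n powr (-s)))))
    sums (of_real c * E + complex_of_real c)"
    using s by (subst (asm) sums_Suc_iff) simp
  then have "complex_of_real (LINT x|lborel. ?T x) = of_real c * E + of_real c"
    using S sums_unique2 by blast
  also have "\<dots> = 2 * of_real c * dirichlet_eta (of_real s)"
    unfolding eta by (simp add: algebra_simps)
  finally show "complex_of_real (LINT x|lborel. ?T x) = 2 * of_real (Gamma (s + 1) / (-s)) * dirichlet_eta (of_real s)"
    by (simp add: c_def)
qed

text \<open>Integrate both the exponential series and the partial fractions of \<open>tanh (x/2)\<close> against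
  \<open>x^(s-1)\<close>.\<close>
lemma eta_functional_equation_real:
  fixes s :: real
  assumes s: "-1 < s" "s < 0"
  shows "dirichlet_eta (of_real s) * of_real (Gamma (s + 1))
    = of_real (- s * Gamma ((1 + s) / 2) * Gamma ((1 - s) / 2) * pi powr (s - 1)
        * (\<Sum>k. real (2 * k + 1) powr (s - 1)))"
    and "summable (\<lambda>k. real (2 * k + 1) powr (s - 1))"
proof -
  define I where "I = (LINT x|lborel. indicator {0<..} x * (x powr (s - 1) * tanh (x / 2)))"
  define B where "B = Gamma ((1 + s) / 2) * Gamma ((1 - s) / 2) / 2"
  have B: "B > 0" using s by (simp add: B_def)
  have I: "I \<ge> 0" unfolding I_def by (intro integral_nonneg_AE AE_I2) (auto simp: indicator_def)
  have "ennreal I = (\<integral>\<^sup>+x. ennreal (indicator {0<..} x * (x powr (s - 1) * tanh (x / 2))) \<partial>lborel)"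
    unfolding I_def
    by (rule nn_integral_eq_integral[symmetric, OF integral_tanh_eq_eta(1)[OF s]])
      (auto simp: indicator_def)
  also have "\<dots> = (\<integral>\<^sup>+x. (\<Sum>k. ennreal (4 * (x powr s / (x\<^sup>2 + (of_nat (2 * k + 1) * pi)\<^sup>2))) * indicator {0<..} x) \<partial>lborel)"
  proof (rule nn_integral_cong)
    fix x :: real
    show "ennreal (indicator {0<..} x * (x powr (s - 1) * tanh (x / 2)))
      = (\<Sum>k. ennreal (4 * (x powr s / (x\<^sup>2 + (of_nat (2 * k + 1) * pi)\<^sup>2))) * indicator {0<..} x)"
    proof (cases "x > 0")
      case True
      have "(\<lambda>k. x powr (s - 1) * (4 * x / (x\<^sup>2 + (of_nat (2 * k + 1) * pi)\<^sup>2))) sums (x powr (s - 1) * tanh (x / 2))"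
        by (intro sums_mult tanh_sums)
      also have "(\<lambda>k. x powr (s - 1) * (4 * x / (x\<^sup>2 + (of_nat (2 * k + 1) * pi)\<^sup>2)))
        = (\<lambda>k. 4 * (x powr s / (x\<^sup>2 + (of_nat (2 * k + 1) * pi)\<^sup>2)))"
        using True by (auto simp: powr_diff)
      finally have "(\<Sum>k. ennreal (4 * (x powr s / (x\<^sup>2 + (of_nat (2 * k + 1) * pi)\<^sup>2))))
          = ennreal (x powr (s - 1) * tanh (x / 2))"
        by (intro suminf_ennreal_eq) auto
      then show ?thesis using True by simp
    qed simp
  qed
  also have "\<dots> = (\<Sum>k. \<integral>\<^sup>+x. ennreal (4 * (x powr s / (x\<^sup>2 + (of_nat (2 * k + 1) * pi)\<^sup>2))) * indicator {0<..} x \<partial>lborel)"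
    by (rule nn_integral_suminf) measurable
  also have "\<dots> = (\<Sum>k. ennreal (4 * ((of_nat (2 * k + 1) * pi) powr (s - 1) * B)))"
  proof (rule suminf_cong)
    fix k
    have "(\<integral>\<^sup>+x. ennreal (4 * (x powr s / (x\<^sup>2 + (of_nat (2 * k + 1) * pi)\<^sup>2))) * indicator {0<..} x \<partial>lborel)
      = (\<integral>\<^sup>+x. ennreal 4 * (ennreal (x powr s / (x\<^sup>2 + (of_nat (2 * k + 1) * pi)\<^sup>2)) * indicator {0<..} x) \<partial>lborel)"
      by (rule nn_integral_cong) (subst ennreal_mult', auto simp: mult_ac)
    also have "\<dots> = ennreal 4 * ennreal ((of_nat (2 * k + 1) * pi) powr (s - 1) * B)"
      unfolding B_def using s
      by (subst nn_integral_cmult) (auto simp: nn_integral_powr_div_square_add simp del: of_nat_add of_nat_mult)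
    finally show "(\<integral>\<^sup>+x. ennreal (4 * (x powr s / (x\<^sup>2 + (of_nat (2 * k + 1) * pi)\<^sup>2))) * indicator {0<..} x \<partial>lborel)
      = ennreal (4 * ((of_nat (2 * k + 1) * pi) powr (s - 1) * B))"
      by (subst ennreal_mult') simp_all
  qed
  finally have IS: "ennreal I = (\<Sum>k. ennreal (4 * ((of_nat (2 * k + 1) * pi) powr (s - 1) * B)))" .
  have nn: "0 \<le> 4 * ((of_nat (2 * k + 1) * pi) powr (s - 1) * B)" for k
    using B by simp
  \<comment> \<open>Convergence of the series over odd numbers is read off from the finiteness of
    the integral \<open>I\<close>.\<close>
  have sm: "summable (\<lambda>k. 4 * ((of_nat (2 * k + 1) * pi) powr (s - 1) * B))"
    by (rule summable_suminf_not_top[OF nn]) (use IS in \<open>metis ennreal_neq_top\<close>)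
  have e: "4 * ((of_nat (2 * k + 1) * pi) powr (s - 1) * B) = (4 * pi powr (s - 1) * B) * real (2 * k + 1) powr (s - 1)" for k
    by (subst powr_mult) auto
  have c: "4 * pi powr (s - 1) * B \<noteq> 0" using B by simp
  show sm': "summable (\<lambda>k. real (2 * k + 1) powr (s - 1))"
    using sm c unfolding e by (simp only: summable_cmult_iff) simp
  have "ennreal I = ennreal (\<Sum>k. 4 * ((of_nat (2 * k + 1) * pi) powr (s - 1) * B))"
    unfolding IS by (rule suminf_ennreal2[OF nn sm])
  then have "I = (\<Sum>k. 4 * ((of_nat (2 * k + 1) * pi) powr (s - 1) * B))"
    using I suminf_nonneg[OF sm nn] by simp
  also have "\<dots> = (4 * pi powr (s - 1) * B) * (\<Sum>k. real (2 * k + 1) powr (s - 1))"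
    unfolding e by (rule suminf_mult[OF sm'])
  finally have I2: "I = (4 * pi powr (s - 1) * B) * (\<Sum>k. real (2 * k + 1) powr (s - 1))" .
  have "complex_of_real I = 2 * of_real (Gamma (s + 1) / (-s)) * dirichlet_eta (of_real s)"
    unfolding I_def by (rule integral_tanh_eq_eta(2)[OF s])
  then have "dirichlet_eta (of_real s) * of_real (Gamma (s + 1)) = of_real (- s * I / 2)"
    using s by (simp add: field_simps)
  also have "- s * I / 2 = - s * Gamma ((1 + s) / 2) * Gamma ((1 - s) / 2) * pi powr (s - 1)
        * (\<Sum>k. real (2 * k + 1) powr (s - 1))"
    by (simp add: I2 B_def)
  finally show "dirichlet_eta (of_real s) * of_real (Gamma (s + 1))
    = of_real (- s * Gamma ((1 + s) / 2) * Gamma ((1 - s) / 2) * pi powr (s - 1)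
        * (\<Sum>k. real (2 * k + 1) powr (s - 1)))" .
qed

text \<open>The terms with even base sum to \<open>2 powr (-s) * Z\<close>. Removing them twice
  gives the alternating series, removing them once the odd one. Since index \<open>n\<close> stands
  for base \<open>n + 1\<close>, even bases sit at odd indices.\<close>

lemma Dirichlet_series_parity_sums:
  fixes s :: complex
  assumes s: "Re s > 1"
  defines "Z \<equiv> (\<Sum>n. of_nat (Suc n) powr (-s))"
  shows "(\<lambda>n. (-1) ^ n * of_nat (Suc n) powr (-s)) sums ((1 - 2 powr (1 - s)) * Z)"
    and "(\<lambda>k. of_nat (2 * k + 1) powr (-s)) sums ((1 - 2 powr (-s)) * Z)"
proof -
  define a where "a = (\<lambda>n. of_nat (Suc n) powr (-s) :: complex)"
  have "summable a" using summable_norm_cancel[OF summable_norm_Suc_powr[OF s]] by (simp add: a_def)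
  then have a: "a sums Z" by (simp add: Z_def a_def summable_sums)
  have "(\<lambda>n. if even n then 0 else a (n div 2)) sums Z"
    using a sums_mono_reindex[of "\<lambda>n. 2 * n + 1" "\<lambda>n. if even n then 0 else a (n div 2)" Z]
    by (fastforce simp: strict_mono_def elim!: oddE)
  then have "(\<lambda>n. 2 powr (-s) * (if even n then 0 else a (n div 2))) sums (2 powr (-s) * Z)"
    by (intro sums_mult)
  also have "(\<lambda>n. 2 powr (-s) * (if even n then 0 else a (n div 2))) = (\<lambda>n. if even n then 0 else a n)"
  proof
    fix n show "2 powr (-s) * (if even n then 0 else a (n div 2)) = (if even n then 0 else a n)"
    proof (cases "even n")
      case False
      then obtain m where m: "n = 2 * m + 1" by (elim oddE)
      have "a n = (2 * of_nat (Suc m)) powr (-s)" by (simp add: a_def m algebra_simps)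
      also have "\<dots> = 2 powr (-s) * a m"
        unfolding a_def by (subst powr_times_real) (auto simp del: of_nat_Suc)
      finally show ?thesis using m by simp
    qed auto
  qed
  finally have ev: "(\<lambda>n. if even n then 0 else a n) sums (2 powr (-s) * Z)" .
  have "(\<lambda>n. a n - 2 * (if even n then 0 else a n)) sums (Z - 2 * (2 powr (-s) * Z))"
    by (intro sums_diff sums_mult a ev)
  also have "(\<lambda>n. a n - 2 * (if even n then 0 else a n)) = (\<lambda>n. (-1) ^ n * a n)" by auto
  also have "Z - 2 * (2 powr (-s) * Z) = (1 - 2 powr (1 - s)) * Z"
    by (simp add: powr_diff powr_minus field_simps)
  finally show "(\<lambda>n. (-1) ^ n * of_nat (Suc n) powr (-s)) sums ((1 - 2 powr (1 - s)) * Z)"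
    by (simp add: a_def)
  have "(\<lambda>n. a n - (if even n then 0 else a n)) sums (Z - 2 powr (-s) * Z)"
    by (intro sums_diff a ev)
  also have "(\<lambda>n. a n - (if even n then 0 else a n)) = (\<lambda>n. if even n then a n else 0)" by auto
  finally have "(\<lambda>k. (\<lambda>n. if even n then a n else 0) (2 * k)) sums (Z - 2 powr (-s) * Z)"
    by (subst sums_mono_reindex) (auto simp: strict_mono_def elim!: evenE)
  then show "(\<lambda>k. of_nat (2 * k + 1) powr (-s)) sums ((1 - 2 powr (-s)) * Z)"
    by (simp add: a_def algebra_simps)
qed

lemma eta_eq_pole_free_zeta:
  assumes "Re s > -1"
  shows "(s - 1) * dirichlet_eta s = (1 - 2 powr (1 - s)) * pole_free_zeta s"
proof (rule analytic_continuation_open[of "{s. Re s > 1}" "{s. Re s > -1}"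
      "\<lambda>s. (s - 1) * dirichlet_eta s" "\<lambda>s. (1 - 2 powr (1 - s)) * pole_free_zeta s"])
  show "open {s. Re s > 1}" "open {s. Re s > -1}" by (rule open_halfspace_Re_gt)+
  show "{s. Re s > 1} \<noteq> {}" by (auto intro: exI[of _ 2])
  show "connected {s. Re s > -1}" by (intro convex_connected convex_halfspace_Re_gt)
  fix s assume "s \<in> {s. Re s > 1}"
  then have s: "Re s > 1" by simp
  then show "(s - 1) * dirichlet_eta s = (1 - 2 powr (1 - s)) * pole_free_zeta s"
    using sums_unique2[OF dirichlet_eta_sums[of s] Dirichlet_series_parity_sums(1)[OF s]]
    by (simp add: pole_free_zeta_eq mult_ac)
qed (use assms in \<open>auto intro!: holomorphic_intros dirichlet_eta_holomorphic pole_free_zeta_holomorphic\<close>)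

text \<open>On the real segment between 1 and 2 the reflection formulas at \<open>z / 2\<close> and
  at \<open>z\<close> turn the Gamma values of the real identity into \<open>cos\<close> and
  \<open>Gamma z\<close>. The segment accumulates at 3/2, so the identity theorem extends the
  equation to the half-plane. The factor \<open>w - 1\<close> removes the pole of zeta at 1.\<close>

theorem eta_functional_equation:
  assumes "Re w > 0"
  shows "(w - 1) * dirichlet_eta (1 - w) =
    - 2 * of_real pi powr (-w) * cos (of_real (pi / 2) * w) * Gamma w * (1 - 2 powr (-w)) * pole_free_zeta w"
    (is "?L w = ?R w")
proof -
  let ?S = "{w. Re w > 0}"
  let ?U = "of_real ` {1<..<2} :: complex set"
  have "?L w - ?R w = 0"
  proof (rule analytic_continuation[of "\<lambda>w. ?L w - ?R w" ?S ?U "of_real (3/2)"])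
    have "dirichlet_eta \<circ> (\<lambda>w. 1 - w) holomorphic_on ?S"
      by (rule holomorphic_on_compose_gen[of _ _ _ UNIV])
        (auto intro!: holomorphic_intros dirichlet_eta_holomorphic)
    then have "(\<lambda>w. dirichlet_eta (1 - w)) holomorphic_on ?S" by (simp add: o_def)
    moreover have "pole_free_zeta holomorphic_on ?S"
      by (rule holomorphic_on_subset[OF pole_free_zeta_holomorphic]) auto
    moreover have "Gamma holomorphic_on ?S" by (rule holomorphic_Gamma) (use Re_pos_not_nonpos_Ints in \<open>auto simp: disjoint_iff\<close>)
    ultimately show "(\<lambda>w. ?L w - ?R w) holomorphic_on ?S"
      by (intro holomorphic_intros) (auto simp: disjoint_iff Re_pos_not_nonpos_Ints)
    show "open ?S" by (rule open_halfspace_Re_gt)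
    show "connected ?S" by (intro convex_connected convex_halfspace_Re_gt)
    show "of_real (3/2) islimpt ?U"
    proof -
      have "\<exists>x'\<in>?U. x' \<noteq> of_real (3/2) \<and> dist x' (of_real (3/2)) < e" if "e > 0" for e :: real
        using that by (intro bexI[of _ "of_real (3/2 + min (e/2) (1/4))"])
          (auto simp: dist_of_real dist_real_def simp del: of_real_add of_real_divide intro!: imageI)
      then show ?thesis by (simp add: islimpt_approachable)
    qed
    fix z assume "z \<in> ?U"
    then obtain x where x: "z = of_real x" "1 < x" "x < 2" by auto
    have s: "-1 < 1 - x" "1 - x < 0" using x by auto
    define \<Lambda> where "\<Lambda> = (\<Sum>k. real (2 * k + 1) powr (-x))"
    have FE: "dirichlet_eta (1 - z) * Gamma (2 - z) = (z - 1) * Gamma (1 - z / 2) * Gamma (z / 2) * of_real pi powr (-z) * of_real \<Lambda>"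
    proof -
      have "Gamma (2 - z) = of_real (Gamma (1 - x + 1))"
        by (simp add: x flip: Gamma_complex_of_real)
      moreover have "Gamma (1 - z / 2) = of_real (Gamma ((1 + (1 - x)) / 2))"
        by (simp add: x diff_divide_distrib flip: Gamma_complex_of_real)
      moreover have "Gamma (z / 2) = of_real (Gamma ((1 - (1 - x)) / 2))"
        by (simp add: x flip: Gamma_complex_of_real)
      moreover have "of_real pi powr (-z) = of_real (pi powr (-x))"
        using powr_of_real[of pi "-x"] by (simp add: x)
      ultimately show ?thesis
        using eta_functional_equation_real(1)[OF s] by (simp add: x \<Lambda>_def)
    qed
    have "(\<lambda>k. complex_of_real (real (2 * k + 1) powr (-x))) sums of_real \<Lambda>"
      unfolding \<Lambda>_def sums_of_real_iff using eta_functional_equation_real(2)[OF s] by (simp add: summable_sums)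
    also have "(\<lambda>k. complex_of_real (real (2 * k + 1) powr (-x))) = (\<lambda>k. of_nat (2 * k + 1) powr (-z))"
      using powr_of_real[of "real (2 * _ + 1)" "-x"] by (simp add: x)
    finally have \<Lambda>_sums: "(\<lambda>k. of_nat (2 * k + 1) powr (-z)) sums of_real \<Lambda>" .
    have "of_real \<Lambda> = (1 - 2 powr (-z)) * (\<Sum>n. of_nat (Suc n) powr (-z))"
      by (rule sums_unique2[OF \<Lambda>_sums Dirichlet_series_parity_sums(2)]) (use x in simp)
    then have \<Lambda>: "(z - 1) * of_real \<Lambda> = (1 - 2 powr (-z)) * pole_free_zeta z"
      using pole_free_zeta_eq[of z] x by simp
    have sn: "sin (of_real pi * z) \<noteq> 0" "sin (of_real (pi / 2) * z) \<noteq> 0"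
    proof -
      have "sin (pi * x) < 0" using x by (intro sin_lt_zero) (auto simp: field_simps)
      moreover have "sin (pi / 2 * x) > 0" using x by (intro sin_gt_zero) (auto simp: field_simps)
      moreover have "sin (of_real pi * z) = of_real (sin (pi * x))" "sin (of_real (pi / 2) * z) = of_real (sin (pi / 2 * x))"
        by (simp_all add: x flip: sin_of_real of_real_mult)
      ultimately show "sin (of_real pi * z) \<noteq> 0" "sin (of_real (pi / 2) * z) \<noteq> 0" by simp_all
    qed
    have dbl: "sin (of_real pi * z) = 2 * sin (of_real (pi / 2) * z) * cos (of_real (pi / 2) * z)"
      using sin_double[of "of_real (pi / 2) * z"] by simp
    have G1: "Gamma (1 - z / 2) * Gamma (z / 2) * sin (of_real (pi / 2) * z) = of_real pi"
      using Gamma_reflection_complex[of "z / 2"] sn by (simp add: field_simps)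
    have G2: "Gamma (2 - z) * Gamma z * sin (of_real pi * z) = (1 - z) * of_real pi"
    proof -
      have "1 - z \<notin> \<int>\<^sub>\<le>\<^sub>0"
      proof
        assume "1 - z \<in> \<int>\<^sub>\<le>\<^sub>0"
        then obtain n where "1 - z = of_int n" by (auto elim: nonpos_Ints_cases)
        then have "Re (1 - z) = of_int n" by simp
        then have "1 - x = of_int n" by (simp add: x)
        then have "real_of_int n < 0" "real_of_int n > -1" using x(2,3) by linarith+
        then have "n < 0" "n > -1" by linarith+
        then show False by simp
      qed
      then have g: "Gamma (2 - z) = (1 - z) * Gamma (1 - z)" using Gamma_plus1[of "1 - z"] by simp
      have r: "Gamma z * Gamma (1 - z) * sin (of_real pi * z) = of_real pi"
        unfolding Gamma_reflection_complex[of z] using sn(1) by simp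
      have "Gamma (2 - z) * Gamma z * sin (of_real pi * z) = (1 - z) * (Gamma z * Gamma (1 - z) * sin (of_real pi * z))"
        unfolding g by (simp only: mult_ac)
      then show ?thesis unfolding r .
    qed
    have "?L z * (Gamma (2 - z) * Gamma z * sin (of_real pi * z) * sin (of_real (pi / 2) * z))
        = (z - 1) * (dirichlet_eta (1 - z) * Gamma (2 - z)) * (Gamma z * sin (of_real pi * z) * sin (of_real (pi / 2) * z))"
      by (simp add: mult_ac)
    also have "\<dots> = (z - 1) * (Gamma (1 - z / 2) * Gamma (z / 2) * sin (of_real (pi / 2) * z)) *
        of_real pi powr (-z) * ((z - 1) * of_real \<Lambda>) * Gamma z * sin (of_real pi * z)"
      unfolding FE by (simp add: mult_ac)
    also have "\<dots> = ?R z * ((1 - z) * of_real pi * sin (of_real (pi / 2) * z))"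
      unfolding G1 \<Lambda> dbl by (simp add: algebra_simps)
    finally have "?L z * ((1 - z) * of_real pi * sin (of_real (pi / 2) * z)) = ?R z * ((1 - z) * of_real pi * sin (of_real (pi / 2) * z))"
      unfolding G2 .
    moreover have "(1 - z) * of_real pi * sin (of_real (pi / 2) * z) \<noteq> 0"
      using sn x by simp
    ultimately have "?L z = ?R z" using mult_right_cancel by blast
    then show "?L z - ?R z = 0" by simp
  qed (use assms in auto)
  then show ?thesis by (simp only: right_minus_eq)
qed

text \<open>The classical function \<open>s (s - 1) / 2 * pi^(-s/2) * Gamma (s/2) * zeta s\<close>.
  Here \<open>s / 2\<close> is absorbed into the Gamma factor and \<open>s - 1\<close> into the zeta
  factor, which leaves no removable singularity at 0 or 1.\<close>

definition riemann_xi :: "complex \<Rightarrow> complex" where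
  "riemann_xi w = of_real pi powr (- w / 2) * Gamma (w / 2 + 1) * pole_free_zeta w"

lemma Gamma_nonzero_Re_pos: "Re z > 0 \<Longrightarrow> Gamma z \<noteq> (0 :: complex)"
  by (simp add: Gamma_eq_zero_iff Re_pos_not_nonpos_Ints)

lemma two_powr_neq_1: "Re z \<noteq> 0 \<Longrightarrow> 2 powr z \<noteq> (1 :: complex)"
proof
  assume "Re z \<noteq> 0" "2 powr z = 1"
  then have "norm (2 powr z :: complex) = 1" by simp
  then have "2 powr Re z = (1::real)" using norm_powr_real_powr[of 2 z] by simp
  with \<open>Re z \<noteq> 0\<close> show False by (simp add: powr_def)
qed

text \<open>The asymmetric functional equation becomes symmetric through the reflection formula at
  \<open>(1 + w) / 2\<close> and the duplication formula at \<open>w / 2\<close>. The bound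
  \<open>Re w < 2\<close> keeps \<open>1 - w\<close> inside the half-plane to which
  \<open>pole_free_zeta\<close> has been continued.\<close>

lemma riemann_xi_reflect:
  assumes w: "0 < Re w" "Re w < 2" "w \<noteq> 1"
  shows "riemann_xi (1 - w) = riemann_xi w"
proof -
  define T where "T = (2 powr w :: complex)"
  define B where "B = (of_real pi powr (-w) :: complex)"
  define C where "C = cos (of_real (pi / 2) * w)"
  define F F1 where "F = pole_free_zeta w" and "F1 = pole_free_zeta (1 - w)"
  define G1 G2 G3 where "G1 = Gamma ((1 - w) / 2)" and "G2 = Gamma (w / 2)" and "G3 = Gamma ((1 + w) / 2)"
  have T0: "T \<noteq> 0" "1 - 2 powr (-w) \<noteq> 0" using two_powr_neq_1[of "-w"] w by (auto simp: T_def)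
  have Tm: "2 powr (-w) = 1 / T" by (simp add: T_def powr_minus field_simps)
  have "(w - 1) * ((1 - T) * F1) = (w - 1) * (- w * dirichlet_eta (1 - w))"
    using eta_eq_pole_free_zeta[of "1 - w"] w by (simp add: T_def F1_def)
  also have "\<dots> = - w * ((w - 1) * dirichlet_eta (1 - w))" by simp
  also have "\<dots> = 2 * w * B * C * Gamma w * (1 - 2 powr (-w)) * F"
    unfolding eta_functional_equation[OF w(1)] by (simp add: B_def C_def F_def)
  also have "(w - 1) * ((1 - T) * F1) = (1 - w) * T * F1 * (1 - 2 powr (-w))"
    unfolding Tm using T0 by (simp add: field_simps)
  finally have "((1 - w) * T * F1) * (1 - 2 powr (-w)) = (2 * w * B * C * Gamma w * F) * (1 - 2 powr (-w))"
    by (simp only: mult_ac)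
  then have 1: "(1 - w) * T * F1 = 2 * w * B * C * Gamma w * F"
    by (rule iffD1[OF mult_right_cancel[OF T0(2)]])
  have wn: "(1 - w) / 2 \<notin> \<int>\<^sub>\<le>\<^sub>0"
  proof
    assume "(1 - w) / 2 \<in> \<int>\<^sub>\<le>\<^sub>0"
    then obtain n where n: "(1 - w) / 2 = of_int n" "n \<le> 0" by (auto elim: nonpos_Ints_cases)
    then have "Re ((1 - w) / 2) = of_int n" by simp
    then have "n = 0" using w n(2) by simp
    with n w show False by simp
  qed
  have G1: "G1 * C * G3 = of_real pi"
  proof -
    have e1: "sin (of_real pi * ((1 + w) / 2)) = C"
    proof -
      have "of_real pi * ((1 + w) / 2) = of_real (pi / 2) * w + of_real (pi / 2)" by (simp add: field_simps)
      moreover have "sin (of_real (pi / 2) :: complex) = 1" "cos (of_real (pi / 2) :: complex) = 0"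
        by (simp_all only: sin_of_real cos_of_real) simp_all
      ultimately show ?thesis by (simp only: C_def sin_add) simp
    qed
    have e2: "1 - (1 + w) / 2 = (1 - w) / 2" by (simp add: field_simps)
    have "rGamma ((1 + w) / 2) * rGamma ((1 - w) / 2) = C / of_real pi"
      using rGamma_reflection_complex[of "(1 + w) / 2"] by (simp only: e1 e2)
    moreover have "G1 * rGamma ((1 - w) / 2) = 1" "G3 * rGamma ((1 + w) / 2) = 1"
      using wn Re_pos_not_nonpos_Ints[of "(1 + w) / 2"] w by (auto simp: G1_def G3_def Gamma_def rGamma_eq_zero_iff)
    moreover have "G1 * G3 * (rGamma ((1 + w) / 2) * rGamma ((1 - w) / 2))
        = (G1 * rGamma ((1 - w) / 2)) * (G3 * rGamma ((1 + w) / 2))" by (simp only: mult_ac)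
    ultimately have "G1 * G3 * (C / of_real pi) = 1" by simp
    then show ?thesis by (simp add: field_simps)
  qed
  have G2: "G2 * G3 = (2 / T) * of_real (sqrt pi) * Gamma w"
  proof -
    have e: "w / 2 + 1 / 2 = (1 + w) / 2" by (simp add: field_simps)
    have "exp ((1 - w) * of_real (ln 2)) = 2 / T"
      using exp_of_real[of "ln 2"] by (simp add: T_def powr_def exp_diff ring_distribs Ln_of_real' flip: Ln_of_real)
    moreover have "Gamma (w / 2) * Gamma ((1 + w) / 2) =
        exp ((1 - 2 * (w / 2)) * of_real (ln 2)) * of_real (sqrt pi) * Gamma (2 * (w / 2))"
      by (rule Gamma_legendre_duplication[of "w / 2", unfolded e]) (use Re_pos_not_nonpos_Ints[of "w / 2"] Re_pos_not_nonpos_Ints[of "(1 + w) / 2"] w in auto)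
    ultimately show ?thesis by (simp add: G2_def G3_def)
  qed
  have x1: "riemann_xi (1 - w) = of_real pi powr (- (1 - w) / 2) * ((1 - w) / 2 * G1) * F1"
    unfolding riemann_xi_def Gamma_plus1[OF wn] by (simp add: G1_def F1_def)
  have x2: "riemann_xi w = of_real pi powr (- w / 2) * (w / 2 * G2) * F"
    unfolding riemann_xi_def using Gamma_plus1[OF Re_pos_not_nonpos_Ints[of "w / 2"]] w by (simp add: G2_def F_def)
  have P: "of_real pi powr (- (1 - w) / 2) * B * of_real pi = of_real pi powr (- w / 2) * of_real (sqrt pi)"
  proof -
    have sq: "of_real (sqrt pi) = (of_real pi powr (1 / 2) :: complex)"
      using powr_of_real[of pi "1/2"] by (simp add: powr_half_sqrt)
    have "of_real pi powr (- (1 - w) / 2) * B * of_real pi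
        = of_real pi powr (- (1 - w) / 2) * of_real pi powr (-w) * of_real pi powr 1"
      by (simp add: B_def)
    also have "\<dots> = of_real pi powr (- (1 - w) / 2 + -w + 1)" by (simp only: powr_add)
    also have "- (1 - w) / 2 + -w + 1 = - w / 2 + 1 / 2" by (simp add: field_simps)
    also have "of_real pi powr (- w / 2 + 1 / 2) = (of_real pi powr (- w / 2) * of_real pi powr (1 / 2) :: complex)"
      by (simp only: powr_add)
    finally show ?thesis unfolding sq .
  qed
  have "riemann_xi (1 - w) * (T * G3) = of_real pi powr (- (1 - w) / 2) * G1 / 2 * G3 * ((1 - w) * T * F1)"
    unfolding x1 by (simp add: field_simps)
  also have "\<dots> = w * (of_real pi powr (- (1 - w) / 2) * B * (G1 * C * G3)) * Gamma w * F"
    unfolding 1 by (simp add: field_simps)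
  also have "\<dots> = w * (of_real pi powr (- w / 2) * of_real (sqrt pi)) * Gamma w * F"
    unfolding G1 P ..
  also have "\<dots> = of_real pi powr (- w / 2) * (w / 2) * F * T * ((2 / T) * of_real (sqrt pi) * Gamma w)"
    using T0 by (simp add: field_simps)
  also have "\<dots> = riemann_xi w * (T * G3)"
    unfolding G2[symmetric] x2 by (simp add: field_simps)
  finally show ?thesis using T0 Gamma_nonzero_Re_pos[of "(1 + w) / 2"] w
    by (simp add: G3_def)
qed

section \<open>Monotonicity of the modulus of xi\<close>

lemma cnj_pole_free_zeta:
  assumes "Re s > -1"
  shows "pole_free_zeta (cnj s) = cnj (pole_free_zeta s)"
proof -
  have c: "cnj (of_nat (Suc n) powr z) = of_nat (Suc n) powr cnj z" for n z
    using cnj_powr[of "of_nat (Suc n)" z] by simp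
  have "zeta_term n (cnj s) = cnj (zeta_term n s)" for n
    unfolding zeta_term_def
    by (simp only: complex_cnj_add complex_cnj_diff complex_cnj_mult complex_cnj_divide c complex_cnj_minus
        complex_cnj_one complex_cnj_numeral)
  then have "(\<lambda>n. zeta_term n (cnj s)) sums cnj (\<Sum>n. zeta_term n s)"
    using summable_sums[OF summable_zeta_term[OF assms]] by (simp add: sums_cnj)
  then show ?thesis unfolding pole_free_zeta_def by (simp add: sums_iff)
qed

lemma pole_free_zeta_lower_bound:
  assumes w: "Re w > 1"
  shows "norm (w - 1) * (Re w - 1) \<le> norm (pole_free_zeta w) * norm (pole_free_zeta (of_real (Re w)))"
proof -
  have "norm (w - 1) * (Re w - 1) * 1 \<le> norm (w - 1) * (Re w - 1) *
     (norm (\<Sum>n. of_nat (Suc n) powr (-w) :: complex) * norm (\<Sum>n. of_nat (Suc n) powr (-of_real (Re w)) :: complex))"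
    using w by (intro mult_left_mono zeta_lower_bound w) auto
  also have "\<dots> = norm (pole_free_zeta w) * norm (pole_free_zeta (of_real (Re w)))"
  proof -
    have "norm (complex_of_real (Re w) - 1) = Re w - 1"
      using w norm_of_real[of "Re w - 1", where 'a = complex] by simp
    then show ?thesis using w by (simp add: pole_free_zeta_eq norm_mult mult_ac)
  qed
  finally show ?thesis by simp
qed

lemma pole_free_zeta_nonzero:
  assumes w: "Re w > 1"
  shows "pole_free_zeta w \<noteq> 0"
proof
  assume "pole_free_zeta w = 0"
  then have "norm (w - 1) * (Re w - 1) \<le> 0" using pole_free_zeta_lower_bound[OF w] by simp
  moreover have "norm (w - 1) > 0" using w by auto
  ultimately show False using w by (simp add: mult_le_0_iff)
qed

text \<open>Comparison with the real point \<open>Re w\<close> bounds zeta below by the reciprocal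
  of \<open>Z\<close>, its value at \<open>1 + e\<close>; the factor \<open>w - 1\<close>
  contributes at least \<open>e\<close>.\<close>

lemma pole_free_zeta_inverse_bound:
  assumes e: "e > 0"
  obtains c where "c > 0" "\<And>w. Re w \<ge> 1 + e \<Longrightarrow> norm (pole_free_zeta w) \<ge> c"
proof -
  define Z where "Z = (\<Sum>n. real (Suc n) powr (- (1 + e)))"
  have sZ: "summable (\<lambda>n. real (Suc n) powr (- (1 + e)))" by (rule summable_Suc_powr) (use e in simp)
  have "real (Suc 0) powr (- (1 + e)) \<le> Z"
    unfolding Z_def using sum_le_suminf[OF sZ, of "{0}"] by simp
  then have Z: "Z \<ge> 1" by simp
  have "norm (pole_free_zeta w) \<ge> e / Z" if w: "Re w \<ge> 1 + e" for w
  proof -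
    have w1: "Re w > 1" using w e by simp
    have "norm (\<Sum>n. of_nat (Suc n) powr (-of_real (Re w)) :: complex) \<le> Z"
      unfolding Z_def
    proof (rule norm_suminf_le[OF _ sZ])
      fix n
      have "norm (of_nat (Suc n) powr (-of_real (Re w)) :: complex) = real (Suc n) powr (- Re w)"
        unfolding norm_of_nat_Suc_powr by simp
      also have "\<dots> \<le> real (Suc n) powr (- (1 + e))" by (rule powr_mono) (use w in auto)
      finally show "norm (of_nat (Suc n) powr (-of_real (Re w)) :: complex) \<le> real (Suc n) powr (- (1 + e))" .
    qed
    then have "1 \<le> norm (\<Sum>n. of_nat (Suc n) powr (-w) :: complex) * Z"
      using zeta_lower_bound[OF w1] mult_left_mono[of _ Z "norm (\<Sum>n. of_nat (Suc n) powr (-w) :: complex)"]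
      by (smt (verit) norm_ge_zero)
    then have "1 / Z \<le> norm (\<Sum>n. of_nat (Suc n) powr (-w) :: complex)" using Z by (simp add: field_simps)
    moreover have "e \<le> norm (w - 1)" using w complex_Re_le_cmod[of "w - 1"] by simp
    ultimately have "e * (1 / Z) \<le> norm (w - 1) * norm (\<Sum>n. of_nat (Suc n) powr (-w) :: complex)"
      using e Z by (intro mult_mono) auto
    then show ?thesis using w1 by (simp add: pole_free_zeta_eq norm_mult)
  qed
  then show ?thesis using that[of "e / Z"] e Z by simp
qed

lemma riemann_xi_holomorphic: "riemann_xi holomorphic_on {s. Re s > -1}"
  unfolding riemann_xi_def
proof (intro holomorphic_intros pole_free_zeta_holomorphic)
  show "w / 2 + 1 \<notin> \<int>\<^sub>\<le>\<^sub>0" if "w \<in> {s. Re s > -1}" for w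
    by (rule Re_pos_not_nonpos_Ints) (use that in simp)
qed auto

lemma cnj_riemann_xi:
  assumes "Re s > -1"
  shows "riemann_xi (cnj s) = cnj (riemann_xi s)"
  unfolding riemann_xi_def
  using cnj_powr[of "of_real pi" "- s / 2"] cnj_Gamma[of "s / 2 + 1"] by (simp add: cnj_pole_free_zeta assms)

lemma riemann_xi_nonzero: "Re w > 1 \<Longrightarrow> riemann_xi w \<noteq> 0"
  unfolding riemann_xi_def using pole_free_zeta_nonzero Gamma_nonzero_Re_pos[of "w / 2 + 1"] by auto

text \<open>A horizontal shift changes the Gamma factor by a bounded ratio only, so the quotient
  satisfies the polynomial bound that the maximum principle in a half-plane requires. The condition
  on \<open>a - d\<close> keeps the numerator where the cubic bound for zeta holds; the Gamma
  argument then has real part at least \<open>1 - 1/4 = 3/4\<close>.\<close>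

lemma riemann_xi_quotient_growth:
  fixes d e a :: real
  assumes d: "0 < d" and e: "e > 0" and a: "a \<ge> 1 + e" "a - d \<ge> - 1 / 2"
  obtains C where "C > 0" "\<And>w. Re w \<ge> a \<Longrightarrow> norm (riemann_xi (w - of_real d) / riemann_xi w) \<le> C * (1 + norm w) ^ 3"
proof -
  obtain A where A: "A > 0" "\<And>s. Re s \<ge> -1/2 \<Longrightarrow> norm (pole_free_zeta s) \<le> A * (1 + norm s) ^ 3"
    using pole_free_zeta_growth by blast
  obtain c where c: "c > 0" "\<And>w. Re w \<ge> 1 + e \<Longrightarrow> norm (pole_free_zeta w) \<ge> c"
    using pole_free_zeta_inverse_bound[OF e] by blast
  define B where "B = pi powr (d / 2) * (Gamma (3 / 4) / Gamma (3 / 4 + d / 2))"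
  have B: "B > 0" unfolding B_def using d by (intro mult_pos_pos divide_pos_pos Gamma_real_pos) auto
  have "norm (riemann_xi (w - of_real d) / riemann_xi w) \<le> (B * (A * (1 + d) ^ 3) / c) * (1 + norm w) ^ 3"
    if w: "Re w \<ge> a" for w
  proof -
    define Z where "Z = (w - of_real d) / 2 + 1"
    have Z: "Re Z \<ge> 3 / 4" using w a by (simp add: Z_def field_simps)
    have wZ: "w / 2 + 1 = Z + of_real (d / 2)" by (simp add: Z_def field_simps)
    have "riemann_xi (w - of_real d) / riemann_xi w =
       (of_real pi powr (- (w - of_real d) / 2) / of_real pi powr (- w / 2)) *
       (Gamma Z / Gamma (Z + of_real (d / 2))) * (pole_free_zeta (w - of_real d) / pole_free_zeta w)"
      unfolding riemann_xi_def wZ Z_def[symmetric] by simp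
    also have "norm \<dots> = norm (of_real pi powr (- (w - of_real d) / 2) / of_real pi powr (- w / 2) :: complex) *
       norm (Gamma Z / Gamma (Z + of_real (d / 2))) * (norm (pole_free_zeta (w - of_real d)) / norm (pole_free_zeta w))"
      by (simp only: norm_mult norm_divide)
    also have "norm (of_real pi powr (- (w - of_real d) / 2) / of_real pi powr (- w / 2) :: complex) = pi powr (d / 2)"
    proof -
      have "- (w - of_real d) / 2 - - w / 2 = of_real (d / 2)" by (simp add: field_simps)
      then have "of_real pi powr (- (w - of_real d) / 2) / of_real pi powr (- w / 2) = (of_real pi powr of_real (d / 2) :: complex)"
        by (simp only: powr_diff[symmetric])
      then show ?thesis using norm_powr_real_powr[of "of_real pi" "of_real (d / 2)"] by simp
    qed
    also have "pi powr (d / 2) * norm (Gamma Z / Gamma (Z + of_real (d / 2))) *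
        (norm (pole_free_zeta (w - of_real d)) / norm (pole_free_zeta w)) \<le>
        pi powr (d / 2) * (Gamma (3 / 4) / Gamma (3 / 4 + d / 2)) * (A * (1 + norm (w - of_real d)) ^ 3 / c)"
    proof (intro mult_mono norm_Gamma_ratio_le Z frac_le)
      show "norm (pole_free_zeta (w - of_real d)) \<le> A * (1 + norm (w - of_real d)) ^ 3"
        by (rule A(2)) (use w a in simp)
      show "c \<le> norm (pole_free_zeta w)" by (rule c(2)) (use w a in simp)
    qed (use d A c Gamma_real_pos[of "3/4"] Gamma_real_pos[of "3/4 + d/2"] in
        \<open>auto intro!: mult_nonneg_nonneg divide_nonneg_nonneg\<close>)
    also have "\<dots> \<le> B * (A * ((1 + d) * (1 + norm w)) ^ 3 / c)"
    proof -
      have "norm (w - of_real d) \<le> norm w + d" using norm_triangle_ineq4[of w "of_real d"] d by simp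
      then have "1 + norm (w - of_real d) \<le> (1 + d) * (1 + norm w)"
      proof -
        have "0 \<le> d * norm w" using d by simp
        moreover have "(1 + d) * (1 + norm w) = 1 + norm w + d + d * norm w" by (simp add: algebra_simps)
        ultimately show ?thesis using \<open>norm (w - of_real d) \<le> norm w + d\<close> by linarith
      qed
      then show ?thesis unfolding B_def[symmetric] using B A c
        by (intro mult_left_mono divide_right_mono power_mono) auto
    qed
    finally show ?thesis by (simp add: power_mult_distrib mult_ac)
  qed
  then show ?thesis using that[of "B * (A * (1 + d) ^ 3) / c"] A B c d by simp
qed

text \<open>On \<open>Re w = a\<close> the points \<open>w\<close> and \<open>2 a - w\<close> are conjugate, and the functional equation turns
  \<open>\<xi> (2 a - w)\<close> into \<open>\<xi> (w + 1 - 2 a)\<close>; so the quotient has modulus 1 there.\<close>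
lemma riemann_xi_reflected_le:
  fixes a :: real
  assumes a: "1 < a" "a \<le> 5 / 4" and w: "Re w \<ge> a"
  shows "norm (riemann_xi (w - of_real (2 * a - 1))) \<le> norm (riemann_xi w)"
proof -
  define d where "d = 2 * a - 1"
  have d: "d > 0" using a by (simp add: d_def)
  let ?R = "\<lambda>w. riemann_xi (w - of_real d) / riemann_xi w"
  \<comment> \<open>Here \<open>a - d = 1 - a\<close>, and \<open>a \<le> 5 / 4\<close> makes it at
    least -1/4.\<close>
  obtain C where C: "C > 0" "\<And>w. Re w \<ge> a \<Longrightarrow> norm (?R w) \<le> C * (1 + norm w) ^ 3"
    using riemann_xi_quotient_growth[of d "a - 1" a] a d by (auto simp: d_def)
  have "norm (?R w) \<le> 1"
  proof (rule phragmen_lindelof_half_plane[where f = ?R and S = "{w. Re w > max 1 (d - 1)}", OF _ _ _ C w])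
    have "riemann_xi \<circ> (\<lambda>w. w - of_real d) holomorphic_on {w. Re w > max 1 (d - 1)}"
      by (rule holomorphic_on_compose_gen[OF _ riemann_xi_holomorphic]) (auto intro!: holomorphic_intros)
    then show "?R holomorphic_on {w. Re w > max 1 (d - 1)}"
      using riemann_xi_nonzero
      by (intro holomorphic_intros holomorphic_on_subset[OF riemann_xi_holomorphic]) (auto simp: o_def)
    show "{w. Re w \<ge> a} \<subseteq> {w. Re w > max 1 (d - 1)}" using a by (auto simp: d_def)
    fix z assume z: "Re z = a"
    have "1 - cnj z = z - of_real d" using z by (simp add: d_def complex_eq_iff)
    moreover have "cnj z \<noteq> 1" using z a by auto
    ultimately have "riemann_xi (z - of_real d) = cnj (riemann_xi z)"
      using riemann_xi_reflect[of "cnj z"] cnj_riemann_xi[of z] z a by simp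
    then show "norm (?R z) \<le> 1" by (simp add: norm_divide)
  qed
  then show ?thesis using riemann_xi_nonzero[of w] w a
    by (simp add: norm_divide divide_le_eq d_def split: if_splits)
qed

text \<open>The previous lemma gives monotonicity across the line \<open>Re w = a\<close>; a second application of the
  maximum principle, to the quotient with the small shift \<open>h\<close>, carries it to the right.\<close>
lemma riemann_xi_mono:
  fixes a h :: real
  assumes a: "1 < a" "a \<le> 5 / 4" and h: "0 < h" "h < 2 * (a - 1)" and w: "Re w \<ge> a + h / 2"
  shows "norm (riemann_xi (w - of_real h)) \<le> norm (riemann_xi w)"
proof -
  let ?R = "\<lambda>w. riemann_xi (w - of_real h) / riemann_xi w"
  obtain C where C: "C > 0" "\<And>w. Re w \<ge> a + h / 2 \<Longrightarrow> norm (?R w) \<le> C * (1 + norm w) ^ 3"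
    using riemann_xi_quotient_growth[of h "a - 1" "a + h / 2"] a h by auto
  have "norm (?R w) \<le> 1"
  proof (rule phragmen_lindelof_half_plane[where f = ?R and S = "{w. Re w > 1}", OF _ _ _ C w])
    have "riemann_xi \<circ> (\<lambda>w. w - of_real h) holomorphic_on {w. Re w > 1}"
      by (rule holomorphic_on_compose_gen[OF _ riemann_xi_holomorphic]) (use a h in \<open>auto intro!: holomorphic_intros\<close>)
    then show "?R holomorphic_on {w. Re w > 1}"
      using riemann_xi_nonzero
      by (intro holomorphic_intros holomorphic_on_subset[OF riemann_xi_holomorphic]) (auto simp: o_def)
    show "{w. Re w \<ge> a + h / 2} \<subseteq> {w. Re w > 1}" using a h by auto
    fix z assume z: "Re z = a + h / 2"
    \<comment> \<open>On this boundary line reflection followed by conjugation sends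
      \<open>z - h\<close> to \<open>z - (2 * a - 1)\<close>, where the preceding comparison
      applies. The bound on \<open>h\<close> keeps \<open>Re y > 1\<close>.\<close>
    define y where "y = z - of_real h"
    have "riemann_xi (1 - cnj y) = riemann_xi (cnj y)"
      by (rule riemann_xi_reflect) (use z a h in \<open>auto simp: y_def complex_eq_iff\<close>)
    also have "riemann_xi (cnj y) = cnj (riemann_xi y)"
      by (rule cnj_riemann_xi) (use z a h in \<open>simp add: y_def\<close>)
    also have "1 - cnj y = z - of_real (2 * a - 1)" using z by (simp add: y_def complex_eq_iff)
    finally have "norm (riemann_xi y) = norm (riemann_xi (z - of_real (2 * a - 1)))" by simp
    also have "\<dots> \<le> norm (riemann_xi z)" by (rule riemann_xi_reflected_le) (use z a h in auto)
    finally show "norm (?R z) \<le> 1"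
      using riemann_xi_nonzero[of z] z a h by (simp add: norm_divide y_def)
  qed
  then show ?thesis using riemann_xi_nonzero[of w] w a h
    by (simp add: norm_divide divide_le_eq split: if_splits)
qed

text \<open>Differentiate the squared modulus along the horizontal line to the left. Multiplying by
  \<open>cnj (f w)\<close> in place of dividing by \<open>f w\<close> keeps the sign condition
  meaningful at zeros of \<open>f\<close> and stable under limits.\<close>

lemma norm_mono_imp_Re_deriv_nonneg:
  fixes f :: "complex \<Rightarrow> complex"
  assumes f: "(f has_field_derivative f') (at w)"
    and mono: "\<forall>\<^sub>F h in at_right 0. norm (f (w - of_real h)) \<le> norm (f w)"
  shows "Re (f' * cnj (f w)) \<ge> 0"
proof -
  have f': "((\<lambda>h. f (w - of_real h)) has_vector_derivative - f') (at (0::real))"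
  proof -
    have "((\<lambda>h::real. w - of_real h) has_vector_derivative -1) (at 0)"
      by (auto intro!: derivative_eq_intros)
    from field_vector_diff_chain_at[OF this, of f f'] f show ?thesis by (simp add: o_def)
  qed
  have "((\<lambda>h::real. Re (f (w - of_real h) * cnj (f (w - of_real h)))) has_vector_derivative
      Re (f (w - of_real 0) * cnj (- f') + - f' * cnj (f (w - of_real 0)))) (at (0::real))"
    by (intro bounded_linear.has_vector_derivative[OF bounded_linear_Re] has_vector_derivative_mult f'
        bounded_linear.has_vector_derivative[OF bounded_linear_cnj])
  then have "((\<lambda>h::real. (norm (f (w - of_real h)))\<^sup>2) has_real_derivative (- 2 * Re (f' * cnj (f w)))) (at 0)"
    unfolding has_real_derivative_iff_has_vector_derivative complex_norm_square[symmetric]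
    by (simp add: algebra_simps flip: complex_norm_square)
  then have d: "((\<lambda>h. ((norm (f (w - of_real h)))\<^sup>2 - (norm (f w))\<^sup>2) / h) \<longlongrightarrow> - 2 * Re (f' * cnj (f w))) (at_right 0)"
    unfolding has_field_derivative_iff by (auto intro: tendsto_within_subset)
  have "- 2 * Re (f' * cnj (f w)) \<le> 0"
  proof (rule tendsto_upperbound[OF d])
    show "\<forall>\<^sub>F h in at_right 0. ((norm (f (w - of_real h)))\<^sup>2 - (norm (f w))\<^sup>2) / h \<le> 0"
      using mono eventually_at_right_less[of 0]
    proof eventually_elim
      case (elim h)
      then have "(norm (f (w - of_real h)))\<^sup>2 \<le> (norm (f w))\<^sup>2" by (intro power_mono) auto
      then show ?case using elim by (simp add: divide_nonpos_pos)
    qed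
  qed simp
  then show ?thesis by simp
qed

lemma deriv_riemann_xi:
  "Re w > -1 \<Longrightarrow> (riemann_xi has_field_derivative deriv riemann_xi w) (at w)"
  by (rule holomorphic_derivI[OF riemann_xi_holomorphic open_halfspace_Re_gt]) simp

text \<open>To the right of the line \<open>Re w = 1\<close> the sign comes from monotonicity under
  all small shifts, with a reference abscissa \<open>a\<close> strictly between 1 and
  \<open>Re w\<close>. The line itself is reached by continuity from the right.\<close>

lemma Re_deriv_riemann_xi_nonneg:
  assumes w: "Re w \<ge> 1"
  shows "Re (deriv riemann_xi w * cnj (riemann_xi w)) \<ge> 0"
proof -
  have gt: "Re (deriv riemann_xi w * cnj (riemann_xi w)) \<ge> 0" if w: "Re w > 1" for w
  proof -
    define a where "a = min (5 / 4) ((Re w + 1) / 2)"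
    have a: "1 < a" "a \<le> 5 / 4" "a < Re w" using w by (auto simp: a_def min_def)
    have "\<forall>\<^sub>F h in at_right 0. norm (riemann_xi (w - of_real h)) \<le> norm (riemann_xi w)"
    proof -
      have "\<forall>\<^sub>F h in at_right 0. 0 < h \<and> h < 2 * (a - 1) \<and> h < 2 * (Re w - a)"
        using a by (auto simp: eventually_at_right_field intro!: exI[of _ "min (2 * (a - 1)) (2 * (Re w - a))"])
      then show ?thesis
        by eventually_elim (rule riemann_xi_mono[OF a(1,2)], auto)
    qed
    then show ?thesis
      by (intro norm_mono_imp_Re_deriv_nonneg[OF deriv_riemann_xi]) (use w in auto)
  qed
  have hol: "deriv riemann_xi holomorphic_on {s. Re s > -1}"
    by (rule holomorphic_deriv[OF riemann_xi_holomorphic open_halfspace_Re_gt])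
  have iso: "isCont riemann_xi w" "isCont (deriv riemann_xi) w"
    using w by (auto intro!: DERIV_isCont deriv_riemann_xi
      holomorphic_derivI[OF hol open_halfspace_Re_gt])
  have t: "((\<lambda>h::real. w + of_real h) \<longlongrightarrow> w + of_real 0) (at_right 0)" by (intro tendsto_intros)
  have "((\<lambda>h::real. Re (deriv riemann_xi (w + of_real h) * cnj (riemann_xi (w + of_real h))))
      \<longlongrightarrow> Re (deriv riemann_xi w * cnj (riemann_xi w))) (at_right 0)"
    using isCont_tendsto_compose[OF iso(1)] isCont_tendsto_compose[OF iso(2)] t
    by (intro tendsto_intros) auto
  then show ?thesis
  proof (rule tendsto_lowerbound)
    show "\<forall>\<^sub>F h in at_right 0. 0 \<le> Re (deriv riemann_xi (w + of_real h) * cnj (riemann_xi (w + of_real h)))"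
      using eventually_at_right_less[of "0::real"] by eventually_elim (rule gt, use w in simp)
  qed simp
qed

section \<open>Zeros near the real axis: Boole summation\<close>

text \<open>The kernel is the Euler polynomial \<open>t^4 - 2 t^3 + t = q (1 + q)\<close> with \<open>q = t (1 - t) \<le> 1/4\<close>.\<close>
lemma boole_error:
  fixes f0 f1 f2 f3 f4 f5 :: "real \<Rightarrow> complex" and \<Psi> B :: "real \<Rightarrow> real" and a :: real
  assumes f0: "\<And>x. a \<le> x \<Longrightarrow> x \<le> a + 1 \<Longrightarrow> (f0 has_vector_derivative f1 x) (at x)"
    and f1: "\<And>x. a \<le> x \<Longrightarrow> x \<le> a + 1 \<Longrightarrow> (f1 has_vector_derivative f2 x) (at x)"
    and f2: "\<And>x. a \<le> x \<Longrightarrow> x \<le> a + 1 \<Longrightarrow> (f2 has_vector_derivative f3 x) (at x)"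
    and f3: "\<And>x. a \<le> x \<Longrightarrow> x \<le> a + 1 \<Longrightarrow> (f3 has_vector_derivative f4 x) (at x)"
    and f4: "\<And>x. a \<le> x \<Longrightarrow> x \<le> a + 1 \<Longrightarrow> (f4 has_vector_derivative f5 x) (at x)"
    and \<Psi>: "\<And>x. a \<le> x \<Longrightarrow> x \<le> a + 1 \<Longrightarrow> (\<Psi> has_real_derivative B x) (at x)"
    and B: "\<And>x. a \<le> x \<Longrightarrow> x \<le> a + 1 \<Longrightarrow> norm (f5 x) \<le> B x"
  shows "norm ((f0 a - f0 (a + 1)) / 2 + (f1 a + f1 (a + 1)) / 4 - (f3 a + f3 (a + 1)) / 48)
    \<le> 5 / 768 * (\<Psi> (a + 1) - \<Psi> a)"
proof -
  define E where "E = (\<lambda>x. ((x-a)^4 - 2 * (x-a)^3 + (x-a)) / 48)"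
  define G where "G = (\<lambda>x. E x *\<^sub>R f4 x - ((4 * (x-a)^3 - 6 * (x-a)^2 + 1) / 48) *\<^sub>R f3 x
     + (((x-a)^2 - (x-a)) / 4) *\<^sub>R f2 x - ((x - a - 1/2) / 2) *\<^sub>R f1 x + (1/2) *\<^sub>R f0 x)"
  have G: "(G has_vector_derivative E x *\<^sub>R f5 x) (at x)"
    if x: "a \<le> x" "x \<le> a + 1" for x
  proof -
    have 4: "((\<lambda>x. E x *\<^sub>R f4 x) has_vector_derivative
        E x *\<^sub>R f5 x + ((4 * (x-a)^3 - 6 * (x-a)^2 + 1) / 48) *\<^sub>R f4 x) (at x)"
      unfolding E_def
      by (rule has_vector_derivative_scaleR[OF _ f4[OF x]])
        (auto intro!: derivative_eq_intros simp: field_simps)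
    have 3: "((\<lambda>x. ((4 * (x-a)^3 - 6 * (x-a)^2 + 1) / 48) *\<^sub>R f3 x) has_vector_derivative
        ((4 * (x-a)^3 - 6 * (x-a)^2 + 1) / 48) *\<^sub>R f4 x + (((x-a)^2 - (x-a)) / 4) *\<^sub>R f3 x) (at x)"
      by (rule has_vector_derivative_scaleR[OF _ f3[OF x]])
        (auto intro!: derivative_eq_intros simp: field_simps)
    have 2: "((\<lambda>x. (((x-a)^2 - (x-a)) / 4) *\<^sub>R f2 x) has_vector_derivative
        (((x-a)^2 - (x-a)) / 4) *\<^sub>R f3 x + ((x - a - 1/2) / 2) *\<^sub>R f2 x) (at x)"
      by (rule has_vector_derivative_scaleR[OF _ f2[OF x]])
        (auto intro!: derivative_eq_intros simp: field_simps)
    have 1: "((\<lambda>x. ((x - a - 1/2) / 2) *\<^sub>R f1 x) has_vector_derivative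
        ((x - a - 1/2) / 2) *\<^sub>R f2 x + (1/2) *\<^sub>R f1 x) (at x)"
      by (rule has_vector_derivative_scaleR[OF _ f1[OF x]])
        (auto intro!: derivative_eq_intros simp: field_simps)
    have 0: "((\<lambda>x. (1/2) *\<^sub>R f0 x) has_vector_derivative (1/2) *\<^sub>R f1 x + 0 *\<^sub>R f0 x) (at x)"
      by (rule has_vector_derivative_scaleR[OF _ f0[OF x]]) (auto intro!: derivative_eq_intros)
    show ?thesis unfolding G_def
      using has_vector_derivative_add[OF has_vector_derivative_diff[OF has_vector_derivative_add[OF
            has_vector_derivative_diff[OF 4 3] 2] 1] 0]
      by (simp add: algebra_simps)
  qed
  have "norm (G (a + 1) - G a) \<le> 5 / 768 * \<Psi> (a + 1) - 5 / 768 * \<Psi> a"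
  proof (rule differentiable_bound_general[where \<phi> = "\<lambda>x. 5 / 768 * \<Psi> x" and \<phi>' = "\<lambda>x. 5 / 768 * B x"])
    show "continuous_on {a..a+1} G"
      by (rule continuous_on_vector_derivative) (use G has_vector_derivative_at_within in fastforce)
    have "continuous_on {a..a+1} \<Psi>"
      by (rule DERIV_continuous_on) (use \<Psi> has_field_derivative_at_within in fastforce)
    then show "continuous_on {a..a+1} (\<lambda>x. 5 / 768 * \<Psi> x)" by (intro continuous_intros)
    fix x assume x: "a < x" "x < a + 1"
    show "((\<lambda>x. 5 / 768 * \<Psi> x) has_vector_derivative 5 / 768 * B x) (at x)"
      using x by (intro has_vector_derivative_mult_right) (auto simp: \<Psi> simp flip: has_real_derivative_iff_has_vector_derivative)
    define q where "q = (x - a) * (1 - (x - a))"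
    have q: "0 \<le> q" "q \<le> 1/4"
    proof -
      show "0 \<le> q" using x by (simp add: q_def)
      have "1/4 - q = (x - a - 1/2)\<^sup>2" by (simp add: q_def power2_eq_square algebra_simps)
      then show "q \<le> 1/4" using zero_le_power2[of "x - a - 1/2"] by linarith
    qed
    \<comment> \<open>At \<open>q = 1/4\<close> the kernel takes its maximum
      \<open>(1/4) * (5/4) / 48 = 5/768\<close>, the constant of the error bound.\<close>
    have "E x = q * (1 + q) / 48"
      by (simp add: E_def q_def algebra_simps power2_eq_square power3_eq_cube power4_eq_xxxx)
    moreover have "q * (1 + q) \<le> 1/4 * (1 + 1/4)" using q by (intro mult_mono) auto
    moreover have "0 \<le> q * (1 + q)" using q by simp
    ultimately have E: "0 \<le> E x" "E x \<le> 5 / 768" by simp_all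
    then have "norm (E x *\<^sub>R f5 x) = E x * norm (f5 x)" by simp
    also have "\<dots> \<le> 5 / 768 * norm (f5 x)" by (rule mult_right_mono[OF E(2)]) simp
    also have "\<dots> \<le> 5 / 768 * B x" using B[of x] x by simp
    finally show "norm (E x *\<^sub>R f5 x) \<le> 5 / 768 * B x" .
  qed (use G in auto)
  moreover have "G (a + 1) - G a = - ((f0 a - f0 (a + 1)) / 2 + (f1 a + f1 (a + 1)) / 4 - (f3 a + f3 (a + 1)) / 48)"
    by (simp add: G_def E_def scaleR_conv_of_real field_simps)
  ultimately show ?thesis by (simp only: norm_minus_cancel right_diff_distrib)
qed

text \<open>Boole summation: \<open>boole_term n s\<close> approximates the alternating sum of \<open>k^(-s)\<close> over \<open>k \<ge> n\<close>,
  and \<open>boole_rest n s\<close> is the error of one step of the recursion this sum satisfies.\<close>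
definition boole_term :: "nat \<Rightarrow> complex \<Rightarrow> complex" where
  "boole_term n s = of_nat n powr (-s) / 2 + s * of_nat n powr (-s-1) / 4
     - s * (s + 1) * (s + 2) * of_nat n powr (-s-3) / 48"

definition boole_term_deriv :: "nat \<Rightarrow> complex \<Rightarrow> complex" where
  "boole_term_deriv n s = - of_real (ln n) * boole_term n s + of_nat n powr (-s-1) / 4
     - (3 * s\<^sup>2 + 6 * s + 2) * of_nat n powr (-s-3) / 48"

definition boole_rest :: "nat \<Rightarrow> complex \<Rightarrow> complex" where
  "boole_rest n s = of_nat n powr (-s) - boole_term n s - boole_term (Suc n) s"

definition boole_rest_deriv :: "nat \<Rightarrow> complex \<Rightarrow> complex" where
  "boole_rest_deriv n s = - of_real (ln n) * of_nat n powr (-s) - boole_term_deriv n s - boole_term_deriv (Suc n) s"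

lemma has_field_derivative_of_real_powr:
  fixes f :: "complex \<Rightarrow> complex"
  assumes "r > 0" "(f has_field_derivative f') (at s within A)"
  shows "((\<lambda>s. of_real r powr f s) has_field_derivative of_real (ln r) * of_real r powr f s * f') (at s within A)"
proof -
  have "((\<lambda>z. of_real r powr z) has_field_derivative of_real (ln r) * of_real r powr f s) (at (f s))"
    using has_field_derivative_powr_right[of "of_real r :: complex" "f s"] assms(1) by (simp add: Ln_of_real)
  from DERIV_chain2[OF this assms(2)] show ?thesis .
qed

lemma has_field_derivative_of_nat_powr:
  fixes f :: "complex \<Rightarrow> complex"
  assumes "n > 0" "(f has_field_derivative f') (at s within A)"
  shows "((\<lambda>s. of_nat n powr f s) has_field_derivative of_real (ln n) * of_nat n powr f s * f') (at s within A)"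
  using has_field_derivative_of_real_powr[of "real n"] assms by simp

lemma has_field_derivative_boole_term:
  assumes "n > 0"
  shows "(boole_term n has_field_derivative boole_term_deriv n s) (at s within A)"
proof -
  have "((\<lambda>s. of_nat n powr (-s) / 2 + s * of_nat n powr (-s-1) / 4
     - (s ^ 3 + 3 * s\<^sup>2 + 2 * s) * of_nat n powr (-s-3) / 48) has_field_derivative boole_term_deriv n s) (at s within A)"
    using assms
    by (auto intro!: derivative_eq_intros has_field_derivative_of_nat_powr simp: boole_term_deriv_def boole_term_def
        field_simps power2_eq_square power3_eq_cube)
  moreover have "boole_term n = (\<lambda>s. of_nat n powr (-s) / 2 + s * of_nat n powr (-s-1) / 4
     - (s ^ 3 + 3 * s\<^sup>2 + 2 * s) * of_nat n powr (-s-3) / 48)"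
    by (auto simp: boole_term_def fun_eq_iff algebra_simps power2_eq_square power3_eq_cube)
  ultimately show ?thesis by simp
qed

lemma has_field_derivative_boole_rest:
  assumes "n > 0"
  shows "(boole_rest n has_field_derivative boole_rest_deriv n s) (at s within A)"
proof -
  have "((\<lambda>s. of_nat n powr (-s) - boole_term n s - boole_term (Suc n) s)
      has_field_derivative boole_rest_deriv n s) (at s within A)"
    using assms
    by (auto intro!: derivative_eq_intros has_field_derivative_boole_term has_field_derivative_of_nat_powr simp: boole_rest_deriv_def)
  then show ?thesis by (simp add: boole_rest_def[abs_def])
qed

lemma has_vector_derivative_ln_powr:
  fixes c A B :: complex and x :: real
  assumes "x > 0"
  shows "((\<lambda>x. (A + B * of_real (ln x)) * of_real x powr c) has_vector_derivative
    (B + c * A + c * B * of_real (ln x)) * of_real x powr (c - 1)) (at x)"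
proof -
  have "((\<lambda>x. complex_of_real (ln x)) has_vector_derivative of_real (1 / x)) (at x)"
    using assms by (auto intro!: derivative_eq_intros has_vector_derivative_of_real
        simp flip: has_real_derivative_iff_has_vector_derivative)
  then have "((\<lambda>x. A + B * of_real (ln x)) has_vector_derivative B * of_real (1 / x)) (at x)"
    using has_vector_derivative_add[OF has_vector_derivative_const has_vector_derivative_mult_right] by fastforce
  from has_vector_derivative_mult[OF this has_vector_derivative_of_real_powr[OF assms, of c]]
  have "((\<lambda>x. (A + B * of_real (ln x)) * of_real x powr c) has_vector_derivative
    (A + B * of_real (ln x)) * (c * of_real x powr (c - 1)) + B * of_real (1 / x) * of_real x powr c) (at x)"
    by simp
  moreover have "B * of_real (1 / x) * of_real x powr c = (B * of_real x powr (c - 1) :: complex)"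
    using assms by (simp add: powr_diff)
  ultimately show ?thesis by (simp only: algebra_simps)
qed

text \<open>The Pochhammer product of length five: the fifth derivative of
  \<open>x powr (-s)\<close> in \<open>x\<close> is its negative times \<open>x powr (-s-5)\<close>.
  The derivative in \<open>s\<close> is needed because the expansion is applied to \<eta>' and not
  to \<eta>.\<close>

definition rising5 :: "complex \<Rightarrow> complex" where
  "rising5 s = s * (s + 1) * (s + 2) * (s + 3) * (s + 4)"

definition rising5_deriv :: "complex \<Rightarrow> complex" where
  "rising5_deriv s = (s + 1) * (s + 2) * (s + 3) * (s + 4) + s * (s + 2) * (s + 3) * (s + 4)
     + s * (s + 1) * (s + 3) * (s + 4) + s * (s + 1) * (s + 2) * (s + 4) + s * (s + 1) * (s + 2) * (s + 3)"

text \<open>The primitive, vanishing at infinity, of the bound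
  \<open>(P + Q * ln x) * x powr (- (Re s + 5))\<close> for the fifth derivative, where
  \<open>P\<close> and \<open>Q\<close> are the norms of \<open>rising5_deriv s\<close> and
  \<open>rising5 s\<close>. Being a primitive, it makes the errors of successive steps
  telescope.\<close>

definition boole_primitive :: "complex \<Rightarrow> real \<Rightarrow> real" where
  "boole_primitive s x = - (norm (rising5_deriv s) / (Re s + 4)
     + norm (rising5 s) * (ln x / (Re s + 4) + 1 / (Re s + 4)\<^sup>2)) * x powr (- (Re s + 4))"

lemma has_real_derivative_log_power_primitive:
  fixes a P Q x :: real
  assumes a: "a > 0" and x: "x > 0"
  shows "((\<lambda>x. - (P / a + Q * (ln x / a + 1 / a\<^sup>2)) * x powr (- a)) has_real_derivative
    (P + Q * ln x) * x powr (- a - 1)) (at x)"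
proof -
  define y where "y = x powr (- a - 1)"
  have y: "x powr (- a) = x * y" using x by (simp add: y_def powr_diff)
  have "((\<lambda>x. - (P / a + Q * (ln x / a + 1 / a\<^sup>2)) * x powr (- a)) has_real_derivative
    - (Q * (1 / x / a)) * x powr (- a) + (- a * x powr (- a - 1)) * - (P / a + Q * (ln x / a + 1 / a\<^sup>2))) (at x)"
    using a x by (auto intro!: derivative_eq_intros)
  moreover have "- (Q * (1 / x / a)) * x powr (- a) + (- a * x powr (- a - 1)) * - (P / a + Q * (ln x / a + 1 / a\<^sup>2))
     = (P + Q * ln x) * x powr (- a - 1)"
    unfolding y y_def[symmetric] using a x by (simp add: field_simps power2_eq_square)
  ultimately show ?thesis by simp
qed

text \<open>The functions \<open>f0\<close> to \<open>f5\<close> are the successive derivatives in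
  \<open>x\<close> of \<open>- ln x * x powr (-s)\<close>, which is the derivative of
  \<open>x powr (-s)\<close> in \<open>s\<close>.\<close>

lemma norm_boole_rest_deriv_le:
  assumes n: "n > 0" and s: "Re s > -4"
  shows "norm (boole_rest_deriv n s) \<le> 5 / 768 * (boole_primitive s (Suc n) - boole_primitive s n)"
proof -
  define F where "F = (\<lambda>A B c x. (A + B * of_real (ln x)) * (of_real x powr c :: complex))"
  define f0 where "f0 = F 0 (-1) (-s)"
  define f1 where "f1 = F (- 1) s (- s - 1)"
  define f2 where "f2 = F (2 * s + 1) (- (s * (s + 1))) (- s - 2)"
  define f3 where "f3 = F (- (3 * s ^ 2 + 6 * s + 2)) (s * (s + 1) * (s + 2)) (- s - 3)"
  define f4 where "f4 = F ((3 * s ^ 2 + 6 * s + 2) * (s + 3) + s * (s + 1) * (s + 2)) (- (s * (s + 1) * (s + 2) * (s + 3))) (- s - 4)"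
  define f5 where "f5 = F (- rising5_deriv s) (rising5 s) (- s - 5)"
  have F: "(F A B c has_vector_derivative F A' B' c' x) (at x)"
    if "x > 0" "A' = B + c * A" "B' = c * B" "c' = c - 1" for A B c A' B' c' x
    unfolding F_def that using has_vector_derivative_ln_powr[OF \<open>x > 0\<close>, of A B c] by (simp add: add_ac)
  have "norm ((f0 (real n) - f0 (real n + 1)) / 2 + (f1 (real n) + f1 (real n + 1)) / 4 - (f3 (real n) + f3 (real n + 1)) / 48)
    \<le> 5 / 768 * (boole_primitive s (real n + 1) - boole_primitive s (real n))"
  proof (rule boole_error[of _ f0 f1 f2 f3 f4 f5 _ "\<lambda>x. (norm (rising5_deriv s) + norm (rising5 s) * ln x) * x powr (- (Re s + 5))"])
    fix x assume x: "real n \<le> x" "x \<le> real n + 1"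
    have x1: "x \<ge> 1" using x n by simp
    then have x0: "x > 0" by simp
    show "(f0 has_vector_derivative f1 x) (at x)" "(f1 has_vector_derivative f2 x) (at x)"
      "(f2 has_vector_derivative f3 x) (at x)" "(f3 has_vector_derivative f4 x) (at x)"
      "(f4 has_vector_derivative f5 x) (at x)"
      unfolding f0_def f1_def f2_def f3_def f4_def f5_def rising5_def rising5_deriv_def
      by (rule F[OF x0]; simp add: algebra_simps power2_eq_square)+
    show "(boole_primitive s has_real_derivative (norm (rising5_deriv s) + norm (rising5 s) * ln x) * x powr (- (Re s + 5))) (at x)"
    proof -
      have e: "- (Re s + 5) = - (Re s + 4) - 1" by simp
      show ?thesis unfolding boole_primitive_def[abs_def] e
        by (rule has_real_derivative_log_power_primitive) (use s x0 in auto)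
    qed
    have "norm (f5 x) = norm (- rising5_deriv s + rising5 s * of_real (ln x)) * x powr (- Re s - 5)"
      using x0 norm_powr_real_powr[of "of_real x" "-s-5"] by (simp add: f5_def F_def norm_mult)
    also have "norm (- rising5_deriv s + rising5 s * of_real (ln x)) \<le> norm (rising5_deriv s) + norm (rising5 s) * ln x"
      using norm_triangle_ineq[of "- rising5_deriv s" "rising5 s * of_real (ln x)"] x1 by (simp add: norm_mult)
    finally show "norm (f5 x) \<le> (norm (rising5_deriv s) + norm (rising5 s) * ln x) * x powr (- (Re s + 5))"
      by (simp add: mult_right_mono algebra_simps)
  qed
  moreover have "(f0 (real n) - f0 (real n + 1)) / 2 + (f1 (real n) + f1 (real n + 1)) / 4 - (f3 (real n) + f3 (real n + 1)) / 48
      = boole_rest_deriv n s"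
    unfolding f0_def f1_def f3_def F_def boole_rest_deriv_def boole_term_deriv_def boole_term_def
    by (simp add: field_simps)
  ultimately show ?thesis by (simp add: add_ac)
qed

lemma tendsto_of_nat_powr_0:
  assumes "Re z < 0"
  shows "(\<lambda>n. of_nat (n + 2) powr z :: complex) \<longlonglongrightarrow> 0"
proof (rule tendsto_norm_zero_cancel)
  have "(\<lambda>n. real (Suc n) powr Re z) \<longlonglongrightarrow> 0"
    by (intro tendsto_neg_powr filterlim_compose[OF filterlim_real_sequentially filterlim_Suc] assms)
  then have "(\<lambda>n. norm (of_nat (Suc n) powr z :: complex)) \<longlonglongrightarrow> 0"
    by (simp add: norm_of_nat_Suc_powr del: of_nat_Suc)
  from LIMSEQ_Suc[OF this] show "(\<lambda>n. norm (of_nat (n + 2) powr z :: complex)) \<longlonglongrightarrow> 0"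
    by (simp add: numeral_2_eq_2 del: of_nat_Suc of_nat_add)
qed

text \<open>The consecutive approximants telescope with alternating signs. Splitting off the
  Dirichlet term 1 and starting at 2 reduces the error, while the main term stays a polynomial times
  the single power \<open>2 powr (-s)\<close>.\<close>

lemma boole_rest_sums:
  assumes s: "Re s > 0"
  shows "(\<lambda>k. (-1) ^ k * boole_rest (k + 2) s) sums (1 - dirichlet_eta s - boole_term 2 s)"
proof -
  have "(\<lambda>k. (-1) ^ Suc k * of_nat (Suc (Suc k)) powr (-s)) sums (dirichlet_eta s - (-1) ^ 0 * of_nat (Suc 0) powr (-s))"
    using dirichlet_eta_sums[OF s] by (subst sums_Suc_iff)
      (simp del: of_nat_Suc power_Suc)
  then have 1: "(\<lambda>k. - ((-1) ^ Suc k * of_nat (Suc (Suc k)) powr (-s))) sums - (dirichlet_eta s - 1)"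
    by (intro sums_minus) simp
  define h where "h = (\<lambda>k. (-1) ^ k * boole_term (k + 2) s)"
  have "(\<lambda>n. boole_term (n + 2) s) \<longlonglongrightarrow> 0 / 2 + s * 0 / 4 - s * (s + 1) * (s + 2) * 0 / 48"
    unfolding boole_term_def by (intro tendsto_intros tendsto_of_nat_powr_0) (use s in auto)
  then have "h \<longlonglongrightarrow> 0"
    by (subst tendsto_norm_zero_iff [symmetric])
      (simp add: h_def norm_mult norm_power tendsto_norm_zero)
  from telescope_sums'[OF this] have "(\<lambda>k. h k - h (Suc k)) sums (boole_term 2 s)"
    by (simp add: h_def numeral_2_eq_2)
  from sums_diff[OF 1 this] show ?thesis
    by (simp add: h_def boole_rest_def algebra_simps del: of_nat_Suc)
qed

lemma norm_rising5_le:
  assumes "\<And>j. j \<in> {0..4::nat} \<Longrightarrow> norm (s + of_nat j) \<le> m j"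
  shows "norm (rising5 s) \<le> m 0 * m 1 * m 2 * m 3 * m 4"
    and "norm (rising5_deriv s) \<le> m 1 * m 2 * m 3 * m 4 + m 0 * m 2 * m 3 * m 4 + m 0 * m 1 * m 3 * m 4
      + m 0 * m 1 * m 2 * m 4 + m 0 * m 1 * m 2 * m 3"
proof -
  have m: "norm s \<le> m 0" "norm (s + 1) \<le> m 1" "norm (s + 2) \<le> m 2" "norm (s + 3) \<le> m 3" "norm (s + 4) \<le> m 4"
    using assms[of 0] assms[of 1] assms[of 2] assms[of 3] assms[of 4] by auto
  have m0: "0 \<le> m 0" "0 \<le> m 1" "0 \<le> m 2" "0 \<le> m 3" "0 \<le> m 4"
    using m norm_ge_zero order_trans by blast+
  show "norm (rising5 s) \<le> m 0 * m 1 * m 2 * m 3 * m 4"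
    unfolding rising5_def norm_mult by (intro mult_mono m m0 mult_nonneg_nonneg norm_ge_zero)
  show "norm (rising5_deriv s) \<le> m 1 * m 2 * m 3 * m 4 + m 0 * m 2 * m 3 * m 4 + m 0 * m 1 * m 3 * m 4
      + m 0 * m 1 * m 2 * m 4 + m 0 * m 1 * m 2 * m 3"
    unfolding rising5_deriv_def
    by (intro order_trans[OF norm_triangle_ineq] add_mono; unfold norm_mult;
        intro mult_mono m m0 mult_nonneg_nonneg norm_ge_zero)
qed

text \<open>A deliberately crude bound whose only purpose is a summable majorant, uniform on the
  bounded domain, for termwise differentiation. The shifted arguments have norm at most 10, hence
  \<open>10^5\<close> and \<open>5 * 10^4\<close>.\<close>

lemma boole_primitive_increment_le:
  fixes s :: complex
  assumes s: "Re s > -2" "norm s < 6" and n: "n > 0"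
  shows "boole_primitive s (Suc n) - boole_primitive s n \<le> 150000 * (1 / real n ^ 2)"
proof -
  have "norm (s + of_nat j) \<le> 10" if "j \<in> {0..4}" for j
    using norm_triangle_ineq[of s "of_nat j"] s that by simp
  from norm_rising5_le[of s "\<lambda>_. 10", OF this]
  have PQ: "norm (rising5 s) \<le> 100000" "norm (rising5_deriv s) \<le> 50000" by simp_all
  let ?D = "\<lambda>x. (norm (rising5_deriv s) + norm (rising5 s) * ln x) * x powr (- (Re s + 4) - 1)"
  have D: "(boole_primitive s has_real_derivative ?D x) (at x)" if "x > 0" for x
    unfolding boole_primitive_def[abs_def]
    by (rule has_real_derivative_log_power_primitive) (use s that in auto)
  have "\<exists>z. real n < z \<and> z < real (Suc n) \<and> boole_primitive s (Suc n) - boole_primitive s n = (real (Suc n) - real n) * ?D z"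
    by (rule MVT2) (use D n in auto)
  then obtain z where z: "real n < z" "boole_primitive s (Suc n) - boole_primitive s n = ?D z" by auto
  have z1: "z > 1" using z n by simp
  have "ln z \<le> z" using z1 by (intro ln_bound) simp
  then have "norm (rising5_deriv s) + norm (rising5 s) * ln z \<le> 50000 * z + 100000 * z"
    using PQ z1 by (intro add_mono mult_mono) auto
  then have "?D z \<le> (150000 * z) * z powr (- 3)"
    using z1 s by (intro mult_mono powr_mono) auto
  also have "\<dots> = 150000 * (1 / z ^ 2)"
  proof -
    have "z powr (- 3) = 1 / z ^ 3" using z1 by (simp add: powr_minus_divide powr_numeral)
    then show ?thesis using z1 by (simp add: power2_eq_square power3_eq_cube)
  qed
  also have "\<dots> \<le> 150000 * (1 / real n ^ 2)"
    using z n by (intro mult_left_mono frac_le power_mono) auto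
  finally show ?thesis using z by simp
qed

text \<open>The series of remainders continues \<eta> to \<open>S\<close>: its termwise derivatives
  converge uniformly there, and it converges at the point 1. The bounds for the differentiated
  remainders then telescope to the value of the primitive at 2.\<close>

lemma deriv_eta_boole:
  assumes s: "Re s > -2" "norm s < 6"
  shows "norm (deriv dirichlet_eta s + boole_term_deriv 2 s) \<le> - 5 / 768 * boole_primitive s 2"
proof -
  define S where "S = {s. Re s > -2} \<inter> ball 0 6"
  have S: "open S" "convex S" "s \<in> S" "1 \<in> S"
    using s by (auto simp: S_def open_halfspace_Re_gt convex_halfspace_Re_gt intro!: open_Int convex_Int)
  define f where "f = (\<lambda>k s. (-1) ^ k * boole_rest (k + 2) s)"
  define f' where "f' = (\<lambda>k s. (-1) ^ k * boole_rest_deriv (k + 2) s)"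
  have f': "(f k has_field_derivative f' k z) (at z within A)" for k z A
    unfolding f_def f'_def by (intro DERIV_cmult has_field_derivative_boole_rest) simp
  have le: "norm (f' k z) \<le> 5 / 768 * (boole_primitive z (Suc (k + 2)) - boole_primitive z (k + 2))"
    if "z \<in> S" for k z
    using norm_boole_rest_deriv_le[of "k + 2" z] that by (simp add: f'_def norm_mult norm_power S_def)
  have unif: "uniformly_convergent_on S (\<lambda>n x. \<Sum>i<n. f' i x)"
  proof (rule Weierstrass_m_test')
    fix k z assume z: "z \<in> S"
    have "norm (f' k z) \<le> 5 / 768 * (150000 * (1 / real (k + 2) ^ 2))"
      using le[OF z, of k] boole_primitive_increment_le[of z "k + 2"] z by (auto simp: S_def)
    then show "norm (f' k z) \<le> 5 / 768 * 150000 * (1 / real (k + 2) ^ 2)" by simp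
  next
    have "summable (\<lambda>k. inverse (real (k + 2) ^ 2))"
      by (rule summable_ignore_initial_segment[of "\<lambda>k. inverse (real k ^ 2)"]) (rule inverse_power_summable, simp)
    then show "summable (\<lambda>k. 5 / 768 * 150000 * (1 / real (k + 2) ^ 2))"
      by (intro summable_mult) (simp add: inverse_eq_divide)
  qed
  have sm: "summable (\<lambda>n. f n 1)"
    using boole_rest_sums[of 1] unfolding f_def by (simp add: sums_iff)
  have ser: "((\<lambda>x. \<Sum>n. f n x) has_field_derivative (\<Sum>n. f' n x)) (at x)" if "x \<in> S" for x
    by (rule has_field_derivative_series'(2)[OF S(2) f' unif S(4) sm])
      (use that S(1) in \<open>simp add: interior_open\<close>)
  define H where "H = (\<lambda>z. 1 - boole_term 2 z - (\<Sum>n. f n z))"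
  have H: "(H has_field_derivative - boole_term_deriv 2 z - (\<Sum>n. f' n z)) (at z)" if "z \<in> S" for z
    unfolding H_def
    by (auto intro!: derivative_eq_intros has_field_derivative_boole_term ser that)
  have eq: "dirichlet_eta z = H z" if z: "z \<in> S" for z
  proof (rule analytic_continuation_open[of "S \<inter> {s. Re s > 0}" S dirichlet_eta H])
    show "open (S \<inter> {s. Re s > 0})" "open S" using S by (auto intro!: open_Int open_halfspace_Re_gt)
    show "S \<inter> {s. Re s > 0} \<noteq> {}" using S(4) by auto
    show "connected S" by (rule convex_connected[OF S(2)])
    show "H holomorphic_on S" using H S(1) by (auto simp: holomorphic_on_open)
    show "dirichlet_eta z = H z" if "z \<in> S \<inter> {s. Re s > 0}" for z
      using sums_unique[OF boole_rest_sums[of z]] that by (simp add: H_def f_def algebra_simps)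
  qed (use z dirichlet_eta_holomorphic in auto)
  have "(dirichlet_eta has_field_derivative - boole_term_deriv 2 s - (\<Sum>n. f' n s)) (at s)"
    by (rule has_field_derivative_transform_within_open[OF H[OF S(3)] S(1,3)]) (simp add: eq)
  then have "deriv dirichlet_eta s + boole_term_deriv 2 s = - (\<Sum>n. f' n s)"
    using DERIV_imp_deriv by fastforce
  then have nrm: "norm (deriv dirichlet_eta s + boole_term_deriv 2 s) = norm (\<Sum>n. f' n s)" by simp
  have "((\<lambda>x. - (norm (rising5_deriv s) / (Re s + 4)
      + norm (rising5 s) * (ln x / (Re s + 4) + 1 / (Re s + 4)\<^sup>2)) * x powr (- (Re s + 4))) \<longlongrightarrow> 0) at_top"
  proof -
    define a P Q where "a = Re s + 4" and "P = norm (rising5_deriv s)" and "Q = norm (rising5 s)"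
    have "a > 0" using s by (simp add: a_def)
    then have "((\<lambda>x. - (P / a + Q * (ln x / a + 1 / a\<^sup>2)) * x powr (- a)) \<longlongrightarrow> 0) at_top"
      by real_asymp
    then show ?thesis by (simp only: a_def P_def Q_def)
  qed
  then have "(boole_primitive s \<longlongrightarrow> 0) at_top" by (simp only: boole_primitive_def[abs_def])
  from filterlim_compose[OF this filterlim_real_sequentially]
  have "(\<lambda>k. boole_primitive s (real k)) \<longlonglongrightarrow> 0" .
  from LIMSEQ_ignore_initial_segment[OF this, of 2]
  have "(\<lambda>k. boole_primitive s (real (k + 2))) \<longlonglongrightarrow> 0" .
  from telescope_sums[OF this]
  have "(\<lambda>k. boole_primitive s (Suc (k + 2)) - boole_primitive s (k + 2)) sums (0 - boole_primitive s 2)"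
    by simp
  from sums_mult[OF this, of "5 / 768"]
  have sums: "(\<lambda>k. 5 / 768 * (boole_primitive s (Suc (k + 2)) - boole_primitive s (k + 2))) sums (- 5 / 768 * boole_primitive s 2)"
    by simp
  have "norm (\<Sum>n. f' n s) \<le> (\<Sum>k. 5 / 768 * (boole_primitive s (Suc (k + 2)) - boole_primitive s (k + 2)))"
    by (rule norm_suminf_le[OF le[OF S(3)] sums_summable[OF sums]])
  then show ?thesis unfolding nrm sums_unique[OF sums, symmetric] .
qed

section \<open>Numerical exclusion of zeros in the box\<close>

lemma ln_2_bounds: "ln (2::real) \<ge> 693 / 1000" "ln (2::real) \<le> 25 / 36"
proof -
  have "693 / 1000 \<le> (\<Sum>k<3. 2 * (1/3::real) ^ (2 * k + 1) / of_nat (2 * k + 1))"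
    by (simp add: eval_nat_numeral)
  also have "\<dots> \<le> ln 2"
    using ln_approx_bounds[of 2 3] by (simp add: Let_def)
  finally show "ln (2::real) \<ge> 693 / 1000" .
qed (rule ln2_le_25_over_36)

text \<open>This is \<open>- 2^s boole_term_deriv 2 s\<close>, the main term of \<open>2^s \<eta>' s\<close>.\<close>
definition eta_deriv_approx :: "complex \<Rightarrow> complex" where
  "eta_deriv_approx s = of_real (ln 2) * (1 / 2 + s / 8 - s * (s + 1) * (s + 2) / 384)
     - 1 / 8 + (3 * s\<^sup>2 + 6 * s + 2) / 384"

lemma eta_deriv_approx_error:
  assumes s: "Re s > -2" "norm s < 6"
  shows "norm (2 powr s * deriv dirichlet_eta s - eta_deriv_approx s)
    \<le> 5 / 12288 * (norm (rising5_deriv s) / (Re s + 4) + norm (rising5 s) * (ln 2 / (Re s + 4) + 1 / (Re s + 4)\<^sup>2))"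
proof -
  define X where "X = norm (rising5_deriv s) / (Re s + 4) + norm (rising5 s) * (ln 2 / (Re s + 4) + 1 / (Re s + 4)\<^sup>2)"
  have e: "2 powr (-s-1) = 2 powr (-s) / (2::complex)" "2 powr (-s-3) = 2 powr (-s) / (8::complex)"
    by (simp_all add: powr_diff)
  have "2 powr s * boole_term_deriv 2 s = - (2 powr s * 2 powr (-s)) * eta_deriv_approx s"
    unfolding boole_term_deriv_def boole_term_def eta_deriv_approx_def by (simp add: e field_simps)
  also have "2 powr s * 2 powr (-s) = (1::complex)" by (simp flip: powr_add)
  finally have "2 powr s * deriv dirichlet_eta s - eta_deriv_approx s = 2 powr s * (deriv dirichlet_eta s + boole_term_deriv 2 s)"
    by (simp add: ring_distribs)
  then have "norm (2 powr s * deriv dirichlet_eta s - eta_deriv_approx s) = 2 powr Re s * norm (deriv dirichlet_eta s + boole_term_deriv 2 s)"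
    using norm_powr_real_powr[of 2 s] by (simp add: norm_mult)
  also have "\<dots> \<le> 2 powr Re s * (- 5 / 768 * boole_primitive s 2)"
    by (intro mult_left_mono deriv_eta_boole s) simp
  also have "\<dots> = (2 powr Re s * 2 powr (- (Re s + 4))) * (5 / 768 * X)"
  proof -
    have "boole_primitive s 2 = - X * 2 powr (- (Re s + 4))" by (simp add: boole_primitive_def X_def)
    then show ?thesis by simp
  qed
  \<comment> \<open>This factor turns the kernel constant 5/768 into 5/12288.\<close>
  also have "2 powr Re s * 2 powr (- (Re s + 4)) = (1 / 16 :: real)"
    by (simp add: powr_minus_divide flip: powr_add)
  finally show ?thesis by (simp add: X_def)
qed

lemma eta_deriv_approx_error_le:
  fixes m0 m1 m2 m3 m4 a :: real
  assumes s: "Re s > -2" "norm s < 6"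
    and m: "norm s \<le> m0" "norm (s + 1) \<le> m1" "norm (s + 2) \<le> m2" "norm (s + 3) \<le> m3" "norm (s + 4) \<le> m4"
    and a: "0 < a" "a \<le> Re s + 4"
  shows "norm (2 powr s * deriv dirichlet_eta s - eta_deriv_approx s)
    \<le> 5 / 12288 * ((m1 * m2 * m3 * m4 + m0 * m2 * m3 * m4 + m0 * m1 * m3 * m4 + m0 * m1 * m2 * m4 + m0 * m1 * m2 * m3) / a
        + m0 * m1 * m2 * m3 * m4 * (25 / 36 / a + 1 / a\<^sup>2))"
proof -
  define m where "m = (\<lambda>j::nat. [m0, m1, m2, m3, m4] ! j)"
  have "norm (s + of_nat j) \<le> m j" if "j \<in> {0..4}" for j
  proof -
    have "j = 0 \<or> j = 1 \<or> j = 2 \<or> j = 3 \<or> j = 4" using that by auto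
    then show ?thesis using assms by (auto simp: m_def)
  qed
  from norm_rising5_le[of s m, OF this]
  have PQ: "norm (rising5 s) \<le> m0 * m1 * m2 * m3 * m4"
    "norm (rising5_deriv s) \<le> m1 * m2 * m3 * m4 + m0 * m2 * m3 * m4 + m0 * m1 * m3 * m4 + m0 * m1 * m2 * m4 + m0 * m1 * m2 * m3"
    by (simp_all add: m_def)
  have nn: "0 \<le> m0 * m1 * m2 * m3 * m4"
    "0 \<le> m1 * m2 * m3 * m4 + m0 * m2 * m3 * m4 + m0 * m1 * m3 * m4 + m0 * m1 * m2 * m4 + m0 * m1 * m2 * m3"
    using PQ norm_ge_zero order_trans by blast+
  have "norm (rising5_deriv s) / (Re s + 4) + norm (rising5 s) * (ln 2 / (Re s + 4) + 1 / (Re s + 4)\<^sup>2)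
    \<le> (m1 * m2 * m3 * m4 + m0 * m2 * m3 * m4 + m0 * m1 * m3 * m4 + m0 * m1 * m2 * m4 + m0 * m1 * m2 * m3) / a
        + m0 * m1 * m2 * m3 * m4 * (25 / 36 / a + 1 / a\<^sup>2)"
  proof (intro add_mono mult_mono PQ nn)
    show "norm (rising5_deriv s) / (Re s + 4) \<le> (m1 * m2 * m3 * m4 + m0 * m2 * m3 * m4 + m0 * m1 * m3 * m4 + m0 * m1 * m2 * m4 + m0 * m1 * m2 * m3) / a"
      by (intro frac_le PQ nn a)
    show "ln 2 / (Re s + 4) \<le> 25 / 36 / a" by (intro frac_le ln_2_bounds a) simp
    show "1 / (Re s + 4)\<^sup>2 \<le> 1 / a\<^sup>2" using a by (intro frac_le power_mono) auto
    have "0 \<le> ln 2 / (Re s + 4)" using a by simp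
    then show "0 \<le> ln 2 / (Re s + 4) + 1 / (Re s + 4)\<^sup>2" by simp
  qed
  then have "5 / 12288 * (norm (rising5_deriv s) / (Re s + 4) + norm (rising5 s) * (ln 2 / (Re s + 4) + 1 / (Re s + 4)\<^sup>2))
    \<le> 5 / 12288 * ((m1 * m2 * m3 * m4 + m0 * m2 * m3 * m4 + m0 * m1 * m3 * m4 + m0 * m1 * m2 * m4 + m0 * m1 * m2 * m3) / a
        + m0 * m1 * m2 * m3 * m4 * (25 / 36 / a + 1 / a\<^sup>2))"
    by (rule mult_left_mono) simp
  with eta_deriv_approx_error[OF s] show ?thesis by linarith
qed

lemma norm_le_of_squares:
  assumes "\<bar>Re z\<bar> \<le> x" "0 \<le> Im z" "Im z \<le> T" "x\<^sup>2 + T\<^sup>2 \<le> m\<^sup>2" "0 \<le> m"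
  shows "norm z \<le> m"
proof -
  have "(Re z)\<^sup>2 \<le> x\<^sup>2" using assms(1) by (rule abs_le_square_iff[THEN iffD1, OF order_trans]) simp
  moreover have "(Im z)\<^sup>2 \<le> T\<^sup>2" using assms(2,3) by (intro power_mono) auto
  ultimately have "(norm z)\<^sup>2 \<le> m\<^sup>2" using assms(4) by (simp add: cmod_power2)
  then show ?thesis using assms(5) by (rule power2_le_imp_le)
qed

lemma eta_deriv_approx_parts:
  "Im (eta_deriv_approx s) = Im s * (ln 2 / 8 + (6 * (Re s + 1) - ln 2 * (3 * (Re s + 1)\<^sup>2 - 1 - (Im s)\<^sup>2)) / 384)"
  "Re (eta_deriv_approx s) = ln 2 * (1 / 2 + Re s / 8) - 1 / 8 + (3 * (Re s)\<^sup>2 - 3 * (Im s)\<^sup>2 + 6 * Re s + 2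
     - ln 2 * ((Re s) ^ 3 - 3 * Re s * (Im s)\<^sup>2 + 3 * (Re s)\<^sup>2 - 3 * (Im s)\<^sup>2 + 2 * Re s)) / 384"
  unfolding eta_deriv_approx_def
  by (simp_all add: field_simps power2_eq_square power3_eq_cube)

text \<open>Only the imaginary part of the main term is used. It is \<open>Im s\<close> times a
  positive quantity increasing with \<open>Im s\<close>, so it is bounded below at the bottom
  \<open>t0\<close> of the cell, whereas the error is bounded at the top \<open>T\<close>. The
  constant \<open>c\<close> covers the part that depends on \<open>Re s\<close> alone.\<close>

lemma deriv_eta_nonzero_cell:
  fixes m0 m1 m2 m3 m4 a t0 T l u :: real
  assumes s: "l \<le> Re s" "Re s \<le> u" "t0 \<le> Im s" "Im s \<le> T"
    and lu: "-3 / 2 \<le> l" "u \<le> 0" "1 \<le> t0" "T \<le> 5"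
    and x: "- l \<le> x0" "\<bar>l + 1\<bar> \<le> x1" "\<bar>u + 1\<bar> \<le> x1"
    and m: "x0\<^sup>2 + T\<^sup>2 \<le> m0\<^sup>2" "x1\<^sup>2 + T\<^sup>2 \<le> m1\<^sup>2" "(u + 2)\<^sup>2 + T\<^sup>2 \<le> m2\<^sup>2"
      "(u + 3)\<^sup>2 + T\<^sup>2 \<le> m3\<^sup>2" "(u + 4)\<^sup>2 + T\<^sup>2 \<le> m4\<^sup>2"
      "0 \<le> m0" "0 \<le> m1" "0 \<le> m2" "0 \<le> m3" "0 \<le> m4"
    and c: "c \<le> ln 2 / 8 + (6 * (Re s + 1) - ln 2 * (3 * (Re s + 1)\<^sup>2 - 1)) / 384" "0 \<le> c"
    and le: "5 / 12288 * ((m1 * m2 * m3 * m4 + m0 * m2 * m3 * m4 + m0 * m1 * m3 * m4 + m0 * m1 * m2 * m4 + m0 * m1 * m2 * m3) / (l + 4)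
        + m0 * m1 * m2 * m3 * m4 * (25 / 36 / (l + 4) + 1 / (l + 4)\<^sup>2)) < t0 * (c + 693 / 384000 * t0\<^sup>2)"
  shows "deriv dirichlet_eta s \<noteq> 0"
proof
  assume z: "deriv dirichlet_eta s = 0"
  have s2: "Re s > -2" "norm s < 6"
  proof -
    show "Re s > -2" using s lu by (simp add: field_simps)
    have "\<bar>Re s\<bar> \<le> 3/2" using s lu by (simp add: abs_le_iff field_simps)
    then show "norm s < 6"
      using norm_le_of_squares[of s "3/2" 5 "11/2"] s lu by (simp add: power2_eq_square)
  qed
  have "norm (2 powr s * deriv dirichlet_eta s - eta_deriv_approx s) < t0 * (c + 693 / 384000 * t0\<^sup>2)"
    by (rule le_less_trans[OF eta_deriv_approx_error_le le]; (rule s2)?; (rule norm_le_of_squares[OF _ _ _ m(1)] norm_le_of_squares[OF _ _ _ m(2)]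
        norm_le_of_squares[OF _ _ _ m(3)] norm_le_of_squares[OF _ _ _ m(4)] norm_le_of_squares[OF _ _ _ m(5)])?)
      (use s lu x m in \<open>auto simp: abs_le_iff field_simps\<close>)
  then have "norm (eta_deriv_approx s) < t0 * (c + 693 / 384000 * t0\<^sup>2)" by (simp add: z)
  moreover have "Im (eta_deriv_approx s) \<ge> t0 * (c + 693 / 384000 * t0\<^sup>2)"
  proof -
    have "693 / 384000 * t0\<^sup>2 \<le> ln 2 / 384 * (Im s)\<^sup>2"
      using ln_2_bounds(1) lu s by (intro mult_mono power_mono) auto
    then have "c + 693 / 384000 * t0\<^sup>2 \<le> ln 2 / 8 + (6 * (Re s + 1) - ln 2 * (3 * (Re s + 1)\<^sup>2 - 1 - (Im s)\<^sup>2)) / 384"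
      using c by (simp add: field_simps)
    then show ?thesis unfolding eta_deriv_approx_parts
      using s lu c by (intro mult_mono) auto
  qed
  ultimately show False using abs_Im_le_cmod[of "eta_deriv_approx s"] by linarith
qed

text \<open>The value 79/1000 is \<open>ln 2 / 8 - 3 / 384 + ln 2 / 1536\<close> rounded down, which
  is attained at the left edge \<open>Re s = -3/2\<close>.\<close>

lemma deriv_eta_nonzero_cell_left:
  fixes m0 m1 m2 m3 m4 t0 T :: real
  assumes s: "-3 / 2 \<le> Re s" "Re s \<le> -1" "t0 \<le> Im s" "Im s \<le> T"
    and t: "1 \<le> t0" "T \<le> 5"
    and m: "9 / 4 + T\<^sup>2 \<le> m0\<^sup>2" "1 / 4 + T\<^sup>2 \<le> m1\<^sup>2" "1 + T\<^sup>2 \<le> m2\<^sup>2" "4 + T\<^sup>2 \<le> m3\<^sup>2" "9 + T\<^sup>2 \<le> m4\<^sup>2"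
      "0 \<le> m0" "0 \<le> m1" "0 \<le> m2" "0 \<le> m3" "0 \<le> m4"
    and le: "5 / 12288 * ((m1 * m2 * m3 * m4 + m0 * m2 * m3 * m4 + m0 * m1 * m3 * m4 + m0 * m1 * m2 * m4 + m0 * m1 * m2 * m3) / (- 3 / 2 + 4)
        + m0 * m1 * m2 * m3 * m4 * (25 / 36 / (- 3 / 2 + 4) + 1 / (- 3 / 2 + 4)\<^sup>2)) < t0 * (79 / 1000 + 693 / 384000 * t0\<^sup>2)"
  shows "deriv dirichlet_eta s \<noteq> 0"
proof (rule deriv_eta_nonzero_cell[of "-3/2" s "-1" t0 T "3/2" "1/2" m0 m1 m2 m3 m4 "79/1000"])
  define y where "y = - (Re s + 1)"
  have y: "0 \<le> y" "y \<le> 1/2" using s by (auto simp: y_def field_simps)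
  have "y * y \<le> 1/2 * (1/2)" using y by (intro mult_mono) auto
  then have "ln 2 * (3 * y\<^sup>2 - 1) \<le> ln 2 * (- 1/4)"
    by (intro mult_left_mono) (auto simp: power2_eq_square field_simps)
  moreover define Y where "Y = ln 2 * (3 * y\<^sup>2 - 1)"
  ultimately have "Y \<le> - (ln 2 / 4)" by simp
  then have "79/1000 \<le> ln 2 / 8 + (6 * (-y) - Y) / 384"
    using y ln_2_bounds(1) by (simp add: field_simps)
  then have "79/1000 \<le> ln 2 / 8 + (6 * (-y) - ln 2 * (3 * y\<^sup>2 - 1)) / 384"
    by (simp only: Y_def)
  moreover have "Re s + 1 = - y" by (simp add: y_def)
  ultimately show "79/1000 \<le> ln 2 / 8 + (6 * (Re s + 1) - ln 2 * (3 * (Re s + 1)\<^sup>2 - 1)) / 384"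
    by (simp only: power2_minus)
qed (rule le | (use s t m in \<open>auto simp: power2_eq_square algebra_simps\<close>)[1])+

text \<open>The value 88/1000 is \<open>ln 2 / 8 + ln 2 / 384\<close> rounded down, attained at
  \<open>Re s = -1\<close>. The norms of \<open>s\<close> and \<open>s + 1\<close> share the bound
  \<open>m0\<close>, since both real parts have modulus at most 1.\<close>

lemma deriv_eta_nonzero_cell_right:
  fixes m0 m1 m2 m3 m4 t0 T :: real
  assumes s: "-1 \<le> Re s" "Re s \<le> 0" "t0 \<le> Im s" "Im s \<le> T"
    and t: "1 \<le> t0" "T \<le> 5"
    and m: "1 + T\<^sup>2 \<le> m0\<^sup>2" "4 + T\<^sup>2 \<le> m2\<^sup>2" "9 + T\<^sup>2 \<le> m3\<^sup>2" "16 + T\<^sup>2 \<le> m4\<^sup>2"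
      "0 \<le> m0" "0 \<le> m2" "0 \<le> m3" "0 \<le> m4"
    and le: "5 / 12288 * ((m0 * m2 * m3 * m4 + m0 * m2 * m3 * m4 + m0 * m0 * m3 * m4 + m0 * m0 * m2 * m4 + m0 * m0 * m2 * m3) / (- 1 + 4)
        + m0 * m0 * m2 * m3 * m4 * (25 / 36 / (- 1 + 4) + 1 / (- 1 + 4)\<^sup>2)) < t0 * (88 / 1000 + 693 / 384000 * t0\<^sup>2)"
  shows "deriv dirichlet_eta s \<noteq> 0"
proof (rule deriv_eta_nonzero_cell[of "-1" s "0" t0 T "1" "1" m0 m0 m2 m3 m4 "88/1000"])
  define y where "y = Re s + 1"
  have y: "0 \<le> y" "y \<le> 1" using s by (auto simp: y_def)
  have "ln 2 * (3 * (y * y)) \<le> 25 / 36 * (3 * (1 * y))"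
    using ln_2_bounds y by (intro mult_mono) auto
  moreover define Y where "Y = ln 2 * (3 * (y * y))"
  ultimately have "Y \<le> 25 / 12 * y" by simp
  then have "88/1000 \<le> ln 2 / 8 + (6 * y - (Y - ln 2)) / 384"
    using y ln_2_bounds(1) by (simp add: field_simps)
  also have "Y - ln 2 = ln 2 * (3 * y\<^sup>2 - 1)"
    by (simp add: Y_def power2_eq_square algebra_simps)
  finally have "88/1000 \<le> ln 2 / 8 + (6 * y - ln 2 * (3 * y\<^sup>2 - 1)) / 384" .
  then show "88/1000 \<le> ln 2 / 8 + (6 * (Re s + 1) - ln 2 * (3 * (Re s + 1)\<^sup>2 - 1)) / 384"
    by (simp add: y_def)
qed (rule le | (use s t m in \<open>auto simp: power2_eq_square algebra_simps\<close>)[1])+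

text \<open>Near the real axis the imaginary part of the main term is too small to beat the error,
  so the real part takes its place: it stays above 0.05 while the error stays below 0.042.\<close>

lemma deriv_eta_nonzero_low:
  assumes s: "-3 / 2 \<le> Re s" "Re s \<le> 0" "0 \<le> Im s" "Im s \<le> 1"
  shows "deriv dirichlet_eta s \<noteq> 0"
proof
  assume z: "deriv dirichlet_eta s = 0"
  have s2: "Re s > -2" "norm s < 6"
    using norm_le_of_squares[of s "3/2" 1 5] s by (auto simp: power2_eq_square abs_le_iff field_simps)
  have m: "norm s \<le> 182/100" "norm (s + 1) \<le> 143/100" "norm (s + 2) \<le> 225/100"
    "norm (s + 3) \<le> 318/100" "norm (s + 4) \<le> 414/100"
    by (rule norm_le_of_squares[of _ "3/2" 1] norm_le_of_squares[of _ 1 1] norm_le_of_squares[of _ 2 1]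
        norm_le_of_squares[of _ 3 1] norm_le_of_squares[of _ 4 1];
        use s in \<open>auto simp: abs_le_iff power2_eq_square field_simps\<close>)+
  have "norm (2 powr s * deriv dirichlet_eta s - eta_deriv_approx s) \<le> 42 / 1000"
    by (rule order_trans[OF eta_deriv_approx_error_le[OF s2 m, of "5/2"]])
      (use s in \<open>auto simp: power2_eq_square field_simps\<close>)
  then have "norm (eta_deriv_approx s) \<le> 42 / 1000" by (simp add: z)
  moreover have "Re (eta_deriv_approx s) \<ge> 5 / 100"
  proof -
    define y \<tau> where "y = Re s + 1" and "\<tau> = (Im s)\<^sup>2"
    have y: "-1/2 \<le> y" "y \<le> 1" using s by (auto simp: y_def field_simps)
    have \<tau>: "0 \<le> \<tau>" "\<tau> \<le> 1" using s power_mono[of "Im s" 1 2] by (auto simp: \<tau>_def)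
    have ay: "\<bar>y\<bar> \<le> 1" using y by (simp add: abs_le_iff field_simps)
    have "\<bar>y ^ 3\<bar> \<le> 1" using ay by (simp add: power_abs power_le_one)
    moreover have "\<bar>y * \<tau>\<bar> \<le> 1 * 1" unfolding abs_mult using ay \<tau> by (intro mult_mono) auto
    ultimately have "y ^ 3 - y - 3 * (y * \<tau>) \<le> 5" using ay by linarith
    then have A: "ln 2 * (y ^ 3 - y - 3 * (y * \<tau>)) \<le> ln 2 * 5" by (intro mult_left_mono) auto
    have B: "693 / 1000 * (3 + y) \<le> ln 2 * (3 + y)" using y ln_2_bounds by (intro mult_right_mono) (auto simp: field_simps)
    define y2 where "y2 = y\<^sup>2"
    have y2: "0 \<le> y2" by (simp add: y2_def)
    define A' B' where "A' = ln 2 * (y ^ 3 - y - 3 * (y * \<tau>))" and "B' = ln 2 * (3 + y)"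
    have e: "Re (eta_deriv_approx s) = B' / 8 - 1 / 8 + (3 * y\<^sup>2 - 1 - 3 * \<tau> - A') / 384"
      unfolding eta_deriv_approx_parts y_def \<tau>_def A'_def B'_def by (simp add: field_simps power2_eq_square power3_eq_cube)
    show ?thesis unfolding e y2_def[symmetric]
      using A[folded A'_def] B[folded B'_def] y \<tau> y2 ln_2_bounds(2) by (simp add: field_simps)
  qed
  ultimately show False using abs_Re_le_cmod[of "eta_deriv_approx s"] by linarith
qed

text \<open>The error grows faster with the height than the main term, so the bands become thinner
  towards the top. The decimals are upper roundings of \<open>sqrt (x^2 + T^2)\<close>, with
  \<open>x\<close> the largest modulus of the real part of the shifted argument.\<close>

lemma deriv_eta_nonzero_box:
  assumes s: "-3 / 2 \<le> Re s" "Re s \<le> 0" "0 \<le> Im s" "Im s \<le> 33 / 10"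
  shows "deriv dirichlet_eta s \<noteq> 0"
proof -
  consider "Im s \<le> 1" | "1 \<le> Im s" "Re s \<le> -1" | "1 \<le> Im s" "-1 \<le> Re s" by linarith
  then show ?thesis
  proof cases
    case 1
    then show ?thesis using s by (intro deriv_eta_nonzero_low)
  next
    case 2
    note * = deriv_eta_nonzero_cell_left[OF s(1) 2(2)]
    consider "1 \<le> Im s" "Im s \<le> 2" | "2 \<le> Im s" "Im s \<le> 26/10" | "26/10 \<le> Im s" "Im s \<le> 3"
      | "3 \<le> Im s" "Im s \<le> 32/10" | "32/10 \<le> Im s" "Im s \<le> 33/10" using 2 s by linarith
    then show ?thesis
    proof cases
      case 1 then show ?thesis
        by (rule *[of _ _ "250/100" "207/100" "224/100" "283/100" "361/100"]) (auto simp: power2_eq_square)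
    next
      case 2 then show ?thesis
        by (rule *[of _ _ "301/100" "265/100" "279/100" "329/100" "398/100"]) (auto simp: power2_eq_square)
    next
      case 3 then show ?thesis
        by (rule *[of _ _ "336/100" "305/100" "317/100" "361/100" "425/100"]) (auto simp: power2_eq_square)
    next
      case 4 then show ?thesis
        by (rule *[of _ _ "354/100" "324/100" "336/100" "378/100" "439/100"]) (auto simp: power2_eq_square)
    next
      case 5 then show ?thesis
        by (rule *[of _ _ "363/100" "334/100" "345/100" "386/100" "446/100"]) (auto simp: power2_eq_square)
    qed
  next
    case 3
    note * = deriv_eta_nonzero_cell_right[OF 3(2) s(2)]
    consider "1 \<le> Im s" "Im s \<le> 2" | "2 \<le> Im s" "Im s \<le> 26/10" | "26/10 \<le> Im s" "Im s \<le> 3"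
      | "3 \<le> Im s" "Im s \<le> 32/10" | "32/10 \<le> Im s" "Im s \<le> 33/10" using 3 s by linarith
    then show ?thesis
    proof cases
      case 1 then show ?thesis
        by (rule *[of _ _ "224/100" "283/100" "361/100" "448/100"]) (auto simp: power2_eq_square)
    next
      case 2 then show ?thesis
        by (rule *[of _ _ "279/100" "329/100" "398/100" "478/100"]) (auto simp: power2_eq_square)
    next
      case 3 then show ?thesis
        by (rule *[of _ _ "317/100" "361/100" "425/100" "501/100"]) (auto simp: power2_eq_square)
    next
      case 4 then show ?thesis
        by (rule *[of _ _ "336/100" "378/100" "439/100" "513/100"]) (auto simp: power2_eq_square)
    next
      case 5 then show ?thesis
        by (rule *[of _ _ "345/100" "386/100" "446/100" "519/100"]) (auto simp: power2_eq_square)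
    qed
  qed
qed

section \<open>Zeros of large height\<close>

text \<open>Writing each derivative as the function times a logarithmic derivative lets long
  products be differentiated by adding the second factors, without division.\<close>

lemma log_deriv_mult:
  fixes f g :: "complex \<Rightarrow> complex"
  assumes "(f has_field_derivative f w * a) (at w)" "(g has_field_derivative g w * b) (at w)"
  shows "((\<lambda>w. f w * g w) has_field_derivative (f w * g w) * (a + b)) (at w)"
  using DERIV_mult[OF assms] by (simp add: algebra_simps)

text \<open>Duplication splits \<open>Gamma w\<close> into the half that belongs to \<xi> and the
  half \<open>Gamma ((w - 1) / 2)\<close> that stays in the explicit factor. The condition on
  \<open>Im w\<close> keeps the latter away from its poles.\<close>

lemma eta_eq_xi:
  assumes w: "Re w > 0" "Im w \<noteq> 0"
  shows "dirichlet_eta (1 - w) = - (of_real pi powr (- (w + 1) / 2) * cos (of_real (pi / 2) * w)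
     * (2 powr w - 1) * Gamma ((w - 1) / 2) * inverse w) * riemann_xi w"
proof -
  define C where "C = cos (of_real (pi / 2) * w)"
  define F where "F = pole_free_zeta w"
  define G0 where "G0 = Gamma ((w - 1) / 2)"
  define G2 where "G2 = Gamma (w / 2)"
  have wn: "(w - 1) / 2 \<notin> \<int>\<^sub>\<le>\<^sub>0" by (rule Im_nonzero_not_nonpos_Ints) (use w in simp)
  have w0: "w \<noteq> 0" using w by auto
  have G3: "Gamma ((w + 1) / 2) = (w - 1) / 2 * G0"
    using Gamma_plus1[OF wn] by (simp add: G0_def field_simps)
  have dup: "G2 * ((w - 1) / 2 * G0) = (2 / 2 powr w) * of_real (sqrt pi) * Gamma w"
  proof -
    have e: "w / 2 + 1 / 2 = (w + 1) / 2" by (simp add: field_simps)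
    have "exp ((1 - w) * of_real (ln 2)) = 2 / 2 powr w"
      using exp_of_real[of "ln 2"] by (simp add: powr_def exp_diff ring_distribs Ln_of_real' flip: Ln_of_real)
    moreover have "Gamma (w / 2) * Gamma ((w + 1) / 2) =
        exp ((1 - 2 * (w / 2)) * of_real (ln 2)) * of_real (sqrt pi) * Gamma (2 * (w / 2))"
      by (rule Gamma_legendre_duplication[of "w / 2", unfolded e]) (use Re_pos_not_nonpos_Ints[of "w / 2"] Re_pos_not_nonpos_Ints[of "(w + 1) / 2"] w in auto)
    ultimately show ?thesis by (simp add: G2_def G3)
  qed
  have x2: "riemann_xi w = of_real pi powr (- w / 2) * (w / 2 * G2) * F"
    unfolding riemann_xi_def using Gamma_plus1[OF Re_pos_not_nonpos_Ints[of "w / 2"]] w by (simp add: G2_def F_def)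
  have P: "of_real pi powr (- (w + 1) / 2) * of_real pi powr (- w / 2) * of_real (sqrt pi) = (of_real pi powr (-w) :: complex)"
  proof -
    have sq: "of_real (sqrt pi) = (of_real pi powr (1 / 2) :: complex)"
      using powr_of_real[of pi "1/2"] by (simp add: powr_half_sqrt)
    have "of_real pi powr (- (w + 1) / 2) * of_real pi powr (- w / 2) * of_real pi powr (1 / 2)
        = (of_real pi powr (- (w + 1) / 2 + - w / 2 + 1 / 2) :: complex)" by (simp only: powr_add)
    also have "- (w + 1) / 2 + - w / 2 + 1 / 2 = - w" by (simp add: field_simps)
    finally show ?thesis unfolding sq .
  qed
  have T0: "2 powr w \<noteq> (0::complex)" by simp
  have "(w - 1) * dirichlet_eta (1 - w) = - 2 * of_real pi powr (-w) * C * Gamma w * (1 - 2 powr (-w)) * F"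
    using eta_functional_equation[of w] w by (simp add: C_def F_def)
  also have "\<dots> = - (of_real pi powr (- (w + 1) / 2) * of_real pi powr (- w / 2)) * C * (2 powr w - 1) * F
      * ((2 / 2 powr w) * of_real (sqrt pi) * Gamma w)"
    unfolding P[symmetric] using T0 by (simp add: powr_minus field_simps)
  also have "\<dots> = (w - 1) * (- (of_real pi powr (- (w + 1) / 2) * C * (2 powr w - 1) * G0 * inverse w) * riemann_xi w)"
    unfolding dup[symmetric] x2 using w0 by (simp add: field_simps)
  finally have e: "(w - 1) * dirichlet_eta (1 - w) = (w - 1) *
      (- (of_real pi powr (- (w + 1) / 2) * C * (2 powr w - 1) * G0 * inverse w) * riemann_xi w)" .
  have "w - 1 \<noteq> 0" using w by auto
  from iffD1[OF mult_left_cancel[OF this] e] show ?thesis by (simp only: C_def G0_def)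
qed

lemma cos_half_pi_nonzero:
  assumes "Im w \<noteq> 0"
  shows "cos (of_real (pi / 2) * w) \<noteq> 0"
proof
  assume "cos (of_real (pi / 2) * w) = 0"
  then obtain n where "of_real (pi / 2) * w = of_real (of_int n * pi) + of_real pi / 2"
    unfolding cos_eq_0 by auto
  then have "Im (of_real (pi / 2) * w) = 0" by simp
  with assms show False by simp
qed

lemma norm_cos_sq: "(norm (cos z))\<^sup>2 = (cos (Re z))\<^sup>2 + (sinh (Im z))\<^sup>2"
proof -
  have "cos z = Complex (cos (Re z) * cosh (Im z)) (- sin (Re z) * sinh (Im z))"
    by (simp add: complex_eq_iff Re_cos Im_cos sinh_def cosh_def field_simps)
  then have "(norm (cos z))\<^sup>2 = (cos (Re z) * cosh (Im z))\<^sup>2 + (sin (Re z) * sinh (Im z))\<^sup>2"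
    by (simp add: cmod_power2)
  also have "\<dots> = (cos (Re z))\<^sup>2 * (1 + (sinh (Im z))\<^sup>2) + (1 - (cos (Re z))\<^sup>2) * (sinh (Im z))\<^sup>2"
    by (simp add: power_mult_distrib cosh_square_eq sin_squared_eq)
  finally show ?thesis by (simp add: algebra_simps)
qed

lemma tan_parts:
  assumes "cos z \<noteq> 0"
  shows "Re (tan z) = sin (Re z) * cos (Re z) / ((cos (Re z))\<^sup>2 + (sinh (Im z))\<^sup>2)"
    and "Im (tan z) = sinh (Im z) * cosh (Im z) / ((cos (Re z))\<^sup>2 + (sinh (Im z))\<^sup>2)"
proof -
  have s: "sin z = Complex (sin (Re z) * cosh (Im z)) (cos (Re z) * sinh (Im z))"
    by (simp add: complex_eq_iff Re_sin Im_sin sinh_def cosh_def field_simps)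
  have c: "cos z = Complex (cos (Re z) * cosh (Im z)) (- sin (Re z) * sinh (Im z))"
    by (simp add: complex_eq_iff Re_cos Im_cos sinh_def cosh_def field_simps)
  have "tan z = sin z * cnj (cos z) / of_real ((norm (cos z))\<^sup>2)"
    unfolding tan_def by (subst complex_div_cnj) simp
  moreover have "sin z * cnj (cos z) = Complex (sin (Re z) * cos (Re z)) (sinh (Im z) * cosh (Im z))"
  proof -
    have "sin (Re z) * cosh (Im z) * (cos (Re z) * cosh (Im z)) - cos (Re z) * sinh (Im z) * (sin (Re z) * sinh (Im z))
       = sin (Re z) * cos (Re z) * ((cosh (Im z))\<^sup>2 - (sinh (Im z))\<^sup>2)"
      by (simp add: algebra_simps power2_eq_square)
    also have "\<dots> = sin (Re z) * cos (Re z)" by (simp add: cosh_square_eq)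
    finally have 1: "sin (Re z) * cosh (Im z) * (cos (Re z) * cosh (Im z)) - cos (Re z) * sinh (Im z) * (sin (Re z) * sinh (Im z))
       = sin (Re z) * cos (Re z)" .
    have "sin (Re z) * cosh (Im z) * (sin (Re z) * sinh (Im z)) + cos (Re z) * sinh (Im z) * (cos (Re z) * cosh (Im z))
       = sinh (Im z) * cosh (Im z) * ((sin (Re z))\<^sup>2 + (cos (Re z))\<^sup>2)"
      by algebra
    also have "\<dots> = sinh (Im z) * cosh (Im z)" by (simp only: sin_cos_squared_add mult_1_right)
    finally have 2: "sin (Re z) * cosh (Im z) * (sin (Re z) * sinh (Im z)) + cos (Re z) * sinh (Im z) * (cos (Re z) * cosh (Im z))
       = sinh (Im z) * cosh (Im z)" .
    show ?thesis unfolding s c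
      using 1 2 by (simp only: complex_cnj complex_mult complex.inject minus_minus mult_minus_left)
  qed
  ultimately show "Re (tan z) = sin (Re z) * cos (Re z) / ((cos (Re z))\<^sup>2 + (sinh (Im z))\<^sup>2)"
    "Im (tan z) = sinh (Im z) * cosh (Im z) / ((cos (Re z))\<^sup>2 + (sinh (Im z))\<^sup>2)"
    by (simp_all add: norm_cos_sq Re_divide_of_real Im_divide_of_real)
qed

lemma deriv_pole_free_zeta:
  "Re w > -1 \<Longrightarrow> (pole_free_zeta has_field_derivative deriv pole_free_zeta w) (at w)"
  by (rule holomorphic_derivI[OF pole_free_zeta_holomorphic open_halfspace_Re_gt]) simp

text \<open>Zeros on \<open>Re w = 1\<close> are simple because \<open>\<bar>\<zeta> (w + h)\<bar> \<ge> 1 / \<zeta> (1 + h)\<close>, which is of order \<open>h\<close>.\<close>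
lemma deriv_pole_free_zeta_nonzero:
  assumes w: "Re w = 1" "w \<noteq> 1" and z: "pole_free_zeta w = 0"
  shows "deriv pole_free_zeta w \<noteq> 0"
proof
  assume d: "deriv pole_free_zeta w = 0"
  have "((\<lambda>h. (pole_free_zeta (w + h) - pole_free_zeta w) / h) \<longlongrightarrow> 0) (at 0)"
    using deriv_pole_free_zeta[of w] w d by (simp add: DERIV_def)
  moreover have "filterlim complex_of_real (at 0) (at_right 0)"
    by (auto simp: filterlim_at eventually_at_filter intro!: tendsto_eq_intros)
  ultimately have "((\<lambda>h. pole_free_zeta (w + of_real h) / of_real h) \<longlongrightarrow> 0) (at_right (0::real))"
    unfolding z by (auto dest: filterlim_compose)
  then have l1: "((\<lambda>h. norm (pole_free_zeta (w + of_real h) / of_real h) * norm (pole_free_zeta (1 + of_real h))) \<longlongrightarrow>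
      norm (0::complex) * norm (pole_free_zeta (1 + of_real 0))) (at_right (0::real))"
    by (intro tendsto_intros isCont_tendsto_compose[OF DERIV_isCont[OF deriv_pole_free_zeta]]) auto
  have l2: "((\<lambda>h. norm (w + of_real h - 1)) \<longlongrightarrow> norm (w + of_real 0 - 1)) (at_right (0::real))"
    by (intro tendsto_intros)
  have "norm (w + of_real 0 - 1) \<le> norm (0::complex) * norm (pole_free_zeta (1 + of_real 0))"
  proof (rule tendsto_le[OF _ l1 l2])
    show "\<forall>\<^sub>F h in at_right 0. norm (w + of_real h - 1) \<le>
        norm (pole_free_zeta (w + of_real h) / of_real h) * norm (pole_free_zeta (1 + of_real h))"
      using eventually_at_right_less[of "0::real"]
    proof eventually_elim
      case (elim h)
      have "norm (w + of_real h - 1) * h \<le> norm (pole_free_zeta (w + of_real h)) * norm (pole_free_zeta (1 + of_real h))"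
        using pole_free_zeta_lower_bound[of "w + of_real h"] w elim by simp
      then show ?case using elim by (simp add: norm_divide field_simps)
    qed
  qed simp
  then show False using w by simp
qed

text \<open>On a circle of radius greater than 1 the real part is smallest at the negative real
  point \<open>- norm z\<close>.\<close>

lemma Re_inverse_diff_1_ge:
  assumes "norm z > 1"
  shows "Re (1 / (z - 1)) \<ge> - 1 / (norm z + 1)"
proof -
  define r x where "r = norm z" and "x = Re z"
  have x: "\<bar>x\<bar> \<le> r" unfolding r_def x_def by (rule abs_Re_le_cmod)
  have r: "r > 1" using assms by (simp add: r_def)
  have n: "(norm (z - 1))\<^sup>2 = r\<^sup>2 - 2 * x + 1"
  proof -
    have "(norm (z - 1))\<^sup>2 = (Re z - 1)\<^sup>2 + (Im z)\<^sup>2" "r\<^sup>2 = (Re z)\<^sup>2 + (Im z)\<^sup>2"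
      by (simp_all add: r_def cmod_power2)
    then show ?thesis by (simp add: x_def power2_diff)
  qed
  have "z \<noteq> 1" using assms by auto
  then have n0: "(norm (z - 1))\<^sup>2 > 0" by simp
  have "Re (1 / (z - 1)) = (x - 1) / (norm (z - 1))\<^sup>2"
    by (simp add: Re_divide cmod_power2 x_def)
  also have "\<dots> \<ge> - 1 / (r + 1)"
  proof -
    have "0 \<le> (r - 1) * (x + r)" using r x by (intro mult_nonneg_nonneg) auto
    then have "- 1 * (norm (z - 1))\<^sup>2 \<le> (x - 1) * (r + 1)"
      unfolding n by (simp add: algebra_simps power2_eq_square)
    then show ?thesis using r n0 by (simp add: field_simps)
  qed
  finally show ?thesis by (simp add: r_def)
qed

lemma log_deriv_xi_factor:
  assumes w: "Re w \<ge> 1" "Im w > 0"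
  defines "K \<equiv> \<lambda>w. - (of_real pi powr (- (w + 1) / 2) * cos (of_real (pi / 2) * w)
     * (2 powr w - 1) * Gamma ((w - 1) / 2) * inverse w)"
  shows "(K has_field_derivative K w * (- of_real (ln pi / 2) - of_real (pi / 2) * tan (of_real (pi / 2) * w)
     + of_real (ln 2) * (1 + 1 / (2 powr w - 1)) + Digamma ((w - 1) / 2) / 2 - 1 / w)) (at w)"
proof -
  have w0: "w \<noteq> 0" "2 powr w - 1 \<noteq> (0::complex)" "cos (of_real (pi / 2) * w) \<noteq> 0"
    using w two_powr_neq_1[of w] cos_half_pi_nonzero[of w] by auto
  have wn: "(w - 1) / 2 \<notin> \<int>\<^sub>\<le>\<^sub>0" by (rule Im_nonzero_not_nonpos_Ints) (use w in simp)
  have 1: "((\<lambda>w. of_real pi powr (- (w + 1) / 2)) has_field_derivative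
      of_real pi powr (- (w + 1) / 2) * - of_real (ln pi / 2)) (at w)"
    by (rule DERIV_cong[OF has_field_derivative_of_real_powr[OF pi_gt_zero, where f' = "- 1 / 2"]])
      (auto intro!: derivative_eq_intros)
  have 2: "((\<lambda>w. cos (of_real (pi / 2) * w)) has_field_derivative
      cos (of_real (pi / 2) * w) * - (of_real (pi / 2) * tan (of_real (pi / 2) * w))) (at w)"
    using w0 by (auto intro!: derivative_eq_intros simp: tan_def)
  have 3: "((\<lambda>w. 2 powr w - 1) has_field_derivative
      (2 powr w - 1) * (of_real (ln 2) * (1 + 1 / (2 powr w - 1)))) (at w)"
  proof -
    have "((\<lambda>w. 2 powr w - 1) has_field_derivative of_real (ln 2) * 2 powr w) (at w)"
      using Ln_of_real[of 2] by (auto intro!: derivative_eq_intros)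
    then show ?thesis by (rule DERIV_cong) (use w0 in \<open>simp add: field_simps\<close>)
  qed
  have 4: "((\<lambda>w. Gamma ((w - 1) / 2)) has_field_derivative Gamma ((w - 1) / 2) * (Digamma ((w - 1) / 2) / 2)) (at w)"
    using wn by (auto intro!: derivative_eq_intros)
  have 5: "(inverse has_field_derivative inverse w * (- 1 / w)) (at w)"
    using w0 by (auto intro!: derivative_eq_intros simp: field_simps power2_eq_square)
  have "((\<lambda>w. of_real pi powr (- (w + 1) / 2) * cos (of_real (pi / 2) * w)
     * (2 powr w - 1) * Gamma ((w - 1) / 2) * inverse w) has_field_derivative
     (of_real pi powr (- (w + 1) / 2) * cos (of_real (pi / 2) * w) * (2 powr w - 1) * Gamma ((w - 1) / 2) * inverse w) *
     (- of_real (ln pi / 2) + - (of_real (pi / 2) * tan (of_real (pi / 2) * w))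
     + of_real (ln 2) * (1 + 1 / (2 powr w - 1)) + Digamma ((w - 1) / 2) / 2 + (- 1 / w))) (at w)"
    by (intro log_deriv_mult 1 2 3 4 5)
  from DERIV_minus[OF this] show ?thesis unfolding K_def by (simp add: algebra_simps)
qed

lemma pi_sq_bound: "pi\<^sup>2 \<le> 989 / 100"
proof -
  have "pi \<le> 3142 / 1000" using pi_approx by (simp add: abs_le_iff)
  then have "pi * pi \<le> 3142 / 1000 * (3142 / 1000)" by (intro mult_mono) auto
  then show ?thesis by (simp add: power2_eq_square)
qed

lemma sinh_lower:
  assumes "x \<ge> 5"
  shows "(sinh x)\<^sup>2 \<ge> (8::real)\<^sup>2"
proof -
  define E where "E = exp (-x)"
  have "1 + x + x\<^sup>2 / 2 \<le> exp x" using assms by (intro exp_lower_Taylor_quadratic) simp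
  moreover have "x\<^sup>2 \<ge> 25" using power_mono[OF assms, of 2] by simp
  moreover have "E \<le> 1" using assms by (simp add: E_def)
  moreover have "sinh x = (exp x - E) / 2" by (simp add: sinh_def E_def field_simps)
  ultimately have "sinh x \<ge> 8" using assms by (simp add: field_simps)
  then show ?thesis by (intro power_mono) auto
qed

text \<open>The multiples of \<open>ln pi\<close> cancel, and those of \<open>ln 2\<close> leave
  \<open>1 - 1/2 - 1/3 = 1/6\<close>. This gives at least 0.1155 against 0.025 from the tangent and
  0.085 from \<open>1 / w\<close>.\<close>

lemma Re_log_deriv_xi_factor_pos:
  assumes w: "Re w \<ge> 1" "Im w \<ge> 33 / 10"
  shows "Re (- of_real (ln pi / 2) - of_real (pi / 2) * tan (of_real (pi / 2) * w)
     + of_real (ln 2) * (1 + 1 / (2 powr w - 1)) + Digamma ((w - 1) / 2) / 2 - 1 / w) > 0"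
proof -
  define u v where "u = Re w" and "v = Im w"
  have u: "u \<ge> 1" and v: "v \<ge> 33 / 10" using w by (auto simp: u_def v_def)
  have v2: "v\<^sup>2 \<ge> 1089 / 100" using power_mono[OF v, of 2] by (simp add: power2_eq_square)
  have T: "pi / 2 * Re (tan (of_real (pi / 2) * w)) \<le> 25 / 1000"
  proof -
    let ?z = "of_real (pi / 2) * w"
    have z: "cos ?z \<noteq> 0" using cos_half_pi_nonzero[of w] w by auto
    have "Im ?z \<ge> 5"
    proof -
      have "Im ?z = pi / 2 * v" by (simp add: v_def)
      moreover have "3 / 2 * (33 / 10) \<le> pi / 2 * v" using v pi_gt3 by (intro mult_mono) auto
      moreover have "31 / 20 * (33 / 10) \<le> pi / 2 * v"
        using v pi_approx by (intro mult_mono) (auto simp: abs_le_iff)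
      ultimately show ?thesis by simp
    qed
    from sinh_lower[OF this] have sh: "(sinh (Im ?z))\<^sup>2 \<ge> 64" by simp
    have "Re (tan ?z) \<le> 1 / 64"
      unfolding tan_parts(1)[OF z]
    proof (rule frac_le)
      have "\<bar>sin (Re ?z) * cos (Re ?z)\<bar> \<le> 1 * 1" unfolding abs_mult by (intro mult_mono) auto
      then show "sin (Re ?z) * cos (Re ?z) \<le> 1" by linarith
      show "64 \<le> (cos (Re ?z))\<^sup>2 + (sinh (Im ?z))\<^sup>2" using sh by (simp add: add_increasing)
    qed auto
    then have "pi / 2 * Re (tan ?z) \<le> pi / 2 * (1 / 64)" by (intro mult_left_mono) auto
    also have "\<dots> \<le> 25 / 1000" using pi_approx by (simp add: abs_le_iff field_simps)
    finally show ?thesis .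
  qed
  \<comment> \<open>The choice of 33/10 enters here: its square is at least \<open>1 + pi^2\<close>,
    so the logarithm from the Digamma bound is at least \<open>ln (pi^2 / 4)\<close>.\<close>
  have psi: "Re (Digamma ((w - 1) / 2) / 2) \<ge> (ln pi - ln 2) / 2"
  proof -
    have "pi\<^sup>2 / 4 \<le> (v\<^sup>2 - 1) / 4" using pi_sq_bound v2 by simp
    also have "\<dots> \<le> ((u - 1) / 2 - 1/2)\<^sup>2 + (v / 2)\<^sup>2 - 1/4"
      using zero_le_power2[of "(u - 1) / 2 - 1/2"] by (simp add: power_divide)
    finally have "ln (pi\<^sup>2 / 4) \<le> ln (((u - 1) / 2 - 1/2)\<^sup>2 + (v / 2)\<^sup>2 - 1/4)" by (intro ln_mono) auto
    moreover have "ln (pi\<^sup>2 / 4) = 2 * (ln pi - ln 2)"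
    proof -
      have "pi\<^sup>2 / 4 = (pi / 2)\<^sup>2" by (simp add: power_divide)
      then show ?thesis by (simp add: ln_realpow ln_div)
    qed
    moreover have "ln (((u - 1) / 2 - 1/2)\<^sup>2 + (v / 2)\<^sup>2 - 1/4) / 2 \<le> Re (Digamma (Complex ((u - 1) / 2) (v / 2)))"
      by (rule Re_Digamma_ge) (use u v in auto)
    moreover have "Complex ((u - 1) / 2) (v / 2) = (w - 1) / 2" by (simp add: complex_eq_iff u_def v_def)
    ultimately show ?thesis by simp
  qed
  have two: "Re (1 / (2 powr w - 1)) \<ge> - 1 / (2 powr u + 1)"
  proof -
    have n: "norm (2 powr w :: complex) = 2 powr u" using norm_powr_real_powr[of 2 w] by (simp add: u_def)
    have "(2::real) powr 0 < 2 powr u" using u by (intro powr_less_mono) auto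
    then have "norm (2 powr w :: complex) > 1" by (simp add: n)
    from Re_inverse_diff_1_ge[OF this] show ?thesis by (simp add: n)
  qed
  have Rw: "Re (1 / w) = u / (u\<^sup>2 + v\<^sup>2)" by (simp add: Re_divide u_def v_def)
  define x where "x = u - 1"
  have x: "x \<ge> 0" using u by (simp add: x_def)
  \<comment> \<open>A common lower bound for \<open>u^2 + v^2\<close>. What \<open>1 / w\<close>
    costs beyond its bound at \<open>u = 1\<close> is at most \<open>x / D\<close>, and the decay of
    \<open>1 / (2 powr u + 1)\<close> recovers the same amount.\<close>
  define D where "D = 11 + 2 * x + x\<^sup>2"
  have D: "D > 0" using x by (simp add: D_def add_pos_nonneg)
  have A: "u / (u\<^sup>2 + v\<^sup>2) \<le> 85 / 1000 + x / D"
  proof -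
    have uv: "u\<^sup>2 + v\<^sup>2 \<ge> D + 89 / 100" using v2 by (simp add: D_def x_def power2_eq_square algebra_simps)
    have "D \<ge> 11" using x by (simp add: D_def)
    have "u / (u\<^sup>2 + v\<^sup>2) = 1 / (u\<^sup>2 + v\<^sup>2) + x / (u\<^sup>2 + v\<^sup>2)" by (simp add: x_def add_divide_distrib diff_divide_distrib)
    also have "\<dots> \<le> 1 / (1189 / 100) + x / D"
      using uv x D \<open>D \<ge> 11\<close> by (intro add_mono frac_le) auto
    finally show ?thesis by simp
  qed
  have B: "ln 2 / (2 powr u + 1) \<le> ln 2 / 3 - x / D"
  proof -
    define q where "q = 1386 / 1000 * x"
    have q: "q \<ge> 0" using x by (simp add: q_def)
    define E where "E = exp (x * ln 2)"
    have "(2::real) powr u = 2 * E" by (simp add: E_def x_def powr_def left_diff_distrib exp_diff)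
    moreover have "1 + x * ln 2 \<le> E" unfolding E_def by (rule exp_ge_add_one_self)
    moreover have "x * (693 / 1000) \<le> x * ln 2" using x ln_2_bounds by (intro mult_left_mono) auto
    ultimately have "2 powr u + 1 \<ge> 3 + q" by (simp add: q_def)
    then have "1 / (2 powr u + 1) \<le> 1 / (3 + q)" using q by (intro frac_le) auto
    moreover have "1 / (3 + q) \<le> 1 / 3" using q by (intro frac_le) auto
    ultimately have "693 / 1000 * (1 / 3 - 1 / (3 + q)) \<le> ln 2 * (1 / 3 - 1 / (2 powr u + 1))"
      by (intro mult_mono ln_2_bounds) auto
    moreover have "x / D \<le> 693 / 1000 * (1 / 3 - 1 / (3 + q))"
    proof -
      have "1 / 3 - 1 / (3 + q) = q / (9 + 3 * q)" using q by (simp add: field_simps)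
      moreover have "x / D \<le> 693 / 1000 * (q / (9 + 3 * q))"
      proof -
        \<comment> \<open>The factor 0.96 is just below \<open>0.693 * 1.386\<close>. The difference
          of the two sides is a quadratic in \<open>x\<close> whose minimum lies close to 1.17,
          hence the comparison with a square centred there.\<close>
        have "9 + 3 * q \<le> 96 / 100 * D"
        proof -
          have "0 \<le> 96 / 100 * (x - 117 / 100)\<^sup>2" by simp
          then show ?thesis using x by (simp add: D_def q_def power2_eq_square field_simps)
        qed
        then have "x * (9 + 3 * q) \<le> x * (96 / 100 * D)" using x by (intro mult_left_mono)
        also have "\<dots> \<le> 693 / 1000 * q * D" using x D by (simp add: q_def)
        finally show ?thesis using D q by (simp add: field_simps)
      qed
      ultimately show ?thesis by simp
    qed
    ultimately show ?thesis by (simp add: right_diff_distrib)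
  qed
  define t where "t = pi / 2 * Re (tan (of_real (pi / 2) * w))"
  define p where "p = Re (Digamma ((w - 1) / 2) / 2)"
  define c where "c = ln 2 * Re (1 / (2 powr w - 1))"
  define d where "d = ln 2 / (2 powr u + 1)"
  define r where "r = u / (u\<^sup>2 + v\<^sup>2)"
  have "Re (- of_real (ln pi / 2) - of_real (pi / 2) * tan (of_real (pi / 2) * w)
     + of_real (ln 2) * (1 + 1 / (2 powr w - 1)) + Digamma ((w - 1) / 2) / 2 - 1 / w)
     = - (ln pi / 2) - t + ln 2 + c + p - r"
  proof -
    define X where "X = 1 / (2 powr w - 1)"
    have m: "Re (of_real a * z) = a * Re z" for a :: real and z :: complex by simp
    have "Re (of_real (pi / 2) * tan (of_real (pi / 2) * w)) = t" "Re (of_real (ln 2) * X) = c"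
      unfolding t_def c_def X_def by (rule m)+
    then show ?thesis unfolding r_def Rw[symmetric] p_def X_def[symmetric]
      by (simp only: ring_distribs Re_complex_of_real minus_complex.sel plus_complex.sel uminus_complex.sel mult_1_right)
  qed
  moreover have "- d \<le> c"
  proof -
    have "ln 2 * (- 1 / (2 powr u + 1)) \<le> c" unfolding c_def using two by (intro mult_left_mono) auto
    then show ?thesis by (simp add: d_def)
  qed
  moreover have "t \<le> 25 / 1000" "p \<ge> (ln pi - ln 2) / 2" "r \<le> 85 / 1000 + x / D" "d \<le> ln 2 / 3 - x / D"
    using T psi A B by (simp_all add: t_def p_def r_def d_def)
  ultimately show ?thesis using ln_2_bounds(1) by simp
qed

lemma deriv_eta_nonzero_high:
  assumes s: "Re s \<le> 0" "Im s \<le> - 33 / 10"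
  shows "deriv dirichlet_eta s \<noteq> 0"
proof
  assume z: "deriv dirichlet_eta s = 0"
  define w where "w = 1 - s"
  have w: "Re w \<ge> 1" "Im w \<ge> 33 / 10" using s by (auto simp: w_def)
  define K :: "complex \<Rightarrow> complex" where "K = (\<lambda>w. - (of_real pi powr (- (w + 1) / 2) * cos (of_real (pi / 2) * w)
     * (2 powr w - 1) * Gamma ((w - 1) / 2) * inverse w))"
  define \<kappa> where "\<kappa> = - of_real (ln pi / 2) - of_real (pi / 2) * tan (of_real (pi / 2) * w)
     + of_real (ln 2) * (1 + 1 / (2 powr w - 1)) + Digamma ((w - 1) / 2) / 2 - 1 / w"
  have K: "(K has_field_derivative K w * \<kappa>) (at w)"
    unfolding K_def \<kappa>_def using w by (intro log_deriv_xi_factor) auto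
  have \<kappa>: "Re \<kappa> > 0" unfolding \<kappa>_def by (rule Re_log_deriv_xi_factor_pos[OF w])
  have wn: "(w - 1) / 2 \<notin> \<int>\<^sub>\<le>\<^sub>0" by (rule Im_nonzero_not_nonpos_Ints) (use w in simp)
  have K0: "K w \<noteq> 0"
    unfolding K_def using w two_powr_neq_1[of w] cos_half_pi_nonzero[of w] Gamma_nonzero[OF wn] by auto
  have "((\<lambda>w. dirichlet_eta (1 - w)) has_field_derivative deriv dirichlet_eta s * (- 1)) (at w)"
  proof (rule DERIV_chain2[of dirichlet_eta])
    show "(dirichlet_eta has_field_derivative deriv dirichlet_eta s) (at (1 - w))"
      using holomorphic_derivI[OF dirichlet_eta_holomorphic open_UNIV, of s] by (simp add: w_def)
  qed (auto intro!: derivative_eq_intros)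
  then have "((\<lambda>w. dirichlet_eta (1 - w)) has_field_derivative 0) (at w)" by (simp add: z)
  moreover have "((\<lambda>w. dirichlet_eta (1 - w)) has_field_derivative (K w * \<kappa>) * riemann_xi w + deriv riemann_xi w * K w) (at w)"
  proof (rule has_field_derivative_transform_within_open[OF DERIV_mult[OF K deriv_riemann_xi]])
    show "Re w > -1" using w by simp
    show "open {w. Re w > 0 \<and> Im w > 0}"
      by (intro open_Collect_conj open_halfspace_Re_gt open_halfspace_Im_gt)
  qed (use w in \<open>auto simp: K_def eta_eq_xi\<close>)
  ultimately have "(K w * \<kappa>) * riemann_xi w + deriv riemann_xi w * K w = 0" using DERIV_unique by blast
  then have "K w * (\<kappa> * riemann_xi w + deriv riemann_xi w) = 0" by (simp add: algebra_simps)
  \<comment> \<open>In this form a zero of \<xi> at \<open>w\<close> would be at least double, which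
    the second case of the split below rules out.\<close>
  then have eq: "deriv riemann_xi w = - (\<kappa> * riemann_xi w)" using K0 by (simp add: add_eq_0_iff)
  show False
  proof (cases "riemann_xi w = 0")
    case False
    have "deriv riemann_xi w * cnj (riemann_xi w) = - \<kappa> * of_real ((norm (riemann_xi w))\<^sup>2)"
      unfolding eq complex_norm_square by simp
    then have "Re (deriv riemann_xi w * cnj (riemann_xi w)) = - Re \<kappa> * (norm (riemann_xi w))\<^sup>2" by simp
    moreover have "Re (deriv riemann_xi w * cnj (riemann_xi w)) \<ge> 0" by (rule Re_deriv_riemann_xi_nonneg[OF w(1)])
    ultimately show False using \<kappa> False by (simp add: mult_le_0_iff)
  next
    case True
    have g0: "of_real pi powr (- w / 2) * Gamma (w / 2 + 1) \<noteq> 0"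
      using Gamma_nonzero_Re_pos[of "w / 2 + 1"] w by simp
    have F0: "pole_free_zeta w = 0" using True g0 by (simp add: riemann_xi_def)
    then have "Re w = 1" using pole_free_zeta_nonzero[of w] w by force
    moreover have "w \<noteq> 1" using w by auto
    ultimately have dF: "deriv pole_free_zeta w \<noteq> 0" using deriv_pole_free_zeta_nonzero F0 by blast
    have wn2: "w / 2 + 1 \<notin> \<int>\<^sub>\<le>\<^sub>0" by (rule Im_nonzero_not_nonpos_Ints) (use w in simp)
    have "((\<lambda>w. of_real pi powr (- w / 2)) has_field_derivative of_real (ln pi) * of_real pi powr (- w / 2) * (- 1 / 2)) (at w)"
      by (rule has_field_derivative_of_real_powr) (auto intro!: derivative_eq_intros)
    moreover have "((\<lambda>w. Gamma (w / 2 + 1)) has_field_derivative Gamma (w / 2 + 1) * Digamma (w / 2 + 1) * (1 / 2)) (at w)"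
      using wn2 by (auto intro!: derivative_eq_intros)
    ultimately obtain g' where "((\<lambda>w. of_real pi powr (- w / 2) * Gamma (w / 2 + 1)) has_field_derivative g') (at w)"
      using DERIV_mult by blast
    from DERIV_mult[OF this deriv_pole_free_zeta] w
    have "(riemann_xi has_field_derivative g' * pole_free_zeta w + deriv pole_free_zeta w * (of_real pi powr (- w / 2) * Gamma (w / 2 + 1))) (at w)"
      by (simp add: riemann_xi_def[abs_def])
    then have "deriv riemann_xi w = deriv pole_free_zeta w * (of_real pi powr (- w / 2) * Gamma (w / 2 + 1))"
      using F0 DERIV_imp_deriv by fastforce
    then have "deriv riemann_xi w \<noteq> 0" using dF g0 by simp
    with eq True show False by simp
  qed
qed

section \<open>The logarithmic derivative to the left\<close>

text \<open>\<open>lambda_deriv j\<close> is the \<open>j\<close>-th derivative of the Dirichlet lambda function, the sum of \<open>n^(-w)\<close>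
  over odd \<open>n\<close>.\<close>
definition odd_term :: "nat \<Rightarrow> nat \<Rightarrow> complex \<Rightarrow> complex" where
  "odd_term j k w = of_real (- ln (2 * real k + 1)) ^ j * of_nat (2 * k + 1) powr (-w)"

definition lambda_deriv :: "nat \<Rightarrow> complex \<Rightarrow> complex" where
  "lambda_deriv j w = (\<Sum>k. odd_term j k w)"

lemma norm_odd_term: "norm (odd_term j k w) = ln (2 * real k + 1) ^ j * (2 * real k + 1) powr (- Re w)"
proof -
  have "norm (of_nat (2 * k + 1) powr (-w) :: complex) = (2 * real k + 1) powr (- Re w)"
    using norm_of_nat_Suc_powr[of "2 * k" "-w"] by (simp add: add_ac)
  then show ?thesis by (simp add: odd_term_def norm_mult norm_power)
qed

lemma exp_1_ge: "exp 1 \<ge> (27 / 10 :: real)"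
proof -
  have "1 + 1 / 8 + (1 / 8)\<^sup>2 / 2 \<le> exp (1 / 8 :: real)" by (rule exp_lower_Taylor_quadratic) simp
  then have "(1 + 1 / 8 + (1 / 8)\<^sup>2 / 2) ^ 8 \<le> exp (1 / 8 :: real) ^ 8" by (rule power_mono) simp
  moreover have "exp (1 / 8 :: real) ^ 8 = exp 1" by (simp flip: exp_of_nat_mult)
  ultimately show ?thesis by (simp add: power_divide eval_nat_numeral)
qed

text \<open>Apply \<open>ln y \<le> y / e\<close> to the square root and to the fourth root of
  \<open>x\<close>, with \<open>e\<close> replaced by 27/10.\<close>

lemma ln_le_root:
  fixes x :: real
  assumes "x \<ge> 1"
  shows "ln x \<le> 3 / 4 * x powr (1 / 2)" "(ln x)\<^sup>2 \<le> 22 / 10 * x powr (1 / 2)"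
proof -
  have *: "ln y \<le> y / (27 / 10)" if "y > 0" for y :: real
  proof -
    have "ln (y / exp 1) \<le> y / exp 1 - 1" using that by (intro ln_le_minus_one) simp
    then have "ln y \<le> y / exp 1" using that by (simp add: ln_div)
    also have "\<dots> \<le> y / (27 / 10)" using that exp_1_ge by (intro frac_le) auto
    finally show ?thesis .
  qed
  have "1 / 2 * ln x = ln (x powr (1 / 2))" using assms by (simp add: ln_powr)
  also have "\<dots> \<le> x powr (1 / 2) / (27 / 10)" by (rule *) (use assms in simp)
  finally have "ln x \<le> 2 / (27 / 10) * x powr (1 / 2)" by simp
  also have "\<dots> \<le> 3 / 4 * x powr (1 / 2)" by (intro mult_right_mono) auto
  finally show "ln x \<le> 3 / 4 * x powr (1 / 2)" .
  have "1 / 4 * ln x = ln (x powr (1 / 4))" using assms by (simp add: ln_powr)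
  also have "\<dots> \<le> x powr (1 / 4) / (27 / 10)" by (rule *) (use assms in simp)
  finally have "ln x \<le> 4 / (27 / 10) * x powr (1 / 4)" by simp
  then have "(ln x)\<^sup>2 \<le> (4 / (27 / 10) * x powr (1 / 4))\<^sup>2" using assms by (intro power_mono) auto
  also have "\<dots> = (4 / (27 / 10))\<^sup>2 * x powr (1 / 2)"
    by (simp add: power_mult_distrib power2_eq_square flip: powr_add)
  also have "\<dots> \<le> 22 / 10 * x powr (1 / 2)" by (intro mult_right_mono) (auto simp: power2_eq_square)
  finally show "(ln x)\<^sup>2 \<le> 22 / 10 * x powr (1 / 2)" .
qed

text \<open>The constants are chosen so that \<open>ln^j n * n^(-1/2) \<le> c\<close> for the odd \<open>n \<ge> 3\<close>.\<close>
definition odd_const :: "nat \<Rightarrow> real" where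
  "odd_const j = (if j = 0 then 10 / 17 else if j = 1 then 3 / 4 else 22 / 10)"

lemma ln_power_le:
  assumes x: "x \<ge> 3" and j: "j \<le> 2"
  shows "ln x ^ j \<le> odd_const j * x powr (1 / 2)"
proof -
  consider "j = 0" | "j = 1" | "j = 2" using j by linarith
  then show ?thesis
  proof cases
    case 1
    have "(17 / 10)\<^sup>2 \<le> x" using x by (simp add: power2_eq_square)
    then have "17 / 10 \<le> sqrt x" by (rule real_le_rsqrt)
    then have "10 / 17 * (17 / 10) \<le> 10 / 17 * sqrt x" by (intro mult_left_mono) auto
    then show ?thesis using 1 x by (simp add: odd_const_def powr_half_sqrt)
  qed (use ln_le_root[of x] x in \<open>auto simp: odd_const_def\<close>)
qed

text \<open>Half a power is spent on the logarithms; at \<open>b = 5/2\<close> inverse squares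
  remain.\<close>

lemma norm_odd_term_le:
  assumes j: "j \<le> 2" and k: "k \<ge> 1" and w: "Re w \<ge> b"
  shows "norm (odd_term j k w) \<le> odd_const j * (2 * real k + 1) powr (1 / 2 - b)"
proof -
  have x: "2 * real k + 1 \<ge> 3" using k by simp
  have "norm (odd_term j k w) \<le> (odd_const j * (2 * real k + 1) powr (1 / 2)) * (2 * real k + 1) powr (- b)"
    unfolding norm_odd_term using x w j
    by (intro mult_mono ln_power_le powr_mono) (auto simp: odd_const_def intro!: mult_nonneg_nonneg)
  also have "\<dots> = odd_const j * (2 * real k + 1) powr (1 / 2 - b)" by (simp add: powr_diff powr_minus_divide)
  finally show ?thesis .
qed

lemma summable_odd_powr:
  assumes "a > 1"
  shows "summable (\<lambda>k. (2 * real k + 1) powr (- a))"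
proof (rule summable_comparison_test)
  show "\<exists>N. \<forall>k\<ge>N. norm ((2 * real k + 1) powr (- a)) \<le> real (Suc k) powr (- a)"
    using assms by (auto intro!: powr_mono2')
qed (rule summable_Suc_powr[OF assms])

lemma odd_term_deriv:
  "(odd_term j k has_field_derivative odd_term (Suc j) k w) (at w within A)"
proof -
  have "((\<lambda>w. of_real (- ln (2 * real k + 1)) ^ j * of_nat (2 * k + 1) powr (-w)) has_field_derivative
     of_real (- ln (2 * real k + 1)) ^ j * (of_real (ln (real (2 * k + 1))) * of_nat (2 * k + 1) powr (-w) * (- 1))) (at w within A)"
    by (intro DERIV_cmult has_field_derivative_of_nat_powr) (auto intro!: derivative_eq_intros)
  then show ?thesis by (simp add: odd_term_def[abs_def] add_ac mult_ac)
qed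

lemma odd_terms_unif:
  assumes j: "j \<le> 2"
  shows "uniformly_convergent_on {w. Re w > 2} (\<lambda>n w. \<Sum>k<n. odd_term j k w)"
proof (rule Weierstrass_m_test'_ev)
  show "\<forall>\<^sub>F k in sequentially. \<forall>w\<in>{w. Re w > 2}. norm (odd_term j k w) \<le> odd_const j * (2 * real k + 1) powr (- (3 / 2))"
    using eventually_ge_at_top[of 1]
  proof eventually_elim
    case (elim k)
    then show ?case using norm_odd_term_le[OF j, of k 2] by simp
  qed
  show "summable (\<lambda>k. odd_const j * (2 * real k + 1) powr (- (3 / 2)))"
    by (intro summable_mult summable_odd_powr) simp
qed

lemma summable_odd_term:
  assumes "j \<le> 2" "Re w > 2"
  shows "summable (\<lambda>k. odd_term j k w)"
  using uniformly_convergent_imp_convergent[OF odd_terms_unif[OF assms(1)], of w] assms(2)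
  by (simp add: summable_iff_convergent)

lemma lambda_deriv_has_field_derivative:
  assumes "j \<le> 1" "Re w > 2"
  shows "(lambda_deriv j has_field_derivative lambda_deriv (Suc j) w) (at w)"
  unfolding lambda_deriv_def[abs_def]
proof (rule has_field_derivative_series'(2)[where S = "{w. Re w > 2}" and ?x0.0 = 3])
  show "convex {w. Re w > 2}" by (rule convex_halfspace_Re_gt)
  show "uniformly_convergent_on {w. Re w > 2} (\<lambda>n w. \<Sum>i<n. odd_term (Suc j) i w)"
    by (rule odd_terms_unif) (use assms in simp)
  show "summable (\<lambda>n. odd_term j n 3)" by (rule summable_odd_term) (use assms in auto)
  show "w \<in> interior {w. Re w > 2}" using assms by (simp add: interior_open open_halfspace_Re_gt)
qed (auto intro: odd_term_deriv)

text \<open>The square \<open>(2 k + 3)^2\<close> exceeds \<open>4 (k + 1) (k + 2)\<close>, so a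
  telescoping series with sum 1/4 dominates.\<close>

lemma odd_inverse_squares:
  "summable (\<lambda>k. 1 / (2 * real (Suc k) + 1)\<^sup>2)" "(\<Sum>k. 1 / (2 * real (Suc k) + 1)\<^sup>2) \<le> 1 / 4"
proof -
  have "(\<lambda>k. 1 / (4 * real (Suc k))) \<longlonglongrightarrow> 0" by real_asymp
  from telescope_sums'[OF this]
  have t: "(\<lambda>k. 1 / (4 * real (Suc k)) - 1 / (4 * real (Suc (Suc k)))) sums (1 / 4)" by simp
  have le: "1 / (2 * real (Suc k) + 1)\<^sup>2 \<le> 1 / (4 * real (Suc k)) - 1 / (4 * real (Suc (Suc k)))" for k
  proof -
    have "1 / (2 * real (Suc k) + 1)\<^sup>2 \<le> 1 / (4 * real (Suc k) * real (Suc (Suc k)))"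
      by (intro frac_le) (auto simp: power2_eq_square algebra_simps intro!: add_pos_nonneg)
    also have "\<dots> = 1 / (4 * real (Suc k)) - 1 / (4 * real (Suc (Suc k)))"
    proof -
      have "1 / (4 * x * (x + 1)) = 1 / (4 * x) - 1 / (4 * (x + 1))" if "x > 0" for x :: real
        using that by (simp add: field_simps)
      from this[of "real (Suc k)"] show ?thesis by (simp add: add_ac)
    qed
    finally show ?thesis .
  qed
  show s: "summable (\<lambda>k. 1 / (2 * real (Suc k) + 1)\<^sup>2)"
    by (rule summable_comparison_test[OF _ sums_summable[OF t]]) (use le in auto)
  show "(\<Sum>k. 1 / (2 * real (Suc k) + 1)\<^sup>2) \<le> 1 / 4"
    using suminf_le[OF le s sums_summable[OF t]] sums_unique[OF t] by simp
qed

text \<open>The term with base 1 is 1 for \<open>j = 0\<close> and 0 for \<open>j > 0\<close>.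
  Everything else is dominated by the inverse odd squares from 9 on.\<close>

lemma norm_lambda_deriv_le:
  assumes j: "j \<le> 2" and w: "Re w \<ge> 5 / 2"
  shows "norm (lambda_deriv j w - odd_term j 0 w) \<le> odd_const j / 4"
proof -
  have "summable (\<lambda>k. odd_term j k w)" by (rule summable_odd_term[OF j]) (use w in simp)
  from suminf_split_initial_segment[OF this, of 1]
  have "lambda_deriv j w - odd_term j 0 w = (\<Sum>k. odd_term j (Suc k) w)"
    by (simp add: lambda_deriv_def)
  also have "norm \<dots> \<le> (\<Sum>k. odd_const j * (1 / (2 * real (Suc k) + 1)\<^sup>2))"
  proof (rule norm_suminf_le)
    fix k
    have "norm (odd_term j (Suc k) w) \<le> odd_const j * (2 * real (Suc k) + 1) powr (1 / 2 - 5 / 2)"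
      by (rule norm_odd_term_le[OF j _ w]) simp
    also have "(2 * real (Suc k) + 1) powr (1 / 2 - 5 / 2) = 1 / (2 * real (Suc k) + 1)\<^sup>2"
      using powr_minus_divide[of "2 * real (Suc k) + 1" 2] by (simp add: powr_numeral)
    finally show "norm (odd_term j (Suc k) w) \<le> odd_const j * (1 / (2 * real (Suc k) + 1)\<^sup>2)" .
  qed (intro summable_mult odd_inverse_squares)
  also have "\<dots> = odd_const j * (\<Sum>k. 1 / (2 * real (Suc k) + 1)\<^sup>2)" by (rule suminf_mult[OF odd_inverse_squares(1)])
  also have "\<dots> \<le> odd_const j * (1 / 4)" by (intro mult_left_mono odd_inverse_squares) (simp add: odd_const_def)
  finally show ?thesis by simp
qed

lemma lambda_bounds:
  assumes w: "Re w \<ge> 5 / 2"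
  shows "norm (lambda_deriv 0 w) \<ge> 85 / 100" "norm (lambda_deriv 1 w) \<le> 1875 / 10000" "norm (lambda_deriv 2 w) \<le> 55 / 100"
proof -
  have "norm (lambda_deriv 0 w - 1) \<le> 10 / 68"
    using norm_lambda_deriv_le[of 0, OF _ w] by (simp add: odd_term_def odd_const_def)
  moreover have "1 \<le> norm (lambda_deriv 0 w) + norm (lambda_deriv 0 w - 1)"
    using norm_triangle_ineq4[of "lambda_deriv 0 w" "lambda_deriv 0 w - 1"] by simp
  ultimately show "norm (lambda_deriv 0 w) \<ge> 85 / 100" by simp
  show "norm (lambda_deriv 1 w) \<le> 1875 / 10000" "norm (lambda_deriv 2 w) \<le> 55 / 100"
    using norm_lambda_deriv_le[of 1, OF _ w] norm_lambda_deriv_le[of 2, OF _ w]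
    by (simp_all add: odd_term_def odd_const_def)
qed

lemma eta_eq_lambda:
  assumes w: "Re w > 1"
  shows "dirichlet_eta (1 - w) = - 2 * of_real pi powr (-w) * cos (of_real (pi / 2) * w) * Gamma w * lambda_deriv 0 w"
proof -
  have "lambda_deriv 0 w = (1 - 2 powr (-w)) * (\<Sum>n. of_nat (Suc n) powr (-w))"
    using Dirichlet_series_parity_sums(2)[OF w] by (simp add: lambda_deriv_def odd_term_def sums_iff)
  then have "(w - 1) * lambda_deriv 0 w = (1 - 2 powr (-w)) * pole_free_zeta w"
    by (simp add: pole_free_zeta_eq[OF w])
  then have "(w - 1) * dirichlet_eta (1 - w) =
      (w - 1) * (- 2 * of_real pi powr (-w) * cos (of_real (pi / 2) * w) * Gamma w * lambda_deriv 0 w)"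
    using eta_functional_equation[of w] w by (simp add: mult_ac)
  moreover have "w - 1 \<noteq> 0" using w by auto
  ultimately show ?thesis using iffD1[OF mult_left_cancel] by blast
qed

text \<open>By \<open>eta_eq_lambda\<close> the logarithmic derivative of \<open>\<eta> (1 - w)\<close> is this function minus
  \<open>ln \<pi> + \<pi>/2 tan (\<pi> w/2)\<close>.\<close>
definition eta_log_deriv_part :: "complex \<Rightarrow> complex" where
  "eta_log_deriv_part w = Digamma w + lambda_deriv 1 w / lambda_deriv 0 w"

lemma lambda_deriv_0_nonzero: "Re w \<ge> 5 / 2 \<Longrightarrow> lambda_deriv 0 w \<noteq> 0"
  using lambda_bounds(1)[of w] by auto

lemma norm_lambda_quotient_le:
  assumes w: "Re w \<ge> 5 / 2"
  shows "norm (lambda_deriv 1 w / lambda_deriv 0 w) \<le> 221 / 1000"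
proof -
  have "norm (lambda_deriv 1 w) / norm (lambda_deriv 0 w) \<le> (1875 / 10000) / (85 / 100)"
    using lambda_bounds[OF w] by (intro frac_le) auto
  then show ?thesis by (simp add: norm_divide)
qed

text \<open>Lowering \<open>x^2\<close> to \<open>x^2 - 1/4\<close> makes the series of inverse
  squares telescope.\<close>

lemma norm_Polygamma_1_le:
  assumes w: "Re w \<ge> 5 / 2"
  shows "norm (Polygamma 1 w) \<le> 1 / 2"
proof -
  define u where "u = Re w"
  have u: "u \<ge> 5 / 2" using w by (simp add: u_def)
  have w0: "w \<noteq> 0" using w by auto
  have s: "(\<lambda>k. inverse ((w + of_nat k) ^ 2)) sums Polygamma 1 w"
    using Polygamma_LIMSEQ[OF w0, of 1] by (simp add: numeral_2_eq_2)
  have "(\<lambda>k. 1 / (u - 1 / 2 + real k)) \<longlonglongrightarrow> 0" by real_asymp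
  from telescope_sums'[OF this]
  have t: "(\<lambda>k. 1 / (u - 1 / 2 + real k) - 1 / (u - 1 / 2 + real (Suc k))) sums (1 / (u - 1 / 2))" by simp
  have le: "norm (inverse ((w + of_nat k) ^ 2)) \<le> 1 / (u - 1 / 2 + real k) - 1 / (u - 1 / 2 + real (Suc k))" for k
  proof -
    define x where "x = u + real k"
    have x: "x \<ge> 5 / 2" using u by (simp add: x_def)
    have x2: "(5 / 2)\<^sup>2 \<le> x\<^sup>2" using x by (intro power_mono) auto
    have "x \<le> norm (w + of_nat k)" using complex_Re_le_cmod[of "w + of_nat k"] by (simp add: x_def u_def)
    then have "x\<^sup>2 \<le> (norm (w + of_nat k))\<^sup>2" using x by (intro power_mono) auto
    then have "1 / (norm (w + of_nat k))\<^sup>2 \<le> 1 / (x\<^sup>2 - 1 / 4)"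
      using x2 by (intro frac_le) (auto simp: power2_eq_square)
    also have "\<dots> = 1 / (x - 1 / 2) - 1 / (x + 1 / 2)"
      using x by (subst diff_frac_eq) (auto simp: power2_eq_square algebra_simps)
    finally show ?thesis by (simp add: norm_inverse norm_divide norm_power inverse_eq_divide x_def algebra_simps)
  qed
  have "norm (Polygamma 1 w) \<le> 1 / (u - 1 / 2)"
    using norm_suminf_le[OF le sums_summable[OF t]] sums_unique[OF s] sums_unique[OF t] by simp
  also have "\<dots> \<le> 1 / 2" using u by (intro frac_le) auto
  finally show ?thesis .
qed

text \<open>The bound is 1/2 from the trigamma function plus 7/10 from the derivative of
  \<open>\<lambda>' / \<lambda>\<close>. It stays well below \<open>(pi / 2)^2\<close>, the least
  slope of \<open>pi / 2 * tan (pi / 2 * t)\<close> on the real axis; both the estimate near the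
  axis and the uniqueness of real zeros rest on this gap.\<close>

lemma eta_log_deriv_part_deriv:
  assumes w: "Re w \<ge> 5 / 2"
  obtains d where "(eta_log_deriv_part has_field_derivative d) (at w)" "norm d \<le> 12 / 10"
proof
  define q1 q2 where "q1 = lambda_deriv 1 w / lambda_deriv 0 w" and "q2 = lambda_deriv 2 w / lambda_deriv 0 w"
  have l0: "lambda_deriv 0 w \<noteq> 0" by (rule lambda_deriv_0_nonzero[OF w])
  have d: "(lambda_deriv 0 has_field_derivative lambda_deriv 1 w) (at w)" "(lambda_deriv 1 has_field_derivative lambda_deriv 2 w) (at w)"
    using lambda_deriv_has_field_derivative[of 0 w] lambda_deriv_has_field_derivative[of 1 w] w
    by (simp_all add: numeral_2_eq_2)
  have "(eta_log_deriv_part has_field_derivative Polygamma 1 w +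
     (lambda_deriv 2 w * lambda_deriv 0 w - lambda_deriv 1 w * lambda_deriv 1 w) / (lambda_deriv 0 w * lambda_deriv 0 w)) (at w)"
    unfolding eta_log_deriv_part_def[abs_def]
    using has_field_derivative_Polygamma[OF Re_pos_not_nonpos_Ints, of w 0] w
    by (intro DERIV_add DERIV_divide d l0) simp
  then show "(eta_log_deriv_part has_field_derivative Polygamma 1 w + (q2 - q1\<^sup>2)) (at w)"
    using l0 by (simp add: q1_def q2_def diff_divide_distrib power2_eq_square)
  have "norm q2 \<le> (55 / 100) / (85 / 100)"
    unfolding q2_def norm_divide using lambda_bounds[OF w] by (intro frac_le) auto
  moreover have "norm (q1\<^sup>2) \<le> (221 / 1000)\<^sup>2"
    unfolding norm_power q1_def by (intro power_mono norm_lambda_quotient_le[OF w]) auto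
  ultimately have "norm (q2 - q1\<^sup>2) \<le> 7 / 10"
    using norm_triangle_ineq4[of q2 "q1\<^sup>2"] by (simp add: power2_eq_square)
  then show "norm (Polygamma 1 w + (q2 - q1\<^sup>2)) \<le> 12 / 10"
    using norm_Polygamma_1_le[OF w] norm_triangle_ineq[of "Polygamma 1 w" "q2 - q1\<^sup>2"] by simp
qed

lemma eta_log_deriv_part_lipschitz:
  assumes "Re z \<ge> 5 / 2" "Re w \<ge> 5 / 2"
  shows "norm (eta_log_deriv_part z - eta_log_deriv_part w) \<le> 12 / 10 * norm (z - w)"
proof (rule field_differentiable_bound[where S = "{w. Re w \<ge> 5 / 2}" and f' = "deriv eta_log_deriv_part"])
  show "convex {w. Re w \<ge> 5 / 2}" by (rule convex_halfspace_Re_ge)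
next
  fix w assume "w \<in> {w. Re w \<ge> 5 / 2}"
  then have "Re w \<ge> 5 / 2" by simp
  then obtain d where d: "(eta_log_deriv_part has_field_derivative d) (at w)" "norm d \<le> 12 / 10" using eta_log_deriv_part_deriv by blast
  then have "deriv eta_log_deriv_part w = d" using DERIV_imp_deriv by blast
  with d show "(eta_log_deriv_part has_field_derivative deriv eta_log_deriv_part w) (at w within {w. Re w \<ge> 5 / 2})" "norm (deriv eta_log_deriv_part w) \<le> 12 / 10"
    using has_field_derivative_at_within by auto
qed (use assms in auto)

lemma Im_lambda_deriv_of_real:
  assumes "j \<le> 2" "u > 2"
  shows "Im (lambda_deriv j (of_real u)) = 0"
proof -
  have "Im (odd_term j k (of_real u)) = 0" for k
  proof -
    have "odd_term j k (of_real u) = of_real ((- ln (2 * real k + 1)) ^ j * real (2 * k + 1) powr (- u))"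
      using powr_of_real[of "real (2 * k + 1)" "- u"] by (simp add: odd_term_def add_ac)
    then show ?thesis by (simp only: Im_complex_of_real)
  qed
  moreover have "(\<lambda>k. odd_term j k (of_real u)) sums lambda_deriv j (of_real u)"
    unfolding lambda_deriv_def by (intro summable_sums summable_odd_term assms(1)) (use assms in simp)
  from sums_Im[OF this] have "(\<lambda>k. Im (odd_term j k (of_real u))) sums Im (lambda_deriv j (of_real u))" .
  ultimately show ?thesis by (simp add: sums_iff)
qed

lemma Im_eta_log_deriv_part_of_real:
  assumes "u \<ge> 5 / 2"
  shows "Im (eta_log_deriv_part (of_real u)) = 0"
proof -
  have "Im (lambda_deriv j (of_real u)) = 0" if "j \<le> 2" for j
    using Im_lambda_deriv_of_real[OF that] assms by simp
  from this[of 0] this[of 1] show ?thesis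
    using assms by (simp add: eta_log_deriv_part_def Polygamma_of_real Im_divide)
qed

section \<open>The tangent against the Digamma function\<close>

lemma Im_Digamma_le:
  assumes x: "x \<ge> 1" and y: "y > 0"
  shows "Im (Digamma (Complex x y)) \<le> pi / 2 - arctan ((x - 1) / y)"
proof -
  define z where "z = Complex x y"
  have z0: "z \<noteq> 0" using y by (auto simp: z_def complex_eq_iff)
  have step: "y / (t\<^sup>2 + y\<^sup>2) \<le> arctan (t / y) - arctan ((t - 1) / y)" if t: "t \<ge> 1" for t
  proof -
    have "((\<lambda>t. arctan (t / y)) has_real_derivative y / (c\<^sup>2 + y\<^sup>2)) (at c)" for c
    proof -
      have "inverse (1 + (c / y)\<^sup>2) * (1 / y) = y / (c\<^sup>2 + y\<^sup>2)"
        using y by (simp add: field_simps power2_eq_square)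
      moreover have "((\<lambda>t. arctan (t / y)) has_real_derivative inverse (1 + (c / y)\<^sup>2) * (1 / y)) (at c)"
        using y by (auto intro!: derivative_eq_intros)
      ultimately show ?thesis by simp
    qed
    from MVT2[of "t - 1" t "\<lambda>t. arctan (t / y)", OF _ this]
    obtain c where c: "t - 1 < c" "c < t" "arctan (t / y) - arctan ((t - 1) / y) = y / (c\<^sup>2 + y\<^sup>2)"
      by auto
    have "c\<^sup>2 \<le> t\<^sup>2" using c t by (intro power_mono) auto
    then show ?thesis unfolding c(3) using y by (intro frac_le) (auto intro: add_nonneg_pos)
  qed
  have sum_le: "(\<Sum>n<m. y / ((x + real n)\<^sup>2 + y\<^sup>2)) \<le> arctan ((x + real m - 1) / y) - arctan ((x - 1) / y)" for m
  proof (induction m)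
    case (Suc m)
    then show ?case using step[of "x + m"] x by (simp add: add_ac)
  qed simp
  have "(\<lambda>m. of_real (ln (real m)) - (\<Sum>n<m. inverse (z + of_nat n))) \<longlonglongrightarrow> Digamma z"
    by (rule Digamma_LIMSEQ[OF z0])
  from tendsto_Im[OF this]
  have lim: "(\<lambda>m. \<Sum>n<m. y / ((x + real n)\<^sup>2 + y\<^sup>2)) \<longlonglongrightarrow> Im (Digamma z)"
    by (simp add: z_def sum_negf)
  have "Im (Digamma z) \<le> pi / 2 - arctan ((x - 1) / y)"
  proof (rule LIMSEQ_le_const2[OF lim], intro exI allI impI)
    fix m :: nat
    show "(\<Sum>n<m. y / ((x + real n)\<^sup>2 + y\<^sup>2)) \<le> pi / 2 - arctan ((x - 1) / y)"
      using sum_le[of m] arctan_ubound[of "(x + real m - 1) / y"] by linarith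
  qed
  then show ?thesis by (simp add: z_def)
qed

text \<open>The bound is \<open>tanh y\<close>: the denominator of the imaginary part is at most
  \<open>(cosh y)^2\<close>.\<close>

lemma Im_tan_ge:
  assumes y: "y > 0" and z: "Im z = y"
  shows "Im (tan z) \<ge> 1 - 2 / (exp (2 * y) + 1)"
proof -
  have c0: "cos z \<noteq> 0"
  proof
    assume "cos z = 0"
    then obtain n where "z = of_real (of_int n * pi) + of_real pi / 2" unfolding cos_eq_0 by auto
    then have "Im z = 0" by simp
    with y z show False by simp
  qed
  have sh: "sinh y > 0" "cosh y > 0" using y by auto
  define p q where "p = exp y" and "q = exp (- y)"
  have pq: "p > 0" "q > 0" "p * q = 1" "exp (2 * y) = p * p"
    using exp_add[of y y] by (auto simp: p_def q_def simp flip: exp_add)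
  have "1 - 2 / (exp (2 * y) + 1) = sinh y / cosh y"
  proof -
    have "p * p + 1 = p * (p + q)" "p * p - 1 = p * (p - q)" using pq by (simp_all add: algebra_simps)
    moreover have "1 - 2 / (p * p + 1) = (p * p - 1) / (p * p + 1)"
      using pq add_pos_pos[of "p * p" 1] by (simp add: field_simps)
    ultimately have "1 - 2 / (exp (2 * y) + 1) = (p - q) / (p + q)" using pq by simp
    moreover have "a / b = (a / 2) / (b / 2)" for a b :: real by simp
    ultimately show ?thesis unfolding sinh_field_def cosh_field_def p_def q_def by metis
  qed
  also have "\<dots> = sinh y * cosh y / (cosh y)\<^sup>2" using sh by (simp add: power2_eq_square)
  also have "\<dots> \<le> sinh y * cosh y / ((cos (Re z))\<^sup>2 + (sinh y)\<^sup>2)"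
  proof (rule divide_left_mono)
    have "(cos (Re z))\<^sup>2 \<le> 1" by (simp add: abs_square_le_1)
    then show "(cos (Re z))\<^sup>2 + (sinh y)\<^sup>2 \<le> (cosh y)\<^sup>2" by (simp add: cosh_square_eq)
    have "(sinh y)\<^sup>2 > 0" using sh by simp
    then show "0 < (cosh y)\<^sup>2 * ((cos (Re z))\<^sup>2 + (sinh y)\<^sup>2)"
      using sh by (intro mult_pos_pos add_nonneg_pos) auto
  qed (use sh in auto)
  finally show ?thesis using tan_parts(2)[OF c0] z by simp
qed

lemma arctan_ge:
  assumes "x > 0"
  shows "x / (1 + x\<^sup>2) \<le> arctan x"
proof -
  from MVT2[of 0 x arctan "\<lambda>c. inverse (1 + c\<^sup>2)", OF assms DERIV_arctan]
  obtain c where c: "0 < c" "c < x" "arctan x = x * inverse (1 + c\<^sup>2)" by auto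
  have "c\<^sup>2 \<le> x\<^sup>2" using c by (intro power_mono) auto
  then have "x * inverse (1 + x\<^sup>2) \<le> x * inverse (1 + c\<^sup>2)"
    using assms by (intro mult_left_mono le_imp_inverse_le) (auto intro: add_pos_nonneg)
  then show ?thesis unfolding c(3) by (simp add: divide_inverse)
qed

lemma exp_1_plus_ge:
  fixes x :: real
  assumes "x \<ge> 0"
  shows "exp (1 + x) \<ge> 27 / 10 * (1 + x + x\<^sup>2 / 2)"
  unfolding exp_add using assms exp_1_ge by (intro mult_mono exp_lower_Taylor_quadratic) auto

text \<open>Near the real axis both sides vanish linearly in \<open>v\<close>, so slopes are
  compared: 6/5 against nearly \<open>pi^2 / 4\<close>, reduced by \<open>1 + y\<close>. Further up,
  \<open>pi / 2\<close> bounds the Digamma part and is also the limit of the tangent part; it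
  cancels, and only the corrections have to be compared.\<close>

lemma Im_eta_log_deriv_part_less:
  assumes w: "Re w \<ge> 5 / 2" "Im w > 0" "Im w \<le> 33 / 10"
  shows "Im (eta_log_deriv_part w) < pi / 2 * Im (tan (of_real (pi / 2) * w))"
proof -
  define v where "v = Im w"
  have v: "v > 0" "v \<le> 33 / 10" using w by (auto simp: v_def)
  define T where "T = 2 / (exp (pi * v) + 1)"
  have "Im (of_real (pi / 2) * w) = pi / 2 * v" by (simp add: v_def)
  from Im_tan_ge[OF _ this] have "1 - T \<le> Im (tan (of_real (pi / 2) * w))" using v by (simp add: T_def)
  then have tan: "pi / 2 * (1 - T) \<le> pi / 2 * Im (tan (of_real (pi / 2) * w))" by (intro mult_left_mono) auto
  have pi: "31415 / 10000 \<le> pi" "pi \<le> 31416 / 10000" using pi_approx by (simp_all add: abs_le_iff)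
  have "Im (eta_log_deriv_part w) < pi / 2 * (1 - T)"
  proof (cases "v \<le> 1 / 2")
    case True
    define y where "y = pi / 2 * v"
    have y: "y > 0" using v by (simp add: y_def)
    have y2: "y \<le> 31416 / 20000 * (1 / 2)" unfolding y_def using True v pi by (intro mult_mono) auto
    have "exp (pi * v) + 1 \<ge> 2 + 2 * y" using exp_ge_add_one_self[of "pi * v"] by (simp add: y_def)
    then have "T \<le> 2 / (2 + 2 * y)" unfolding T_def using y by (intro frac_le) auto
    moreover have "2 / (2 + 2 * y) = 1 - y / (1 + y)" using y by (simp add: field_simps)
    ultimately have "y / (1 + y) \<le> 1 - T" by simp
    then have "pi / 2 * (y / (1 + y)) \<le> pi / 2 * (1 - T)" by (intro mult_left_mono) auto
    moreover have "12 / 10 * v < pi / 2 * (y / (1 + y))"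
    proof -
      have "12 / 10 * (1 + y) < (31415 / 20000) * (31415 / 20000)" using y2 by simp
      also have "\<dots> \<le> (pi / 2) * (pi / 2)" using pi by (intro mult_mono) auto
      finally have "12 / 10 * (1 + y) * v < (pi / 2) * (pi / 2) * v" using v by (intro mult_strict_right_mono)
      then show ?thesis using y by (simp add: y_def field_simps)
    qed
    moreover have "Im (eta_log_deriv_part w) \<le> 12 / 10 * v"
    proof -
      have "w - of_real (Re w) = \<i> * of_real v" by (simp add: complex_eq_iff v_def)
      then have "norm (w - of_real (Re w)) = v" using v by (simp add: norm_mult)
      then have "norm (eta_log_deriv_part w - eta_log_deriv_part (of_real (Re w))) \<le> 12 / 10 * v"
        using eta_log_deriv_part_lipschitz[of w "of_real (Re w)"] w by simp
      then show ?thesis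
        using abs_Im_le_cmod[of "eta_log_deriv_part w - eta_log_deriv_part (of_real (Re w))"] Im_eta_log_deriv_part_of_real[of "Re w"] w by simp
    qed
    ultimately show ?thesis by linarith
  next
    case False
    then have v1: "v > 1 / 2" by simp
    have "Im (Digamma (Complex (Re w) v)) \<le> pi / 2 - arctan ((Re w - 1) / v)"
      by (rule Im_Digamma_le) (use w v in auto)
    moreover have "arctan ((3 / 2) / v) \<le> arctan ((Re w - 1) / v)"
      using w v unfolding arctan_le_iff by (intro divide_right_mono) auto
    moreover have "Im (lambda_deriv 1 w / lambda_deriv 0 w) \<le> 221 / 1000"
      using norm_lambda_quotient_le[OF w(1)] abs_Im_le_cmod[of "lambda_deriv 1 w / lambda_deriv 0 w"] by linarith
    moreover have "Complex (Re w) v = w" by (simp add: v_def)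
    ultimately have P: "Im (eta_log_deriv_part w) \<le> pi / 2 - arctan ((3 / 2) / v) + 221 / 1000" by (simp add: eta_log_deriv_part_def)
    \<comment> \<open>As \<open>v\<close> grows, the arctangent decreases but so does
      \<open>T\<close>. Splitting at \<open>v = 1\<close> fits both: below 1 the arctangent is at
      least \<open>pi / 4\<close>, above 1 the exponential in \<open>T\<close> is at least
      \<open>exp 3\<close>.\<close>
    have "pi / 2 * T + 221 / 1000 < arctan ((3 / 2) / v)"
    proof (cases "v \<le> 1")
      case True
      have "1 + 57 / 100 \<le> pi * v"
      proof -
        have "pi * (1 / 2) \<le> pi * v" using v1 by (intro mult_left_mono) auto
        then show ?thesis using pi by linarith
      qed
      then have "exp (1 + 57 / 100) \<le> exp (pi * v)" by simp
      then have "exp (pi * v) \<ge> 27 / 10 * (1 + 57 / 100 + (57 / 100)\<^sup>2 / 2)"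
        using exp_1_plus_ge[of "57 / 100"] by linarith
      then have "exp (pi * v) + 1 \<ge> 56 / 10" by (simp add: power2_eq_square)
      then have "T \<le> 2 / (56 / 10)" unfolding T_def by (intro frac_le) auto
      then have "pi / 2 * T \<le> 31416 / 20000 * (2 / (56 / 10))" using pi by (intro mult_mono) (auto simp: T_def)
      then have "pi / 2 * T < 564 / 1000" by simp
      moreover have "785 / 1000 \<le> pi / 4" using pi by simp
      moreover have "arctan 1 \<le> arctan ((3 / 2) / v)" unfolding arctan_le_iff using True v by (simp add: field_simps)
      ultimately show ?thesis unfolding arctan_one by linarith
    next
      case False
      have "pi * 1 \<le> pi * v" using False by (intro mult_left_mono) auto
      then have "3 \<le> pi * v" using pi_gt3 by linarith
      then have "exp 3 \<le> exp (pi * v)" by simp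
      moreover have "(27 / 10) ^ 3 \<le> exp (1 :: real) ^ 3" by (intro power_mono exp_1_ge) auto
      moreover have "exp (1 :: real) ^ 3 = exp 3" by (simp flip: exp_of_nat_mult)
      ultimately have "exp (pi * v) \<ge> (27 / 10) ^ 3" by linarith
      then have "exp (pi * v) + 1 \<ge> 206 / 10" by (simp add: power3_eq_cube)
      then have "T \<le> 2 / (206 / 10)" unfolding T_def by (intro frac_le) auto
      then have "pi / 2 * T \<le> 31416 / 20000 * (2 / (206 / 10))" using pi by (intro mult_mono) (auto simp: T_def)
      then have "pi / 2 * T \<le> 154 / 1000" by simp
      \<comment> \<open>The argument 5/11 is \<open>(3/2) / (33/10)\<close>, the value at the
        greatest height.\<close>
      moreover have "(5 / 11) / (1 + (5 / 11)\<^sup>2) \<le> arctan (5 / 11)" by (rule arctan_ge) simp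
      then have "376 / 1000 \<le> arctan (5 / 11)" by (simp add: power2_eq_square)
      moreover have "arctan (5 / 11) \<le> arctan ((3 / 2) / v)" using v by (simp add: arctan_le_iff field_simps)
      ultimately show ?thesis by linarith
    qed
    then show ?thesis using P by (simp add: right_diff_distrib)
  qed
  with tan show ?thesis by linarith
qed

text \<open>Every factor of the product for \<eta> is nonzero at \<open>w\<close>, so a zero of the
  derivative is a zero of the logarithmic derivative. This serves non-real and real zeros
  alike.\<close>

lemma log_deriv_eta_eq_0:
  assumes w: "Re w \<ge> 5 / 2" "cos (of_real (pi / 2) * w) \<noteq> 0" and z: "deriv dirichlet_eta (1 - w) = 0"
  shows "eta_log_deriv_part w = of_real (ln pi) + of_real (pi / 2) * tan (of_real (pi / 2) * w)"
proof -
  define E where "E = (\<lambda>w. - 2 * of_real pi powr (-w) * cos (of_real (pi / 2) * w) * Gamma w * lambda_deriv 0 w)"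
  define \<kappa> where "\<kappa> = 0 + - of_real (ln pi) + - (of_real (pi / 2) * tan (of_real (pi / 2) * w))
     + Digamma w + lambda_deriv 1 w / lambda_deriv 0 w"
  have wn: "w \<notin> \<int>\<^sub>\<le>\<^sub>0" using w by (intro Re_pos_not_nonpos_Ints) simp
  have l0: "lambda_deriv 0 w \<noteq> 0" by (rule lambda_deriv_0_nonzero[OF w(1)])
  have 0: "((\<lambda>w. - 2) has_field_derivative - 2 * 0) (at w)" by simp
  have 1: "((\<lambda>w. of_real pi powr (-w)) has_field_derivative of_real pi powr (-w) * - of_real (ln pi)) (at w)"
    by (rule DERIV_cong[OF has_field_derivative_of_real_powr[OF pi_gt_zero, where f' = "- 1"]])
      (auto intro!: derivative_eq_intros)
  have 2: "((\<lambda>w. cos (of_real (pi / 2) * w)) has_field_derivative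
      cos (of_real (pi / 2) * w) * - (of_real (pi / 2) * tan (of_real (pi / 2) * w))) (at w)"
    using w by (auto intro!: derivative_eq_intros simp: tan_def)
  have 3: "(Gamma has_field_derivative Gamma w * Digamma w) (at w)"
    using wn by (auto intro!: derivative_eq_intros)
  have 4: "(lambda_deriv 0 has_field_derivative lambda_deriv 0 w * (lambda_deriv 1 w / lambda_deriv 0 w)) (at w)"
    using lambda_deriv_has_field_derivative[of 0 w] w l0 by simp
  have "(E has_field_derivative E w * \<kappa>) (at w)"
    unfolding E_def \<kappa>_def by (intro log_deriv_mult 0 1 2 3 4)
  moreover have "(E has_field_derivative 0) (at w)"
  proof -
    have "((\<lambda>w. dirichlet_eta (1 - w)) has_field_derivative deriv dirichlet_eta (1 - w) * (- 1)) (at w)"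
      using holomorphic_derivI[OF dirichlet_eta_holomorphic open_UNIV, of "1 - w"]
      by (rule DERIV_chain2) (auto intro!: derivative_eq_intros)
    then have "((\<lambda>w. dirichlet_eta (1 - w)) has_field_derivative 0) (at w)" by (simp add: z)
    then show ?thesis
      by (rule has_field_derivative_transform_within_open[where S = "{w. Re w > 1}"])
        (use w in \<open>auto simp: open_halfspace_Re_gt E_def eta_eq_lambda\<close>)
  qed
  ultimately have "E w * \<kappa> = 0" by (rule DERIV_unique)
  moreover have "E w \<noteq> 0" using w l0 Gamma_nonzero[OF wn] by (simp add: E_def)
  ultimately have "\<kappa> = 0" by simp
  then show ?thesis by (simp add: \<kappa>_def eta_log_deriv_part_def algebra_simps add_eq_0_iff2)
qed

text \<open>The term \<open>ln pi\<close> is real, so taking imaginary parts contradicts the strict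
  inequality for the tangent.\<close>

lemma deriv_eta_nonzero_left:
  assumes s: "Re s \<le> - 3 / 2" "Im s < 0" "Im s \<ge> - 33 / 10"
  shows "deriv dirichlet_eta s \<noteq> 0"
proof
  assume "deriv dirichlet_eta s = 0"
  then have "deriv dirichlet_eta (1 - (1 - s)) = 0" by simp
  from log_deriv_eta_eq_0[OF _ cos_half_pi_nonzero this]
  have "eta_log_deriv_part (1 - s) = of_real (ln pi) + of_real (pi / 2) * tan (of_real (pi / 2) * (1 - s))"
    using s by simp
  moreover have "Im (of_real a + of_real b * z) = b * Im z" for a b z by simp
  ultimately have "Im (eta_log_deriv_part (1 - s)) = pi / 2 * Im (tan (of_real (pi / 2) * (1 - s)))" by simp
  moreover have "Im (eta_log_deriv_part (1 - s)) < pi / 2 * Im (tan (of_real (pi / 2) * (1 - s)))"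
    by (rule Im_eta_log_deriv_part_less) (use s in auto)
  ultimately show False by simp
qed

text \<open>Conjugation on both sides preserves the defining Dirichlet series, so the uniqueness of
  the continuation applies.\<close>

lemma dirichlet_eta_cnj: "dirichlet_eta (cnj s) = cnj (dirichlet_eta s)"
proof -
  have "cnj \<circ> dirichlet_eta \<circ> cnj = dirichlet_eta"
  proof (rule dirichlet_eta_unique)
    show "cnj \<circ> dirichlet_eta \<circ> cnj holomorphic_on UNIV"
      by (intro holomorphic_on_compose_cnj_cnj dirichlet_eta_holomorphic) auto
    fix s :: complex assume s: "Re s > 0"
    have "(\<lambda>n. cnj ((-1) ^ n * of_nat (Suc n) powr (- cnj s))) sums cnj (dirichlet_eta (cnj s))"
      unfolding sums_cnj by (rule dirichlet_eta_sums) (use s in simp)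
    moreover have "cnj ((-1) ^ n * of_nat (Suc n) powr (- cnj s)) = (-1) ^ n * of_nat (Suc n) powr (-s)" for n
      using cnj_powr[of "of_nat (Suc n)" "- cnj s"] by simp
    ultimately show "(\<lambda>n. (-1) ^ n * of_nat (Suc n) powr (-s)) sums (cnj \<circ> dirichlet_eta \<circ> cnj) s" by simp
    show "(\<lambda>n. (-1) ^ n * of_nat (Suc n) powr (-s)) sums dirichlet_eta s" by (rule dirichlet_eta_sums[OF s])
  qed (rule dirichlet_eta_holomorphic)
  then have "cnj (dirichlet_eta (cnj (cnj s))) = dirichlet_eta (cnj s)" unfolding fun_eq_iff o_def by blast
  then show ?thesis by simp
qed

lemma deriv_dirichlet_eta_cnj: "deriv dirichlet_eta (cnj s) = cnj (deriv dirichlet_eta s)"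
proof -
  have "(dirichlet_eta has_field_derivative deriv dirichlet_eta s) (at (cnj (cnj s)))"
    using holomorphic_derivI[OF dirichlet_eta_holomorphic open_UNIV, of s] by simp
  from has_field_derivative_cnj_cnj[OF this]
  have "(dirichlet_eta has_field_derivative cnj (deriv dirichlet_eta s)) (at (cnj s))"
    by (simp add: o_def dirichlet_eta_cnj[symmetric])
  then show ?thesis by (rule DERIV_imp_deriv)
qed

lemma deriv_eta_zero_real:
  assumes s: "Re s \<le> 0" "deriv dirichlet_eta s = 0"
  shows "s \<in> \<real>"
proof (rule ccontr)
  assume "s \<notin> \<real>"
  then have im: "Im s \<noteq> 0" by (simp add: complex_is_Real_iff)
  \<comment> \<open>The negative imaginary part matches the upper half-plane for
    \<open>w = 1 - s\<close>; only the box estimate is stated for the conjugate point.\<close>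
  define t where "t = (if Im s < 0 then s else cnj s)"
  have t: "Re t \<le> 0" "Im t < 0" "deriv dirichlet_eta t = 0" "deriv dirichlet_eta (cnj t) = 0"
    using s im by (auto simp: t_def deriv_dirichlet_eta_cnj)
  consider "Im t \<le> - 33 / 10" | "Im t \<ge> - 33 / 10" "Re t \<le> - 3 / 2" | "Im t \<ge> - 33 / 10" "Re t \<ge> - 3 / 2"
    by fastforce
  then show False
  proof cases
    case 1
    then show ?thesis using deriv_eta_nonzero_high t by blast
  next
    case 2
    then show ?thesis using deriv_eta_nonzero_left t by blast
  next
    case 3
    then show ?thesis using deriv_eta_nonzero_box[of "cnj t"] t by simp
  qed
qed

section \<open>The real zeros\<close>

lemma cos_half_pi_odd: "cos (of_real (pi / 2) * of_real (real (2 * k + 1)) :: complex) = 0"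
proof -
  have "pi / 2 * real (2 * k + 1) = real k * pi + pi / 2" by (simp add: field_simps)
  then have "cos (pi / 2 * real (2 * k + 1)) = 0" by (simp only: cos_add) simp
  then show ?thesis by (metis cos_of_real of_real_0 of_real_mult)
qed

lemma dirichlet_eta_even_zero:
  assumes "k > 0"
  shows "dirichlet_eta (of_real (- 2 * real k)) = 0"
proof -
  have Re: "Re (of_real (real (2 * k + 1))) > 1" using assms by simp
  have "dirichlet_eta (1 - of_real (real (2 * k + 1))) = 0"
    unfolding eta_eq_lambda[OF Re, unfolded cos_half_pi_odd] by simp
  moreover have "1 - of_real (real (2 * k + 1)) = (of_real (- 2 * real k) :: complex)" by simp
  ultimately show ?thesis by simp
qed

lemma cos_half_pi_nonzero_real:
  assumes "2 * real n + 1 < x" "x < 2 * real n + 3"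
  shows "cos (pi / 2 * x) \<noteq> 0"
proof -
  define y where "y = pi / 2 * (x - 2 * real (Suc n))"
  have "pi / 2 * x = y + real (Suc n) * pi" by (simp add: y_def field_simps)
  then have "cos (pi / 2 * x) = (- 1) ^ Suc n * cos y"
    by (simp only: cos_add cos_npi sin_npi) simp
  moreover have "cos y > 0"
  proof (rule cos_gt_zero_pi)
    have "pi / 2 * (- 1) < pi / 2 * (x - 2 * real (Suc n))" using assms by (intro mult_strict_left_mono) auto
    then show "- (pi / 2) < y" by (simp add: y_def)
    have "pi / 2 * (x - 2 * real (Suc n)) < pi / 2 * 1" using assms by (intro mult_strict_left_mono) auto
    then show "y < pi / 2" by (simp add: y_def)
  qed
  ultimately show ?thesis by simp
qed

lemma Re_of_real_derivative:
  assumes "(f has_field_derivative d) (at (of_real x))"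
  shows "((\<lambda>x. Re (f (of_real x))) has_real_derivative Re d) (at x)"
  using bounded_linear.has_vector_derivative[OF bounded_linear_Re has_vector_derivative_real_field[OF assms]]
  by (simp add: has_real_derivative_iff_has_vector_derivative)

lemma deriv_eta_zero_exists:
  assumes n: "n > 0"
  shows "\<exists>x \<in> {- 2 * real n - 2 <..< - 2 * real n}. deriv dirichlet_eta (of_real x) = 0"
proof -
  define f where "f = (\<lambda>x::real. Re (dirichlet_eta (of_real x)))"
  have der: "(f has_real_derivative Re (deriv dirichlet_eta (of_real x))) (at x)" for x
  proof -
    have "(dirichlet_eta has_field_derivative deriv dirichlet_eta (of_real x)) (at (of_real x))"
      using holomorphic_derivI[OF dirichlet_eta_holomorphic open_UNIV] by simp
    from Re_of_real_derivative[OF this] show ?thesis by (simp add: f_def)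
  qed
  have "f (- 2 * real n - 2) = f (- 2 * real n)"
  proof -
    have "f (- 2 * real k) = 0" if "k > 0" for k
      unfolding f_def dirichlet_eta_even_zero[OF that] by simp
    moreover have "- 2 * real n - 2 = - 2 * real (Suc n)" by simp
    ultimately show ?thesis using n by (metis zero_less_Suc)
  qed
  then obtain x where x: "- 2 * real n - 2 < x" "x < - 2 * real n" "(f has_real_derivative 0) (at x)"
    using Rolle[of "- 2 * real n - 2" "- 2 * real n" f] der
    by (metis DERIV_isCont continuous_at_imp_continuous_on real_differentiable_def diff_less_eq less_add_same_cancel1 zero_less_numeral)
  then have "Re (deriv dirichlet_eta (of_real x)) = 0" using der DERIV_unique by blast
  moreover have "Im (deriv dirichlet_eta (of_real x)) = 0"
    using deriv_dirichlet_eta_cnj[of "of_real x"] by (simp add: complex_eq_iff)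
  ultimately show ?thesis using x by (intro bexI[of _ x]) (auto simp: complex_eq_iff)
qed

lemma deriv_eta_zero_unique:
  assumes n: "n > 0"
    and x: "x \<in> {- 2 * real n - 2 <..< - 2 * real n}" "deriv dirichlet_eta (of_real x) = 0"
    and y: "y \<in> {- 2 * real n - 2 <..< - 2 * real n}" "deriv dirichlet_eta (of_real y) = 0"
    and xy: "x < y"
  shows False
proof -
  \<comment> \<open>At each zero \<open>z\<close> of \<eta>' in the interval
    \<open>D (1 - z)\<close> equals \<open>ln pi\<close>. The reflected interval from
    \<open>2 n + 1\<close> to \<open>2 n + 3\<close> lies between consecutive poles of the tangent
    and to the right of 5/2, so strict monotonicity of \<open>D\<close> leaves room for one
    zero.\<close>
  define D where "D = (\<lambda>t. Re (eta_log_deriv_part (of_real t)) - pi / 2 * tan (pi / 2 * t))"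
  have D: "D (1 - z) = ln pi" if z: "z \<in> {- 2 * real n - 2 <..< - 2 * real n}" "deriv dirichlet_eta (of_real z) = 0" for z
  proof -
    have "deriv dirichlet_eta (1 - of_real (1 - z)) = 0" using z by simp
    moreover have "cos (of_real (pi / 2) * of_real (1 - z)) \<noteq> (0::complex)"
    proof -
      have "cos (pi / 2 * (1 - z)) \<noteq> 0" by (rule cos_half_pi_nonzero_real[of n]) (use z in auto)
      then show ?thesis by (simp only: cos_of_real of_real_eq_0_iff not_False_eq_True flip: of_real_mult)
    qed
    ultimately have "eta_log_deriv_part (of_real (1 - z)) = of_real (ln pi) + of_real (pi / 2) * tan (of_real (pi / 2) * of_real (1 - z))"
      using z n by (intro log_deriv_eta_eq_0) auto
    also have "\<dots> = of_real (ln pi + pi / 2 * tan (pi / 2 * (1 - z)))" by (simp only: of_real_add of_real_mult tan_of_real)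
    finally show ?thesis by (simp only: D_def Re_complex_of_real)
  qed
  have "D (1 - x) < D (1 - y)"
  proof (rule DERIV_neg_imp_decreasing[where f = D])
    show "1 - y < 1 - x" using xy by simp
    fix t assume "1 - y \<le> t" "t \<le> 1 - x"
    then have t: "2 * real n + 1 < t" "t < 2 * real n + 3" using x y by auto
    have n1: "real n \<ge> 1" using n by simp
    obtain d where d: "(eta_log_deriv_part has_field_derivative d) (at (of_real t))" "norm d \<le> 12 / 10"
      using eta_log_deriv_part_deriv[of "of_real t"] t n1 by auto
    have 1: "((\<lambda>t. Re (eta_log_deriv_part (of_real t))) has_real_derivative Re d) (at t)"
      by (rule Re_of_real_derivative[OF d(1)])
    have c: "cos (pi / 2 * t) \<noteq> 0" by (rule cos_half_pi_nonzero_real[OF t])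
    have 2: "((\<lambda>t. pi / 2 * tan (pi / 2 * t)) has_real_derivative
        pi / 2 * (inverse ((cos (pi / 2 * t))\<^sup>2) * (pi / 2))) (at t)"
      using c by (auto intro!: derivative_eq_intros)
    have "(cos (pi / 2 * t))\<^sup>2 \<le> 1" by (simp add: abs_square_le_1)
    then have "1 \<le> inverse ((cos (pi / 2 * t))\<^sup>2)" using c by (intro one_le_inverse) auto
    \<comment> \<open>With \<open>pi > 3\<close> the tangent term has slope at least 9/4, against at
      most 12/10 for the other term.\<close>
    then have "3 / 2 * (1 * (3 / 2)) \<le> pi / 2 * (inverse ((cos (pi / 2 * t))\<^sup>2) * (pi / 2))"
      using pi_gt3 by (intro mult_mono) auto
    moreover have "Re d \<le> 12 / 10" using d complex_Re_le_cmod[of d] by linarith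
    ultimately have "Re d - pi / 2 * (inverse ((cos (pi / 2 * t))\<^sup>2) * (pi / 2)) < 0" by simp
    then show "\<exists>y. (D has_real_derivative y) (at t) \<and> y < 0"
      unfolding D_def using DERIV_diff[OF 1 2] by blast
  qed
  then show False using D[OF x] D[OF y] by simp
qed

theorem theorem5p4:
  shows "(\<forall>s. Re s \<le> 0 \<and> deriv dirichlet_eta s = 0 \<longrightarrow> s \<in> \<real>) \<and>
    (\<forall>n::nat. n > 0 \<longrightarrow>
      (\<exists>!x::real. x \<in> {- 2 * real n - 2 <..< - 2 * real n} \<and>
        deriv dirichlet_eta (of_real x) = 0))"
proof (intro conjI allI impI)
  fix n :: nat assume n: "n > 0"
  show "\<exists>!x::real. x \<in> {- 2 * real n - 2 <..< - 2 * real n} \<and> deriv dirichlet_eta (of_real x) = 0"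
    using deriv_eta_zero_exists[OF n] deriv_eta_zero_unique[OF n] by (metis linorder_neqE_linordered_idom)
qed (use deriv_eta_zero_real in blast)

end
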